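(* Consider the adaptive algorithm AILFEM described in the context with arbitrary parameters $0<\theta\le 1$, $C_{\rm mark}\ge 1$, $\lambda_{\rm lin}>0$, $0<\rho<1$, $\alpha_{\min}>0$, $J_{\max}\in\mathbb N$, $\tau\ge0$, and arbitrary $u_0^{0,0}\in\mathcal X_0$. Let $0<C_{\rm nrg}<C_{\rm nrg}^\star$ be the constant specified in the context. Then there exists a constant $q_{\rm nrg}$ with $$0<q_{\rm nrg}\le1-\frac{2C_{\rm nrg}}{L}\,\frac{\alpha^2}{C_{\rm cnt}^2}\,(1-q_{\rm alg})^2<1$$ such that $$0\le\mathrm d^2(u_\ell^\star,u_\ell^{k,\underline j})\le q_{\rm nrg}\,\mathrm d^2(u_\ell^\star,u_\ell^{k-1,\underline j})\quad\text{for all }(\ell,k,\underline j)\in\mathcal Q\text{ with }k\ge1$$ and consequently $$\frac{1-q_{\rm nrg}}{q_{\rm nrg}}\,\mathrm d^2(u_\ell^\star,u_\ell^{k,\underline j})\le\mathrm d^2(u_\ell^{k,\underline j},u_\ell^{k-1,\underline j})\le\mathrm d^2(u_\ell^\star,u_\ell^{k-1,\underline j})\quad\text{for all }(\ell,k,\underline j)\in\mathcal Q\text{ with }k\ge1.$$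
   Context: **Problem.** $\Omega\subset\mathbb R^d$ ($d\ge1$) is a bounded Lipschitz domain, $\mathcal X=H^1_0(\Omega)$ with dual $\mathcal X'$, $|||v|||:=\|\nabla v\|_{L^2(\Omega)}$. $\mu:\mathbb R_{\ge0}\to\mathbb R_{\ge0}$ is $C^1$ and there are $0<\alpha\le L/3$ with $\alpha(t-s)\le\mu(t^2)t-\mu(s^2)s\le\frac L3(t-s)$ for all $t\ge s\ge0$. Data: $f\in L^2(\Omega)$, $\boldsymbol f\in[L^2(\Omega)]^d$. Set $\langle\mathcal Au,v\rangle:=\int_\Omega\mu(|\nabla u|^2)\nabla u\cdot\nabla v\,dx$, $F(v):=\int_\Omega fv\,dx+\int_\Omega\boldsymbol f\cdot\nabla v\,dx$. Then $\alpha|||u-v|||^2\le\langle\mathcal Au-\mathcal Av,u-v\rangle$ and $\langle\mathcal Au-\mathcal Av,w\rangle\le L|||u-v|||\,|||w|||$ for all $u,v,w\in\mathcal X$. For each closed subspace $\mathcal X_H\subseteq\mathcal X$, $u_H^\star\in\mathcal X_H$ is the unique solution of $\langle\mathcal Au_H^\star,v_H\rangle=F(v_H)$ for all $v_H\in\mathcal X_H$. Energy: $\mathcal E(v):=\frac12\int_\Omega\int_0^{|\nabla v|^2}\mu(t)\,dt\,dx-F(v)$; energy difference: $\mathrm d^2(v,w):=\mathcal E(w)-\mathcal E(v)$ (may be negative). **Meshes and spaces.** $\mathcal T_0$ is a conforming simplicial mesh of $\Omega$ (admissible for newest vertex bisection, NVB). $\mathtt{refine}(\mathcal T_H,\mathcal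 M_H)$ is the coarsest conforming NVB refinement of $\mathcal T_H$ in which at least all elements of $\mathcal M_H\subseteq\mathcal T_H$ are refined. For fixed $p\in\mathbb N$, $\mathcal X_H:=\{v\in H_0^1(\Omega): v|_T\text{ polynomial of degree}\le p\ \forall T\in\mathcal T_H\}$. Index $\ell$ refers to the mesh $\mathcal T_\ell$; $u_\ell^\star$ is the exact discrete solution in $\mathcal X_\ell$. **Linearization.** For each $u\in\mathcal X$, $a(u;\cdot,\cdot)$ is a symmetric bilinear form on $\mathcal X$ with $C_{\rm ell}|||v|||^2\le a(u;v,v)$ and $|a(u;v,w)|\le C_{\rm cnt}|||v|||\,|||w|||$, with $C_{\rm ell},C_{\rm cnt}>0$ independent of $u$. For $u_H\in\mathcal X_H$, $\Phi_H(u_H)\in\mathcal X_H$ is the unique solution of $a(u_H;\Phi_H(u_H),v_H)=a(u_H;u_H,v_H)+F(v_H)-\langle\mathcal Au_H,v_H\rangle$ for all $v_H\in\mathcal X_H$. It is assumed that there is $C_{\rm nrg}^\star>0$, independent of $\mathcal X_H$ and $u_H$, with $C_{\rm nrg}^\star|||\Phi_H(u_H)-u_H|||^2\le\mathrm d^2(\Phi_H(u_H),u_H)$ for all $u_H\in\mathcal X_H$. **Algebraic solver.** Given $u_H^{k,0}\in\mathcal X_H$ and $u_H^{k,\star}:=\Phi_H(u_H^{k,0})$, the solver is an iteration map $\Psi_H(u_H^{k,\star};\cdot):\mathcal X_H\to\mathcal X_H$ with iterates $u_H^{k,j}:=\Psi_H(u_H^{k,\star};u_H^{k,j-1})$ satisfying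 $|||u_H^{k,\star}-u_H^{k,j}|||\le q_{\rm alg}|||u_H^{k,\star}-u_H^{k,j-1}|||$ for all $j\ge1$, with $0<q_{\rm alg}<1$ independent of $\mathcal X_H$ and $u_H^{k,0}$. **Estimator.** For $T\in\mathcal T_H$, $v_H\in\mathcal X_H$, with $\boldsymbol A(\nabla v)=\mu(|\nabla v|^2)\nabla v$: $\eta_H(T,v_H)^2:=|T|^{2/d}\|f+\mathrm{div}(\boldsymbol A(\nabla v_H)-\boldsymbol f)\|_{L^2(T)}^2+|T|^{1/d}\|[\![(\boldsymbol A(\nabla v_H)-\boldsymbol f)\cdot n]\!]\|^2_{L^2(\partial T\cap\Omega)}$ (assumed well defined and finite), where $[\![\cdot]\!]$ is the jump across faces; $\eta_H(\mathcal U,v_H):=(\sum_{T\in\mathcal U}\eta_H(T,v_H)^2)^{1/2}$ for $\mathcal U\subseteq\mathcal T_H$, $\eta_H(v_H):=\eta_H(\mathcal T_H,v_H)$. **Algorithm AILFEM.** Input: $\mathcal T_0$, $u_0^{0,0}=u_0^{0,\underline j}=u_0^{0,\star}\in\mathcal X_0$, $\theta,C_{\rm mark},\lambda_{\rm lin},\rho,\tau$, and initial values of the variables $\alpha_{\min}>0$, $J_{\max}\in\mathbb N$. For $\ell=0,1,\dots$: (i) For $k=1,2,\dots$: (a) set $u_\ell^{k,0}:=u_\ell^{k-1,\underline j}$ and $u_\ell^{k,\star}:=\Phi_\ell(u_\ell^{k-1,\underline j})$ (not computed). (b) For $j=1,2,\dots$: compute $u_\ell^{k,j}$ from $u_\ell^{k,j-1}$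 by one solver step; if $\eta_\ell(u_\ell^{k,j})+|||u_\ell^{k,j}-u_\ell^{k-1,\underline j}|||+|||u_\ell^{k,j}-u_\ell^{k,j-1}|||\le\tau$, set $\underline\ell:=\ell$, $\underline k[\underline\ell]:=k$, $\underline j[\underline\ell,\underline k]:=j$ and terminate the algorithm; set $\alpha_\ell^{k,j}:=\mathrm d^2(u_\ell^{k,j},u_\ell^{k-1,\underline j})/|||u_\ell^{k,j}-u_\ell^{k-1,\underline j}|||^2$; leave the $j$-loop as soon as $\alpha_\ell^{k,j}\ge\alpha_{\min}$, or $u_\ell^{k,j}=u_\ell^{k-1,\underline j}$, or [$\alpha_\ell^{k,j}>0$ and $j>J_{\max}$]. (c) Set $\underline j[\ell,k]:=j$. (d) If $\underline j[\ell,k]>J_{\max}$, update $J_{\max}\leftarrow\underline j[\ell,k]$ and $\alpha_{\min}\leftarrow\rho\,\alpha_{\min}$. Leave the $k$-loop as soon as $\mathrm d^2(u_\ell^{k,\underline j},u_\ell^{k-1,\underline j})\le\lambda_{\rm lin}\,\eta_\ell(u_\ell^{k,\underline j})^2$. (ii) Set $\underline k[\ell]:=k$. (iii) Choose $\mathcal M_\ell\subseteq\mathcal T_\ell$ with $\theta\,\eta_\ell(u_\ell^{\underline k,\underline j})^2\le\eta_\ell(\mathcal M_\ell,u_\ell^{\underline k,\underline j})^2$ whose cardinality is at most $C_{\rm mark}$ times the minimal cardinality of sets with this property. (iv) $\mathcal T_{\ell+1}:=\mathtt{refine}(\mathcal T_\ell,\mathcal M_\ell)$, $u_{\ell+1}^{0,0}:=u_{\ell+1}^{0,\underline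 j}:=u_{\ell+1}^{0,\star}:=u_\ell^{\underline k,\underline j}$. **Indices.** $\mathcal Q\subset\mathbb N_0^3$ is the set of triples $(\ell,k,j)$ used by the algorithm (i.e., $u_\ell^{k,j}$ is defined). $\underline\ell,\underline k[\ell],\underline j[\ell,k]$ are the suprema (possibly $\infty$) of the indices $\ell$, of $k$ for given $\ell$, and of $j$ for given $(\ell,k)$, occurring in $\mathcal Q$; $\underline j[\ell,0]=0$. Arguments are omitted if clear: $u_\ell^{k,\underline j}=u_\ell^{k,\underline j[\ell,k]}$, $u_\ell^{\underline k,\underline j}=u_\ell^{\underline k[\ell],\underline j[\ell,\underline k[\ell]]}$, $(\ell,k,\underline j)=(\ell,k,\underline j[\ell,k])$. **Constant $C_{\rm nrg}$.** $0<C_{\rm nrg}<C_{\rm nrg}^\star$ is a constant with $C_{\rm nrg}|||u_\ell^{k,\underline j}-u_\ell^{k-1,\underline j}|||^2\le\mathrm d^2(u_\ell^{k,\underline j},u_\ell^{k-1,\underline j})$ for all $(\ell,k,0)\in\mathcal Q$ with $k\ge1$. The paper establishes that such a constant exists (for the same arbitrary parameters) and that $\underline j[\ell,k]$ is uniformly bounded. *)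

theory Defs
  imports "HOL-Analysis.Analysis" "HOL-Library.Extended_Nat"
begin

section \<open>Lebesgue and Sobolev spaces\<close>

text \<open>Elements of \<open>L\<^sup>2\<close> and Sobolev spaces are represented by functions on the whole space.
  Values outside the set under consideration are irrelevant, and equality of such elements is
  equality almost everywhere.\<close>

definition L2_on :: "'a::euclidean_space set \<Rightarrow> ('a \<Rightarrow> 'b::euclidean_space) \<Rightarrow> bool" where
  "L2_on S g \<longleftrightarrow> g \<in> borel_measurable (lebesgue_on S) \<and>
     integrable (lebesgue_on S) (\<lambda>x. (norm (g x))\<^sup>2)"

definition L2_norm :: "'a::euclidean_space set \<Rightarrow> ('a \<Rightarrow> 'b::euclidean_space) \<Rightarrow> real" where
  "L2_norm S g = sqrt (\<integral>x. (norm (g x))\<^sup>2 \<partial>lebesgue_on S)"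

definition ae_equal_on :: "'a::euclidean_space set \<Rightarrow> ('a \<Rightarrow> 'b) \<Rightarrow> ('a \<Rightarrow> 'b) \<Rightarrow> bool" where
  "ae_equal_on S u v \<longleftrightarrow> (AE x in lebesgue_on S. u x = v x)"

primrec C_k :: "nat \<Rightarrow> ('a::euclidean_space \<Rightarrow> real) \<Rightarrow> bool" where
  "C_k 0 \<phi> \<longleftrightarrow> continuous_on UNIV \<phi>"
| "C_k (Suc k) \<phi> \<longleftrightarrow> (\<forall>x. \<phi> differentiable (at x)) \<and>
     (\<forall>b\<in>Basis. C_k k (\<lambda>x. frechet_derivative \<phi> (at x) b))"

definition test_function :: "'a::euclidean_space set \<Rightarrow> ('a \<Rightarrow> real) \<Rightarrow> bool" where
  "test_function U \<phi> \<longleftrightarrow> (\<forall>k. C_k k \<phi>) \<and>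
     (\<exists>K. compact K \<and> K \<subseteq> U \<and> (\<forall>x. x \<notin> K \<longrightarrow> \<phi> x = 0))"

definition grad :: "('a::euclidean_space \<Rightarrow> real) \<Rightarrow> 'a \<Rightarrow> 'a" where
  "grad \<phi> x = (\<Sum>b\<in>Basis. frechet_derivative \<phi> (at x) b *\<^sub>R b)"

definition has_weak_grad ::
    "'a::euclidean_space set \<Rightarrow> ('a \<Rightarrow> real) \<Rightarrow> ('a \<Rightarrow> 'a) \<Rightarrow> bool" where
  "has_weak_grad U u g \<longleftrightarrow> L2_on U u \<and> L2_on U g \<and>
     (\<forall>\<phi>. test_function U \<phi> \<longrightarrow>
        (\<integral>x. u x *\<^sub>R grad \<phi> x \<partial>lebesgue_on U) = - (\<integral>x. \<phi> x *\<^sub>R g x \<partial>lebesgue_on U))"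

definition weak_grad :: "'a::euclidean_space set \<Rightarrow> ('a \<Rightarrow> real) \<Rightarrow> 'a \<Rightarrow> 'a" where
  "weak_grad U u = (SOME g. has_weak_grad U u g)"

definition has_weak_div ::
    "'a::euclidean_space set \<Rightarrow> ('a \<Rightarrow> 'a) \<Rightarrow> ('a \<Rightarrow> real) \<Rightarrow> bool" where
  "has_weak_div U G h \<longleftrightarrow> L2_on U G \<and> L2_on U h \<and>
     (\<forall>\<phi>. test_function U \<phi> \<longrightarrow>
        (\<integral>x. G x \<bullet> grad \<phi> x \<partial>lebesgue_on U) = - (\<integral>x. h x * \<phi> x \<partial>lebesgue_on U))"

definition weak_div :: "'a::euclidean_space set \<Rightarrow> ('a \<Rightarrow> 'a) \<Rightarrow> 'a \<Rightarrow> real" where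
  "weak_div U G = (SOME h. has_weak_div U G h)"

text \<open>The closure of the test functions with respect to the \<open>H\<^sup>1\<close> norm.\<close>

definition H10 :: "'a::euclidean_space set \<Rightarrow> ('a \<Rightarrow> real) set" where
  "H10 U = {u. \<exists>g. has_weak_grad U u g \<and>
     (\<exists>\<phi>. (\<forall>n. test_function U (\<phi> n)) \<and>
        (\<lambda>n::nat. L2_norm U (\<lambda>x. \<phi> n x - u x)) \<longlonglongrightarrow> 0 \<and>
        (\<lambda>n. L2_norm U (\<lambda>x. grad (\<phi> n) x - g x)) \<longlonglongrightarrow> 0)}"

text \<open>The Lipschitz function \<open>\<gamma>\<close> is constant in direction \<open>n\<close>, that is, a function of the
  remaining \<open>d - 1\<close> coordinates; near the boundary point the domain is its strict subgraph.\<close>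

definition lipschitz_domain :: "'a::euclidean_space set \<Rightarrow> bool" where
  "lipschitz_domain U \<longleftrightarrow> open U \<and> connected U \<and> U \<noteq> {} \<and>
     (\<forall>x\<in>frontier U. \<exists>n r C \<gamma>. norm n = 1 \<and> 0 < r \<and>
        C-lipschitz_on UNIV \<gamma> \<and> (\<forall>y t. \<gamma> (y + t *\<^sub>R n) = \<gamma> y) \<and>
        (\<forall>y\<in>ball x r. y \<in> U \<longleftrightarrow> y \<bullet> n < \<gamma> y))"

section \<open>The model problem\<close>

record 'a problem =
  Omega :: "'a set"
  mu :: "real \<Rightarrow> real"
  src :: "'a \<Rightarrow> real"
  flux :: "'a \<Rightarrow> 'a"

definition admissible_coefficient :: "(real \<Rightarrow> real) \<Rightarrow> real \<Rightarrow> real \<Rightarrow> bool" where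
  "admissible_coefficient m \<alpha> L \<longleftrightarrow>
     (\<forall>t\<ge>0. 0 \<le> m t) \<and>
     (\<exists>m'. (\<forall>t\<ge>0. (m has_real_derivative m' t) (at t within {0..})) \<and> continuous_on {0..} m') \<and>
     0 < \<alpha> \<and> \<alpha> \<le> L / 3 \<and>
     (\<forall>s t. 0 \<le> s \<and> s \<le> t \<longrightarrow>
        \<alpha> * (t - s) \<le> m (t\<^sup>2) * t - m (s\<^sup>2) * s \<and>
        m (t\<^sup>2) * t - m (s\<^sup>2) * s \<le> L / 3 * (t - s))"

definition model_problem :: "('a::euclidean_space) problem \<Rightarrow> real \<Rightarrow> real \<Rightarrow> bool" where
  "model_problem P \<alpha> L \<longleftrightarrow> lipschitz_domain (Omega P) \<and> bounded (Omega P) \<and>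
     admissible_coefficient (mu P) \<alpha> L \<and> L2_on (Omega P) (src P) \<and> L2_on (Omega P) (flux P)"

abbreviation nabla :: "('a::euclidean_space) problem \<Rightarrow> ('a \<Rightarrow> real) \<Rightarrow> 'a \<Rightarrow> 'a" where
  "nabla P \<equiv> weak_grad (Omega P)"

definition X_space :: "('a::euclidean_space) problem \<Rightarrow> ('a \<Rightarrow> real) set" where
  "X_space P = H10 (Omega P)"

definition tnorm :: "('a::euclidean_space) problem \<Rightarrow> ('a \<Rightarrow> real) \<Rightarrow> real" where
  "tnorm P v = L2_norm (Omega P) (nabla P v)"

definition tdist :: "('a::euclidean_space) problem \<Rightarrow> ('a \<Rightarrow> real) \<Rightarrow> ('a \<Rightarrow> real) \<Rightarrow> real" where
  "tdist P v w = tnorm P (\<lambda>x. v x - w x)"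

definition A_vec :: "('a::euclidean_space) problem \<Rightarrow> 'a \<Rightarrow> 'a" where
  "A_vec P y = mu P ((norm y)\<^sup>2) *\<^sub>R y"

definition A_op :: "('a::euclidean_space) problem \<Rightarrow> ('a \<Rightarrow> real) \<Rightarrow> ('a \<Rightarrow> real) \<Rightarrow> real" where
  "A_op P u v = (\<integral>x. mu P ((norm (nabla P u x))\<^sup>2) * (nabla P u x \<bullet> nabla P v x)
     \<partial>lebesgue_on (Omega P))"

definition F_rhs :: "('a::euclidean_space) problem \<Rightarrow> ('a \<Rightarrow> real) \<Rightarrow> real" where
  "F_rhs P v = (\<integral>x. src P x * v x \<partial>lebesgue_on (Omega P)) +
     (\<integral>x. flux P x \<bullet> nabla P v x \<partial>lebesgue_on (Omega P))"

definition energy :: "('a::euclidean_space) problem \<Rightarrow> ('a \<Rightarrow> real) \<Rightarrow> real" where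
  "energy P v =
     1 / 2 * (\<integral>x. integral {0..(norm (nabla P v x))\<^sup>2} (mu P) \<partial>lebesgue_on (Omega P)) - F_rhs P v"

definition d2 :: "('a::euclidean_space) problem \<Rightarrow> ('a \<Rightarrow> real) \<Rightarrow> ('a \<Rightarrow> real) \<Rightarrow> real" where
  "d2 P v w = energy P w - energy P v"

definition discrete_solution ::
    "('a::euclidean_space) problem \<Rightarrow> ('a \<Rightarrow> real) set \<Rightarrow> ('a \<Rightarrow> real) \<Rightarrow> bool" where
  "discrete_solution P V u \<longleftrightarrow> u \<in> V \<and> (\<forall>v\<in>V. A_op P u v = F_rhs P v)"

section \<open>Newest vertex bisection and finite element spaces\<close>

text \<open>A simplex is stored as the list of its vertices \<open>x\<^sub>0, \<dots>, x\<^sub>d\<close> together with a type in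
  \<open>{0, \<dots>, d - 1}\<close> (Maubach, Traxler, Stevenson); its refinement edge joins \<open>x\<^sub>0\<close> and \<open>x\<^sub>d\<close>.\<close>

type_synonym 'a tsimplex = "'a list \<times> nat"
type_synonym 'a mesh = "'a tsimplex set"

definition verts :: "'a tsimplex \<Rightarrow> 'a set" where
  "verts t = set (fst t)"

definition elem :: "('a::euclidean_space) tsimplex \<Rightarrow> 'a set" where
  "elem t = convex hull (verts t)"

definition tagged_simplex :: "('a::euclidean_space) tsimplex \<Rightarrow> bool" where
  "tagged_simplex t \<longleftrightarrow> length (fst t) = Suc DIM('a) \<and> distinct (fst t) \<and>
     \<not> affine_dependent (verts t) \<and> snd t < DIM('a)"

definition conforming_mesh :: "('a::euclidean_space) set \<Rightarrow> 'a mesh \<Rightarrow> bool" where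
  "conforming_mesh U T \<longleftrightarrow> finite T \<and> (\<forall>t\<in>T. tagged_simplex t) \<and> inj_on verts T \<and>
     (\<Union>t\<in>T. elem t) = closure U \<and>
     (\<forall>t\<in>T. \<forall>t'\<in>T. elem t \<inter> elem t' = convex hull (verts t \<inter> verts t'))"

text \<open>The children of \<open>(x\<^sub>0, \<dots>, x\<^sub>d)\<^sub>\<gamma>\<close> with midpoint \<open>m\<close> of \<open>x\<^sub>0\<close> and \<open>x\<^sub>d\<close> are
  \<open>(x\<^sub>0, m, x\<^sub>1, \<dots>, x\<^sub>\<gamma>, x\<^sub>\<gamma>\<^sub>+\<^sub>1, \<dots>, x\<^sub>d\<^sub>-\<^sub>1)\<close> and
  \<open>(x\<^sub>d, m, x\<^sub>1, \<dots>, x\<^sub>\<gamma>, x\<^sub>d\<^sub>-\<^sub>1, \<dots>, x\<^sub>\<gamma>\<^sub>+\<^sub>1)\<close>, both of type \<open>\<gamma> + 1\<close> modulo \<open>d\<close>.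
  For \<open>d = 2\<close> the vertex \<open>x\<^sub>1\<close> is the newest vertex.\<close>

definition bisect :: "('a::euclidean_space) tsimplex \<Rightarrow> 'a mesh" where
  "bisect t = (let xs = fst t; \<gamma> = snd t; \<gamma>' = Suc \<gamma> mod (length xs - 1);
      m = midpoint (hd xs) (last xs); ys = butlast (tl xs)
    in {(hd xs # m # take \<gamma> ys @ drop \<gamma> ys, \<gamma>'),
        (last xs # m # take \<gamma> ys @ rev (drop \<gamma> ys), \<gamma>')})"

definition bisect_step :: "('a::euclidean_space) mesh \<Rightarrow> 'a mesh \<Rightarrow> bool" where
  "bisect_step T T' \<longleftrightarrow> (\<exists>t\<in>T. T' = (T - {t}) \<union> bisect t)"

definition nvb_refinement :: "('a::euclidean_space) mesh \<Rightarrow> 'a mesh \<Rightarrow> bool" where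
  "nvb_refinement = bisect_step\<^sup>*\<^sup>*"

definition conforming_refinement ::
    "('a::euclidean_space) set \<Rightarrow> 'a mesh \<Rightarrow> 'a mesh \<Rightarrow> 'a mesh \<Rightarrow> bool" where
  "conforming_refinement U T M T' \<longleftrightarrow>
     nvb_refinement T T' \<and> conforming_mesh U T' \<and> M \<inter> T' = {}"

text \<open>\<open>T'\<close> is the coarsest conforming refinement of \<open>T\<close> in which all elements of \<open>M\<close> are
  refined, i.e. the mesh \<open>refine(T, M)\<close>.\<close>

definition is_refine ::
    "('a::euclidean_space) set \<Rightarrow> 'a mesh \<Rightarrow> 'a mesh \<Rightarrow> 'a mesh \<Rightarrow> bool" where
  "is_refine U T M T' \<longleftrightarrow> conforming_refinement U T M T' \<and>
     (\<forall>T''. conforming_refinement U T M T'' \<longrightarrow> nvb_refinement T' T'')"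

definition meshes :: "('a::euclidean_space) set \<Rightarrow> 'a mesh \<Rightarrow> 'a mesh set" where
  "meshes U T\<^sub>0 = {T. nvb_refinement T\<^sub>0 T \<and> conforming_mesh U T}"

text \<open>Admissibility of an initial mesh means that refinement is well-defined on it and on all
  meshes obtained from it. Every tagging of a conforming mesh has this property if \<open>d \<le> 2\<close>,
  and Stevenson's matching condition is sufficient for it in every dimension.\<close>

definition nvb_admissible :: "('a::euclidean_space) set \<Rightarrow> 'a mesh \<Rightarrow> bool" where
  "nvb_admissible U T\<^sub>0 \<longleftrightarrow> conforming_mesh U T\<^sub>0 \<and>
     (\<forall>T\<in>meshes U T\<^sub>0. \<forall>M\<subseteq>T. \<exists>T'. is_refine U T M T')"

definition poly_deg_le :: "nat \<Rightarrow> ('a::euclidean_space \<Rightarrow> real) \<Rightarrow> bool" where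
  "poly_deg_le p q \<longleftrightarrow> (\<exists>c. q = (\<lambda>x.
     \<Sum>k\<in>{k. (\<forall>b. b \<notin> Basis \<longrightarrow> k b = 0) \<and> (\<Sum>b\<in>Basis. k b) \<le> p}.
       c k * (\<Prod>b\<in>Basis. (x \<bullet> b) ^ k b)))"

definition fe_space ::
    "('a::euclidean_space) problem \<Rightarrow> nat \<Rightarrow> 'a mesh \<Rightarrow> ('a \<Rightarrow> real) set" where
  "fe_space P p T = {v\<in>X_space P. \<forall>t\<in>T. \<exists>q. poly_deg_le p q \<and> ae_equal_on (elem t) v q}"

section \<open>The error estimator\<close>

text \<open>Traces are limits of averages, hence independent of the representative and equal to the
  limit from inside \<open>U\<close> where the function is continuous up to the boundary.\<close>

definition average_on :: "'a::euclidean_space set \<Rightarrow> ('a \<Rightarrow> 'a) \<Rightarrow> 'a" where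
  "average_on S G = (1 / measure lebesgue S) *\<^sub>R (\<integral>x. G x \<partial>lebesgue_on S)"

definition has_trace ::
    "'a::euclidean_space set \<Rightarrow> ('a \<Rightarrow> 'a) \<Rightarrow> 'a \<Rightarrow> 'a \<Rightarrow> bool" where
  "has_trace U G x l \<longleftrightarrow> ((\<lambda>r. average_on (U \<inter> ball x r) G) \<longlongrightarrow> l) (at_right 0)"

definition trace_at :: "'a::euclidean_space set \<Rightarrow> ('a \<Rightarrow> 'a) \<Rightarrow> 'a \<Rightarrow> 'a" where
  "trace_at U G x = (THE l. has_trace U G x l)"

definition facet_normal :: "('a::euclidean_space) set \<Rightarrow> 'a" where
  "facet_normal F = (SOME n. norm n = 1 \<and> (\<forall>x\<in>F. \<forall>y\<in>F. n \<bullet> (x - y) = 0))"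

text \<open>The surface measure of a flat facet \<open>F\<close> with unit normal \<open>n\<close> is the Lebesgue measure on the
  cylinder over \<open>F\<close> of height 1 in direction \<open>n\<close>, pushed forward under the orthogonal projection
  onto \<open>F\<close>. For \<open>d = 1\<close> it is the unit mass at a point.\<close>

definition facet_cylinder :: "('a::euclidean_space) set \<Rightarrow> 'a set" where
  "facet_cylinder F = {y + s *\<^sub>R facet_normal F | y s. y \<in> F \<and> 0 \<le> s \<and> s \<le> 1}"

definition facet_proj :: "('a::euclidean_space) set \<Rightarrow> 'a \<Rightarrow> 'a" where
  "facet_proj F x = x - ((x - (SOME z. z \<in> F)) \<bullet> facet_normal F) *\<^sub>R facet_normal F"

definition neighbours :: "('a::euclidean_space) mesh \<Rightarrow> 'a tsimplex \<Rightarrow> 'a mesh" where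
  "neighbours T t = {t'\<in>T. card (verts t \<inter> verts t') = DIM('a)}"

definition jump ::
    "('a::euclidean_space) tsimplex \<Rightarrow> 'a tsimplex \<Rightarrow> ('a \<Rightarrow> 'a) \<Rightarrow> 'a \<Rightarrow> real" where
  "jump t t' G x = (trace_at (interior (elem t)) G x - trace_at (interior (elem t')) G x)
     \<bullet> facet_normal (elem t \<inter> elem t')"

definition flux_residual ::
    "('a::euclidean_space) problem \<Rightarrow> ('a \<Rightarrow> real) \<Rightarrow> 'a \<Rightarrow> 'a" where
  "flux_residual P v x = A_vec P (nabla P v x) - flux P x"

text \<open>Up to a null set of the surface measure, the part of the boundary of an element inside the
  domain is the union of the facets shared with its neighbours.\<close>

definition eta_sq ::
    "('a::euclidean_space) problem \<Rightarrow> 'a mesh \<Rightarrow> 'a tsimplex \<Rightarrow> ('a \<Rightarrow> real) \<Rightarrow> real" where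
  "eta_sq P T t v =
     measure lebesgue (elem t) powr (2 / real DIM('a)) *
       (L2_norm (interior (elem t))
          (\<lambda>x. src P x + weak_div (interior (elem t)) (flux_residual P v) x))\<^sup>2 +
     measure lebesgue (elem t) powr (1 / real DIM('a)) *
       (\<Sum>t'\<in>neighbours T t.
          (L2_norm (facet_cylinder (elem t \<inter> elem t'))
             (\<lambda>x. jump t t' (flux_residual P v) (facet_proj (elem t \<inter> elem t') x)))\<^sup>2)"

definition eta_on ::
    "('a::euclidean_space) problem \<Rightarrow> 'a mesh \<Rightarrow> 'a mesh \<Rightarrow> ('a \<Rightarrow> real) \<Rightarrow> real" where
  "eta_on P T S v = sqrt (\<Sum>t\<in>S. eta_sq P T t v)"

definition eta :: "('a::euclidean_space) problem \<Rightarrow> 'a mesh \<Rightarrow> ('a \<Rightarrow> real) \<Rightarrow> real" where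
  "eta P T v = eta_on P T T v"

definition estimator_well_defined ::
    "('a::euclidean_space) problem \<Rightarrow> nat \<Rightarrow> 'a mesh \<Rightarrow> bool" where
  "estimator_well_defined P p T\<^sub>0 \<longleftrightarrow>
     (\<forall>T\<in>meshes (Omega P) T\<^sub>0. \<forall>v\<in>fe_space P p T. \<forall>t\<in>T.
        (\<exists>h. has_weak_div (interior (elem t)) (flux_residual P v) h) \<and>
        (\<forall>t'\<in>neighbours T t.
           (AE x in lebesgue_on (facet_cylinder (elem t \<inter> elem t')).
              \<forall>s\<in>{t, t'}. \<exists>l. has_trace (interior (elem s)) (flux_residual P v)
                (facet_proj (elem t \<inter> elem t') x) l) \<and>
           L2_on (facet_cylinder (elem t \<inter> elem t'))
             (\<lambda>x. jump t t' (flux_residual P v) (facet_proj (elem t \<inter> elem t') x))))"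

section \<open>Linearization and algebraic solver\<close>

definition symmetric_bilinear_on ::
    "('a \<Rightarrow> real) set \<Rightarrow> (('a \<Rightarrow> real) \<Rightarrow> ('a \<Rightarrow> real) \<Rightarrow> real) \<Rightarrow> bool" where
  "symmetric_bilinear_on V B \<longleftrightarrow>
     (\<forall>v\<in>V. \<forall>w\<in>V. B v w = B w v) \<and>
     (\<forall>v\<in>V. \<forall>w\<in>V. \<forall>z\<in>V. B (\<lambda>x. v x + w x) z = B v z + B w z) \<and>
     (\<forall>c. \<forall>v\<in>V. \<forall>z\<in>V. B (\<lambda>x. c * v x) z = c * B v z)"

definition linearization_form ::
    "('a::euclidean_space) problem \<Rightarrow> (('a \<Rightarrow> real) \<Rightarrow> ('a \<Rightarrow> real) \<Rightarrow> ('a \<Rightarrow> real) \<Rightarrow> real) \<Rightarrow>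
     real \<Rightarrow> real \<Rightarrow> bool" where
  "linearization_form P a Cell Ccnt \<longleftrightarrow> 0 < Cell \<and> 0 < Ccnt \<and>
     (\<forall>u\<in>X_space P. symmetric_bilinear_on (X_space P) (a u) \<and>
        (\<forall>v\<in>X_space P. Cell * (tnorm P v)\<^sup>2 \<le> a u v v) \<and>
        (\<forall>v\<in>X_space P. \<forall>w\<in>X_space P. \<bar>a u v w\<bar> \<le> Ccnt * tnorm P v * tnorm P w))"

definition linearization_step ::
    "('a::euclidean_space) problem \<Rightarrow> nat \<Rightarrow> 'a mesh \<Rightarrow>
     (('a \<Rightarrow> real) \<Rightarrow> ('a \<Rightarrow> real) \<Rightarrow> ('a \<Rightarrow> real) \<Rightarrow> real) \<Rightarrow>
     ('a mesh \<Rightarrow> ('a \<Rightarrow> real) \<Rightarrow> ('a \<Rightarrow> real)) \<Rightarrow> bool" where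
  "linearization_step P p T\<^sub>0 a \<Phi> \<longleftrightarrow>
     (\<forall>T\<in>meshes (Omega P) T\<^sub>0. \<forall>u\<in>fe_space P p T.
        \<Phi> T u \<in> fe_space P p T \<and>
        (\<forall>v\<in>fe_space P p T. a u (\<Phi> T u) v = a u u v + F_rhs P v - A_op P u v))"

definition energy_decrease ::
    "('a::euclidean_space) problem \<Rightarrow> nat \<Rightarrow> 'a mesh \<Rightarrow>
     ('a mesh \<Rightarrow> ('a \<Rightarrow> real) \<Rightarrow> ('a \<Rightarrow> real)) \<Rightarrow> real \<Rightarrow> bool" where
  "energy_decrease P p T\<^sub>0 \<Phi> Cstar \<longleftrightarrow> 0 < Cstar \<and>
     (\<forall>T\<in>meshes (Omega P) T\<^sub>0. \<forall>u\<in>fe_space P p T.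
        Cstar * (tdist P (\<Phi> T u) u)\<^sup>2 \<le> d2 P (\<Phi> T u) u)"

definition algebraic_solver ::
    "('a::euclidean_space) problem \<Rightarrow> nat \<Rightarrow> 'a mesh \<Rightarrow>
     ('a mesh \<Rightarrow> ('a \<Rightarrow> real) \<Rightarrow> ('a \<Rightarrow> real)) \<Rightarrow>
     ('a mesh \<Rightarrow> ('a \<Rightarrow> real) \<Rightarrow> ('a \<Rightarrow> real) \<Rightarrow> ('a \<Rightarrow> real)) \<Rightarrow> real \<Rightarrow> bool" where
  "algebraic_solver P p T\<^sub>0 \<Phi> \<Psi> q_alg \<longleftrightarrow> 0 < q_alg \<and> q_alg < 1 \<and>
     (\<forall>T\<in>meshes (Omega P) T\<^sub>0. \<forall>u\<in>fe_space P p T.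
        (\<forall>w\<in>fe_space P p T. \<Psi> T (\<Phi> T u) w \<in> fe_space P p T) \<and>
        (\<forall>j\<ge>1. tdist P (\<Phi> T u) ((\<Psi> T (\<Phi> T u) ^^ j) u)
           \<le> q_alg * tdist P (\<Phi> T u) ((\<Psi> T (\<Phi> T u) ^^ (j - 1)) u)))"

section \<open>The adaptive algorithm\<close>

record params =
  theta :: real
  C_mark :: real
  lam_lin :: real
  rho :: real
  tau :: real
  alpha_min_init :: real
  J_max_init :: nat

definition admissible_params :: "params \<Rightarrow> bool" where
  "admissible_params c \<longleftrightarrow> 0 < theta c \<and> theta c \<le> 1 \<and> 1 \<le> C_mark c \<and> 0 < lam_lin c \<and>
     0 < rho c \<and> rho c < 1 \<and> 0 \<le> tau c \<and> 0 < alpha_min_init c \<and> 1 \<le> J_max_init c"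

text \<open>The data produced by the algorithm: \<open>iter R l k j\<close> is the iterate with indices \<open>(l, k, j)\<close>,
  while \<open>alpha_min R l k\<close> and \<open>J_max R l k\<close> are the values of the two variables of the algorithm
  during the loop over \<open>j\<close> for the given \<open>l\<close> and \<open>k \<ge> 1\<close>. Only values at indices that are
  actually reached are meaningful.\<close>

record 'a run =
  iter :: "nat \<Rightarrow> nat \<Rightarrow> nat \<Rightarrow> 'a \<Rightarrow> real"
  level_mesh :: "nat \<Rightarrow> 'a mesh"
  marked :: "nat \<Rightarrow> 'a mesh"
  alpha_min :: "nat \<Rightarrow> nat \<Rightarrow> real"
  J_max :: "nat \<Rightarrow> nat \<Rightarrow> nat"

text \<open>Inside the loops over \<open>k\<close> and \<open>j\<close>, the last iterate of the previous step \<open>k - 1\<close> is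
  available as \<open>iter R l k 0\<close>.\<close>

definition tau_stop ::
    "('a::euclidean_space) problem \<Rightarrow> params \<Rightarrow> 'a run \<Rightarrow> nat \<Rightarrow> nat \<Rightarrow> nat \<Rightarrow> bool" where
  "tau_stop P c R l k j \<longleftrightarrow>
     eta P (level_mesh R l) (iter R l k j) + tdist P (iter R l k j) (iter R l k 0) +
       tdist P (iter R l k j) (iter R l k (j - 1)) \<le> tau c"

definition alpha_quot ::
    "('a::euclidean_space) problem \<Rightarrow> 'a run \<Rightarrow> nat \<Rightarrow> nat \<Rightarrow> nat \<Rightarrow> real" where
  "alpha_quot P R l k j =
     d2 P (iter R l k j) (iter R l k 0) / (tdist P (iter R l k j) (iter R l k 0))\<^sup>2"

definition j_stop ::
    "('a::euclidean_space) problem \<Rightarrow> 'a run \<Rightarrow> nat \<Rightarrow> nat \<Rightarrow> nat \<Rightarrow> bool" where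
  "j_stop P R l k j \<longleftrightarrow>
     alpha_min R l k \<le> alpha_quot P R l k j \<or>
     ae_equal_on (Omega P) (iter R l k j) (iter R l k 0) \<or>
     (0 < alpha_quot P R l k j \<and> J_max R l k < j)"

definition k_stop ::
    "('a::euclidean_space) problem \<Rightarrow> params \<Rightarrow> 'a run \<Rightarrow> nat \<Rightarrow> nat \<Rightarrow> nat \<Rightarrow> bool" where
  "k_stop P c R l k j \<longleftrightarrow>
     d2 P (iter R l k j) (iter R l k 0) \<le> lam_lin c * (eta P (level_mesh R l) (iter R l k j))\<^sup>2"

inductive_set index_set :: "('a::euclidean_space) problem \<Rightarrow> params \<Rightarrow> 'a run \<Rightarrow> (nat \<times> nat \<times> nat) set"
  for P :: "('a::euclidean_space) problem" and c :: params and R :: "'a run" where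
  start: "(0, 0, 0) \<in> index_set P c R"
| first_linearization: "(l, 0, 0) \<in> index_set P c R \<Longrightarrow> (l, 1, 0) \<in> index_set P c R"
| first_solver_step: "(l, k, 0) \<in> index_set P c R \<Longrightarrow> 1 \<le> k \<Longrightarrow> (l, k, 1) \<in> index_set P c R"
| next_solver_step: "(l, k, j) \<in> index_set P c R \<Longrightarrow> 1 \<le> k \<Longrightarrow> 1 \<le> j \<Longrightarrow>
    \<not> tau_stop P c R l k j \<Longrightarrow> \<not> j_stop P R l k j \<Longrightarrow> (l, k, Suc j) \<in> index_set P c R"
| next_linearization: "(l, k, j) \<in> index_set P c R \<Longrightarrow> 1 \<le> k \<Longrightarrow> 1 \<le> j \<Longrightarrow>
    \<not> tau_stop P c R l k j \<Longrightarrow> j_stop P R l k j \<Longrightarrow> \<not> k_stop P c R l k j \<Longrightarrow>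
    (l, Suc k, 0) \<in> index_set P c R"
| next_level: "(l, k, j) \<in> index_set P c R \<Longrightarrow> 1 \<le> k \<Longrightarrow> 1 \<le> j \<Longrightarrow>
    \<not> tau_stop P c R l k j \<Longrightarrow> j_stop P R l k j \<Longrightarrow> k_stop P c R l k j \<Longrightarrow>
    (Suc l, 0, 0) \<in> index_set P c R"

definition doerfler ::
    "('a::euclidean_space) problem \<Rightarrow> params \<Rightarrow> 'a mesh \<Rightarrow> ('a \<Rightarrow> real) \<Rightarrow> 'a mesh set" where
  "doerfler P c T v = {S. S \<subseteq> T \<and> theta c * (eta P T v)\<^sup>2 \<le> (eta_on P T S v)\<^sup>2}"

definition marking ::
    "('a::euclidean_space) problem \<Rightarrow> params \<Rightarrow> 'a mesh \<Rightarrow> ('a \<Rightarrow> real) \<Rightarrow> 'a mesh \<Rightarrow> bool" where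
  "marking P c T v M \<longleftrightarrow> M \<in> doerfler P c T v \<and>
     real (card M) \<le> C_mark c * real (Min (card ` doerfler P c T v))"

definition alpha_min_update :: "params \<Rightarrow> 'a run \<Rightarrow> nat \<Rightarrow> nat \<Rightarrow> nat \<Rightarrow> real" where
  "alpha_min_update c R l k j =
     (if J_max R l k < j then rho c * alpha_min R l k else alpha_min R l k)"

definition J_max_update :: "'a run \<Rightarrow> nat \<Rightarrow> nat \<Rightarrow> nat \<Rightarrow> nat" where
  "J_max_update R l k j = (if J_max R l k < j then j else J_max R l k)"

definition ailfem_run ::
    "('a::euclidean_space) problem \<Rightarrow> params \<Rightarrow>
     ('a mesh \<Rightarrow> ('a \<Rightarrow> real) \<Rightarrow> ('a \<Rightarrow> real)) \<Rightarrow>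
     ('a mesh \<Rightarrow> ('a \<Rightarrow> real) \<Rightarrow> ('a \<Rightarrow> real) \<Rightarrow> ('a \<Rightarrow> real)) \<Rightarrow>
     'a mesh \<Rightarrow> ('a \<Rightarrow> real) \<Rightarrow> 'a run \<Rightarrow> bool" where
  "ailfem_run P c \<Phi> \<Psi> T\<^sub>0 u\<^sub>0 R \<longleftrightarrow>
     level_mesh R 0 = T\<^sub>0 \<and> iter R 0 0 0 = u\<^sub>0 \<and>
     alpha_min R 0 1 = alpha_min_init c \<and> J_max R 0 1 = J_max_init c \<and>
     (\<forall>l. (l, 0, 0) \<in> index_set P c R \<longrightarrow> iter R l 1 0 = iter R l 0 0) \<and>
     (\<forall>l k j. (l, k, Suc j) \<in> index_set P c R \<longrightarrow>
        iter R l k (Suc j) = \<Psi> (level_mesh R l) (\<Phi> (level_mesh R l) (iter R l k 0)) (iter R l k j)) \<and>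
     (\<forall>l k j. (l, k, j) \<in> index_set P c R \<and> 1 \<le> k \<and> 1 \<le> j \<and>
        \<not> tau_stop P c R l k j \<and> j_stop P R l k j \<longrightarrow>
        (if k_stop P c R l k j then
           marking P c (level_mesh R l) (iter R l k j) (marked R l) \<and>
           is_refine (Omega P) (level_mesh R l) (marked R l) (level_mesh R (Suc l)) \<and>
           iter R (Suc l) 0 0 = iter R l k j \<and>
           alpha_min R (Suc l) 1 = alpha_min_update c R l k j \<and>
           J_max R (Suc l) 1 = J_max_update R l k j
         else
           iter R l (Suc k) 0 = iter R l k j \<and>
           alpha_min R l (Suc k) = alpha_min_update c R l k j \<and>
           J_max R l (Suc k) = J_max_update R l k j))"

definition j_last ::
    "('a::euclidean_space) problem \<Rightarrow> params \<Rightarrow> 'a run \<Rightarrow> nat \<Rightarrow> nat \<Rightarrow> enat" where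
  "j_last P c R l k = (SUP j\<in>{j. (l, k, j) \<in> index_set P c R}. enat j)"

text \<open>Meaningful if \<open>j_last P c R l k\<close> is finite.\<close>

definition last_iter ::
    "('a::euclidean_space) problem \<Rightarrow> params \<Rightarrow> 'a run \<Rightarrow> nat \<Rightarrow> nat \<Rightarrow> 'a \<Rightarrow> real" where
  "last_iter P c R l k = iter R l k (the_enat (j_last P c R l k))"

text \<open>The pairs \<open>(l, k)\<close> with \<open>k \<ge> 1\<close> such that the last index of the loop over \<open>j\<close> is
  finite and, together with \<open>l\<close> and \<open>k\<close>, forms a triple of the index set.\<close>

definition completed ::
    "('a::euclidean_space) problem \<Rightarrow> params \<Rightarrow> 'a run \<Rightarrow> (nat \<times> nat) set" where
  "completed P c R = {(l, k). 1 \<le> k \<and> j_last P c R l k \<noteq> \<infinity> \<and>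
     (l, k, the_enat (j_last P c R l k)) \<in> index_set P c R}"

end

theory Submission
  imports Defs
begin

text \<open>Write \<open>u\<close> and \<open>w\<close> for the final iterates of two successive linearization steps on one mesh, \<open>s\<close> for
  the exact discrete solution, and \<open>\<Phi>\<close> for the exact linearization step from \<open>u\<close>. Strong monotonicity
  and the equation for \<open>\<Phi>\<close> give \<open>\<alpha> |s - u| \<le> C_cnt |\<Phi> - u|\<close>, the solver contraction gives
  \<open>(1 - q_alg) |\<Phi> - u| \<le> |w - u|\<close>, and \<open>d2 s u \<le> L / 2 |s - u|\<^sup>2\<close>. Hence
  \<open>d2 w u \<ge> C_nrg |w - u|\<^sup>2 \<ge> (1 - q) d2 s u\<close> with \<open>q\<close> equal to the claimed upper bound, and
  \<open>d2 s w = d2 s u - d2 w u \<le> q d2 s u\<close>.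

  That this \<open>q\<close> is positive follows from \<open>C_star |\<Phi> - u|\<^sup>2 \<le> d2 \<Phi> u \<le> d2 s u \<le> L / 2 |s - u|\<^sup>2\<close>, provided
  some reachable finite element space contains \<open>u\<close> with \<open>|s - u| > 0\<close>. The initial mesh need not have
  an interior vertex, but repeated bisection of one simplex creates a vertex in its interior, and the
  hat function of this vertex lies in \<open>H10\<close> and has a gradient that is not zero almost everywhere.\<close>

section \<open>Square-integrable functions\<close>

text \<open>The claimed bound for \<open>q\<close> contains no information on the run, and its
  positivity is really a restriction on \<open>C_star\<close>: if all reachable spaces were trivial,
  \<open>C_star\<close> could be arbitrarily large and the bound negative. Hence a nontrivial
  discrete function has to be exhibited, on a mesh that the run need not visit; this suffices
  because the assumptions on the linearization are made on every reachable mesh. Strict positivity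
  then comes from \<open>C_nrg < C_star\<close>.

  Two obstacles shape the analysis. \<open>H10\<close> is a closure of test functions, so membership
  of the hat function requires smooth compactly supported approximations, hence bump functions and
  mollification. And \<open>weak_grad\<close> is an arbitrary choice of representative, so linearity
  of the gradient and its value on the hat function hold only almost everywhere and rest on
  uniqueness of weak gradients. The Lipschitz property enters by excluding slits: \<open>U\<close>
  has to fill the interior of its closure, otherwise the new vertex or the support of its hat
  function could meet the boundary. The factor \<open>L / 2\<close> is the integral of
  \<open>L * t\<close> over the unit interval.\<close>

lemma L2_on_measurable: "L2_on S f \<Longrightarrow> f \<in> borel_measurable (lebesgue_on S)"
  by (simp add: L2_on_def)

lemma L2_on_scaled_integrable:
  assumes "L2_on S u" "L2_on S f"
  shows "integrable (lebesgue_on S) (\<lambda>x. (u x :: real) *\<^sub>R f x)"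
proof (rule Bochner_Integration.integrable_bound)
  show "integrable (lebesgue_on S) (\<lambda>x. (norm (u x))\<^sup>2 + (norm (f x))\<^sup>2)"
    using assms unfolding L2_on_def by auto
  show "(\<lambda>x. u x *\<^sub>R f x) \<in> borel_measurable (lebesgue_on S)"
    using assms[THEN L2_on_measurable] by measurable
  have "2 * (\<bar>u x\<bar> * norm (f x)) \<le> (norm (u x))\<^sup>2 + (norm (f x))\<^sup>2" for x
    using sum_squares_bound[of "\<bar>u x\<bar>" "norm (f x)"] by (simp add: algebra_simps)
  moreover have "0 \<le> \<bar>u x\<bar> * norm (f x)" for x by simp
  ultimately have "\<bar>u x\<bar> * norm (f x) \<le> (norm (u x))\<^sup>2 + (norm (f x))\<^sup>2" for x
    by (smt (verit, best))
  then show "AE x in lebesgue_on S. norm (u x *\<^sub>R f x) \<le> norm ((norm (u x))\<^sup>2 + (norm (f x))\<^sup>2)"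
    by simp
qed

lemma L2_on_norm: "L2_on S f \<Longrightarrow> L2_on S (\<lambda>x. norm (f x))"
  unfolding L2_on_def by auto

lemma L2_on_inner_integrable:
  assumes "L2_on S f" "L2_on S g"
  shows "integrable (lebesgue_on S) (\<lambda>x. f x \<bullet> g x)"
proof (rule Bochner_Integration.integrable_bound)
  show "integrable (lebesgue_on S) (\<lambda>x. norm (f x) *\<^sub>R norm (g x))"
    using assms by (intro L2_on_scaled_integrable L2_on_norm)
  show "(\<lambda>x. f x \<bullet> g x) \<in> borel_measurable (lebesgue_on S)"
    using assms[THEN L2_on_measurable] by measurable
qed (simp add: Cauchy_Schwarz_ineq2)

lemma L2_on_scaleR: "L2_on S f \<Longrightarrow> L2_on S (\<lambda>x. c *\<^sub>R f x)"
  unfolding L2_on_def by (auto simp: power_mult_distrib)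

lemma norm_add_sq: "(norm (x + y :: 'a::real_inner))\<^sup>2 = (norm x)\<^sup>2 + 2 * (x \<bullet> y) + (norm y)\<^sup>2"
  by (simp add: power2_norm_eq_inner inner_commute algebra_simps)

lemma L2_on_add:
  assumes "L2_on S f" "L2_on S g"
  shows "L2_on S (\<lambda>x. f x + g x)"
  unfolding L2_on_def norm_add_sq
  using assms[THEN L2_on_measurable] assms L2_on_inner_integrable[OF assms]
  by (auto simp: L2_on_def)

lemma L2_on_diff:
  assumes "L2_on S f" "L2_on S g"
  shows "L2_on S (\<lambda>x. f x - g x)"
  using L2_on_add[OF assms(1) L2_on_scaleR[OF assms(2), of "-1"]] by simp

lemma L2_norm_nonneg: "0 \<le> L2_norm S f"
  by (simp add: L2_norm_def)

lemma L2_norm_sq: "(L2_norm S f)\<^sup>2 = (\<integral>x. (norm (f x))\<^sup>2 \<partial>lebesgue_on S)"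
  by (simp add: L2_norm_def)

lemma L2_norm_sq_add:
  assumes "L2_on S f" "L2_on S g"
  shows "(L2_norm S (\<lambda>x. f x + g x))\<^sup>2
    = (L2_norm S f)\<^sup>2 + 2 * (\<integral>x. f x \<bullet> g x \<partial>lebesgue_on S) + (L2_norm S g)\<^sup>2"
  unfolding L2_norm_sq norm_add_sq
  using assms L2_on_inner_integrable[OF assms] by (simp add: L2_on_def)

lemma L2_norm_scaleR: "L2_norm S (\<lambda>x. c *\<^sub>R f x) = \<bar>c\<bar> * L2_norm S f"
  unfolding L2_norm_def by (simp add: power_mult_distrib real_sqrt_mult)

lemma L2_norm_cong_AE:
  assumes "AE x in lebesgue_on S. f x = g x" "L2_on S f" "L2_on S g"
  shows "L2_norm S f = L2_norm S g"
proof -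
  have "(\<integral>x. (norm (f x))\<^sup>2 \<partial>lebesgue_on S) = (\<integral>x. (norm (g x))\<^sup>2 \<partial>lebesgue_on S)"
    using assms by (intro integral_cong_AE) (auto simp: L2_on_def)
  then show ?thesis by (simp add: L2_norm_def)
qed

lemma L2_norm_eq_0_iff:
  assumes "L2_on S f"
  shows "L2_norm S f = 0 \<longleftrightarrow> (AE x in lebesgue_on S. f x = 0)"
  using assms integral_nonneg_eq_0_iff_AE[of "lebesgue_on S" "\<lambda>x. (norm (f x))\<^sup>2"]
  unfolding L2_on_def L2_norm_def by simp

text \<open>The squared norm of \<open>f + t g\<close> is a nonnegative quadratic polynomial in t;
  evaluating it at one suitable t gives the discriminant inequality.\<close>

lemma L2_Cauchy_Schwarz:
  assumes f: "L2_on S f" and g: "L2_on S g"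
  shows "\<bar>\<integral>x. f x \<bullet> g x \<partial>lebesgue_on S\<bar> \<le> L2_norm S f * L2_norm S g"
proof -
  define A B C where "A = L2_norm S f" and "B = L2_norm S g"
    and "C = (\<integral>x. f x \<bullet> g x \<partial>lebesgue_on S)"
  have nn: "0 \<le> A" "0 \<le> B" by (simp_all add: A_def B_def L2_norm_nonneg)
  have *: "0 \<le> A\<^sup>2 + 2 * (t * C) + t\<^sup>2 * B\<^sup>2" for t
    using L2_norm_sq_add[OF f L2_on_scaleR[OF g, of t]]
      zero_le_power2[of "L2_norm S (\<lambda>x. f x + t *\<^sub>R g x)"]
    by (simp add: L2_norm_scaleR power_mult_distrib A_def B_def C_def)
  have "C\<^sup>2 \<le> (A * B)\<^sup>2"
  proof (cases "B = 0")
    case True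
    have "C = 0"
    proof (rule ccontr)
      \<comment> \<open>For \<open>B = 0\<close> the polynomial is affine in t, and the t used here
        would give it the value \<open>- A^2 - 2\<close>.\<close>
      assume "C \<noteq> 0"
      then have "A\<^sup>2 + 2 * ((- (A\<^sup>2 + 1) / C) * C) = - A\<^sup>2 - 2" by (simp add: field_simps)
      with *[of "- (A\<^sup>2 + 1) / C"] True show False by (simp add: algebra_simps) (smt (verit) zero_le_power2)
    qed
    then show ?thesis by simp
  next
    case False
    \<comment> \<open>\<open>t = - C / B^2\<close> is the minimiser.\<close>
    have "A\<^sup>2 + 2 * ((- C / B\<^sup>2) * C) + (- C / B\<^sup>2)\<^sup>2 * B\<^sup>2 = A\<^sup>2 - C\<^sup>2 / B\<^sup>2"
      using False by (simp add: field_simps power2_eq_square)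
    with *[of "- C / B\<^sup>2"] have "C\<^sup>2 / B\<^sup>2 \<le> A\<^sup>2" by simp
    with False show ?thesis by (simp add: field_simps)
  qed
  then have "\<bar>C\<bar> \<le> \<bar>A * B\<bar>" by (simp add: abs_le_square_iff)
  with nn show ?thesis by (simp add: A_def B_def C_def)
qed

lemma L2_norm_triangle:
  assumes f: "L2_on S f" and g: "L2_on S g"
  shows "L2_norm S (\<lambda>x. f x + g x) \<le> L2_norm S f + L2_norm S g"
proof (rule power2_le_imp_le)
  show "(L2_norm S (\<lambda>x. f x + g x))\<^sup>2 \<le> (L2_norm S f + L2_norm S g)\<^sup>2"
    using L2_Cauchy_Schwarz[OF f g] unfolding L2_norm_sq_add[OF f g]
    by (simp add: power2_sum)
qed (simp add: L2_norm_nonneg)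

lemma L2_on_bounded:
  assumes "S \<in> lmeasurable" "f \<in> borel_measurable (lebesgue_on S)" "AE x in lebesgue_on S. norm (f x) \<le> C"
  shows "L2_on S f"
proof -
  have "integrable (lebesgue_on S) (\<lambda>x. (norm (f x))\<^sup>2)"
  proof (rule Bochner_Integration.integrable_bound)
    show "integrable (lebesgue_on S) (\<lambda>x. C\<^sup>2)"
      using assms(1) by (intro finite_measure.integrable_const finite_measure_lebesgue_on)
    show "AE x in lebesgue_on S. norm ((norm (f x))\<^sup>2) \<le> norm (C\<^sup>2)"
      using assms(3) by eventually_elim (simp add: power_mono)
  qed (use assms(2) in measurable)
  with assms(2) show ?thesis by (simp add: L2_on_def)
qed

text \<open>Dominated convergence with a constant majorant, which is integrable because
  \<open>S\<close> has finite measure. It serves later for the mollified functions and for their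
  gradients.\<close>

lemma L2_norm_tendsto_0_bounded:
  assumes S: "S \<in> lmeasurable"
    and meas: "\<And>n. f n \<in> borel_measurable (lebesgue_on S)"
    and bd: "\<And>n. AE x in lebesgue_on S. norm (f n x) \<le> C"
    and lim: "AE x in lebesgue_on S. (\<lambda>n. f n x) \<longlonglongrightarrow> 0"
  shows "(\<lambda>n. L2_norm S (f n)) \<longlonglongrightarrow> 0"
proof -
  have "(\<lambda>n. \<integral>x. (norm (f n x))\<^sup>2 \<partial>lebesgue_on S) \<longlonglongrightarrow> (\<integral>x. 0 \<partial>lebesgue_on S)"
  proof (rule integral_dominated_convergence)
    show "integrable (lebesgue_on S) (\<lambda>x. C\<^sup>2)"
      using S by (intro finite_measure.integrable_const finite_measure_lebesgue_on)
    show "AE x in lebesgue_on S. norm ((norm (f n x))\<^sup>2) \<le> C\<^sup>2" for n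
      using bd[of n] by eventually_elim (simp add: power_mono)
    have "(\<lambda>n. (norm (f n x))\<^sup>2) \<longlonglongrightarrow> 0" if "(\<lambda>n. f n x) \<longlonglongrightarrow> 0" for x
      using tendsto_power[OF tendsto_norm_zero[OF that], of 2] by simp
    then show "AE x in lebesgue_on S. (\<lambda>n. (norm (f n x))\<^sup>2) \<longlonglongrightarrow> 0"
      using lim by (auto elim: eventually_mono)
    show "(\<lambda>x. (norm (f n x))\<^sup>2) \<in> borel_measurable (lebesgue_on S)" for n
      using meas[of n] by measurable
  qed simp
  from tendsto_real_sqrt[OF this] show ?thesis by (simp add: L2_norm_def)
qed

lemma L2_on_continuous_bounded:
  assumes "S \<in> lmeasurable" "continuous_on S f" "\<And>x. norm (f x) \<le> C"
  shows "L2_on S f"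
  using assms by (intro L2_on_bounded[of S f C] continuous_imp_measurable_on_sets_lebesgue) auto

section \<open>Smooth bump functions\<close>

lemma C_k_differentiable: "C_k (Suc k) f \<Longrightarrow> (f has_derivative frechet_derivative f (at x)) (at x)"
  by (simp add: frechet_derivative_works)

lemma C_k_continuous: "C_k k f \<Longrightarrow> continuous_on UNIV f"
proof (cases k)
  case (Suc n)
  assume "C_k k f"
  then have "\<forall>x. f differentiable (at x)" by (simp add: Suc)
  then show ?thesis
    by (meson continuous_at_imp_continuous_on differentiable_imp_continuous_within)
qed simp

text \<open>\<open>C_k\<close> refers to the choice operator \<open>frechet_derivative\<close>;
  uniqueness of derivatives lets any explicitly known derivative take its place.\<close>

lemma C_k_I:
  assumes "\<And>x. (f has_derivative f' x) (at x)" "\<And>b. b \<in> Basis \<Longrightarrow> C_k k (\<lambda>x. f' x b)"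
  shows "C_k (Suc k) f"
proof -
  have "frechet_derivative f (at x) = f' x" for x
    using frechet_derivative_at[OF assms(1)] by simp
  moreover have "f differentiable (at x)" for x
    using assms(1) by (auto simp: differentiable_def)
  ultimately show ?thesis using assms(2) by simp
qed

lemma C_k_Suc_imp: "C_k (Suc k) f \<Longrightarrow> C_k k f"
proof (induction k arbitrary: f)
  case 0
  then show ?case using C_k_continuous[of "Suc 0" f] by simp
next
  case (Suc k)
  then show ?case by (metis C_k.simps(2))
qed

lemma C_k_const: "C_k k (\<lambda>x. c)"
  by (induction k arbitrary: c) simp_all

lemma C_k_add: "C_k k f \<Longrightarrow> C_k k g \<Longrightarrow> C_k k (\<lambda>x. f x + g x)"
proof (induction k arbitrary: f g)
  case (Suc k)
  show ?case
  proof (rule C_k_I)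
    show "((\<lambda>x. f x + g x) has_derivative
        (\<lambda>h. frechet_derivative f (at x) h + frechet_derivative g (at x) h)) (at x)" for x
      using Suc.prems by (intro has_derivative_add C_k_differentiable)
  qed (use Suc in auto)
qed (auto intro: continuous_on_add)

lemma C_k_mult: "C_k k f \<Longrightarrow> C_k k g \<Longrightarrow> C_k k (\<lambda>x. f x * g x)"
proof (induction k arbitrary: f g)
  case (Suc k)
  show ?case
  proof (rule C_k_I)
    show "((\<lambda>x. f x * g x) has_derivative
        (\<lambda>h. f x * frechet_derivative g (at x) h + frechet_derivative f (at x) h * g x)) (at x)" for x
      using Suc.prems by (intro has_derivative_mult C_k_differentiable)
    fix b :: 'a assume "b \<in> Basis"
    then show "C_k k (\<lambda>x. f x * frechet_derivative g (at x) b + frechet_derivative f (at x) b * g x)"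
      using Suc.prems by (intro C_k_add Suc.IH) (auto intro: C_k_Suc_imp)
  qed
qed (auto intro: continuous_on_mult)

lemma C_k_prod: "(\<And>i. i \<in> I \<Longrightarrow> C_k k (f i)) \<Longrightarrow> C_k k (\<lambda>x. \<Prod>i\<in>I. f i x)"
  by (induction I rule: infinite_finite_induct) (auto intro: C_k_const C_k_mult)

text \<open>The classical smooth function that is flat at 0, with a polynomial factor in
  \<open>1 / t\<close> so that the family is closed under differentiation.\<close>

definition flat_exp :: "real poly \<Rightarrow> real \<Rightarrow> real" where
  "flat_exp p t = (if 0 < t then poly p (1 / t) * exp (- (1 / t)) else 0)"

lemma poly_exp_tendsto_0: "((\<lambda>s. poly p s * exp (- s)) \<longlongrightarrow> (0::real)) at_top"
proof -
  have "((\<lambda>s. \<Sum>i\<le>degree p. coeff p i * (s ^ i / exp s)) \<longlongrightarrow> (\<Sum>i\<le>degree p. coeff p i * 0)) at_top"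
    by (intro tendsto_sum tendsto_mult tendsto_const tendsto_power_div_exp_0)
  then show ?thesis
    by (simp add: poly_altdef exp_minus sum_distrib_right divide_inverse mult.assoc)
qed

text \<open>With \<open>s = 1 / t\<close> differentiation in t is \<open>- s^2\<close> times
  differentiation in s, which turns \<open>p(s) exp(- s)\<close> into
  \<open>s^2 (p - p')(s) exp(- s)\<close>. At 0 the exponential decay beats every
  polynomial.\<close>

lemma flat_exp_deriv:
  "(flat_exp p has_real_derivative flat_exp ([:0, 0, 1:] * (p - pderiv p)) t) (at t)"
proof (cases t "0::real" rule: linorder_cases)
  case less
  have "((\<lambda>t. 0) has_real_derivative 0) (at t)" by simp
  then have "(flat_exp p has_real_derivative 0) (at t)"
    by (rule DERIV_cong_ev[THEN iffD1, rotated -1])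
       (use less in \<open>auto simp: flat_exp_def eventually_nhds intro!: exI[of _ "{..<0}"]\<close>)
  then show ?thesis using less by (simp add: flat_exp_def)
next
  case equal
  \<comment> \<open>In terms of \<open>s = 1 / t\<close> the right difference quotient at 0 is
    \<open>s p(s) exp(- s)\<close>, whence the additional factor \<open>[:0, 1:]\<close>.\<close>
  have "((\<lambda>s. poly ([:0, 1:] * p) s * exp (- s)) \<longlongrightarrow> (0::real)) at_top"
    by (rule poly_exp_tendsto_0)
  then have "((\<lambda>t. poly ([:0, 1:] * p) (inverse t) * exp (- inverse t)) \<longlongrightarrow> 0) (at_right 0)"
    by (rule filterlim_compose[OF _ filterlim_inverse_at_top_right])
  moreover have "\<forall>\<^sub>F t in at_right (0::real).
      poly ([:0, 1:] * p) (inverse t) * exp (- inverse t) = flat_exp p t / t"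
    unfolding eventually_at_right_field
    by (intro exI[of _ 1]) (auto simp: flat_exp_def divide_simps)
  ultimately have r: "((\<lambda>t. flat_exp p t / t) \<longlongrightarrow> 0) (at_right 0)"
    by (rule Lim_transform_eventually)
  have "\<forall>\<^sub>F t in at_left (0::real). 0 = flat_exp p t / t"
    unfolding eventually_at_left_field by (intro exI[of _ "-1"]) (auto simp: flat_exp_def)
  then have l: "((\<lambda>t. flat_exp p t / t) \<longlongrightarrow> 0) (at_left 0)"
    by (rule Lim_transform_eventually[rotated]) simp
  from l r have "((\<lambda>t. flat_exp p t / t) \<longlongrightarrow> 0) (at 0)"
    by (rule filterlim_split_at)
  then show ?thesis using equal by (simp add: has_field_derivative_iff flat_exp_def)
next
  case greater
  have "((\<lambda>t. poly p (1 / t) * exp (- (1 / t))) has_real_derivative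
      poly p (1 / t) * (exp (- (1 / t)) * (1 / t\<^sup>2)) + poly (pderiv p) (1 / t) * (- (1 / t\<^sup>2)) * exp (- (1 / t)))
      (at t)"
    using greater
    by (auto intro!: derivative_eq_intros DERIV_chain'[OF _ poly_DERIV] simp: power2_eq_square)
  then have "(flat_exp p has_real_derivative
      poly p (1 / t) * (exp (- (1 / t)) * (1 / t\<^sup>2)) + poly (pderiv p) (1 / t) * (- (1 / t\<^sup>2)) * exp (- (1 / t)))
      (at t)"
    by (rule DERIV_cong_ev[THEN iffD1, rotated -1])
       (use greater in \<open>auto simp: flat_exp_def eventually_nhds intro!: exI[of _ "{0<..}"]\<close>)
  then show ?thesis
    by (rule DERIV_cong) (use greater in \<open>simp add: flat_exp_def field_simps power2_eq_square\<close>)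
qed

text \<open>The polynomial must vary in the induction, since a derivative is again of this form, up
  to a constant factor, but with another polynomial.\<close>

lemma C_k_flat_exp: "C_k k (\<lambda>x. flat_exp p (v \<bullet> x + c))"
proof (induction k arbitrary: p)
  case 0
  have "continuous_on UNIV (flat_exp p)"
    using flat_exp_deriv by (meson DERIV_isCont continuous_at_imp_continuous_on)
  then have "continuous_on UNIV (flat_exp p \<circ> (\<lambda>x. v \<bullet> x + c))"
    by (intro continuous_on_compose continuous_intros) (auto elim: continuous_on_subset)
  then show ?case by (simp add: o_def)
next
  case (Suc k)
  show ?case
  proof (rule C_k_I)
    show "((\<lambda>x. flat_exp p (v \<bullet> x + c)) has_derivative
      (\<lambda>h. (v \<bullet> h) * flat_exp ([:0, 0, 1:] * (p - pderiv p)) (v \<bullet> x + c))) (at x)" for x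
      by (rule has_derivative_compose[OF _ flat_exp_deriv[unfolded has_field_derivative_def],
            THEN has_derivative_eq_rhs])
         (auto intro!: derivative_eq_intros simp: mult.commute)
    show "C_k k (\<lambda>x. (v \<bullet> b) * flat_exp ([:0, 0, 1:] * (p - pderiv p)) (v \<bullet> x + c))" for b
      by (intro C_k_mult C_k_const Suc.IH)
  qed
qed

text \<open>As \<open>s \<longrightarrow> \<infinity>\<close>, the factors \<open>exp (- 1 / (s * t))\<close> tend to \<open>1\<close> for \<open>t > 0\<close>, so these functions tend to the
  indicator function of the box.\<close>

definition box_bump :: "'a::euclidean_space \<Rightarrow> 'a \<Rightarrow> real \<Rightarrow> 'a \<Rightarrow> real" where
  "box_bump a b s x = (\<Prod>i\<in>Basis. flat_exp 1 (s * ((x - a) \<bullet> i)) * flat_exp 1 (s * ((b - x) \<bullet> i)))"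

lemma flat_exp_1_bounds: "0 \<le> flat_exp 1 t" "flat_exp 1 t \<le> 1" "0 < flat_exp 1 t \<longleftrightarrow> 0 < t"
  by (auto simp: flat_exp_def)

lemma flat_exp_tendsto: "(\<lambda>n. flat_exp 1 (real (Suc n) * t)) \<longlonglongrightarrow> (if 0 < t then 1 else 0)"
proof (cases "0 < t")
  case True
  have "(\<lambda>n. exp (- (inverse (real (Suc n)) * (1 / t)))) \<longlonglongrightarrow> exp (- (0 * (1 / t)))"
    by (intro tendsto_intros LIMSEQ_inverse_real_of_nat)
  moreover have "0 < real (Suc n) * t" for n using True by simp
  ultimately show ?thesis using True by (simp add: flat_exp_def divide_simps)
next
  case False
  then have "\<not> 0 < real (Suc n) * t" for n
    by (simp add: mult_nonneg_nonpos not_less)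
  then show ?thesis using False by (simp add: flat_exp_def)
qed

lemma box_bump_C_k: "C_k k (box_bump a b s)"
proof -
  have "box_bump a b s = (\<lambda>x. \<Prod>i\<in>Basis.
      flat_exp 1 ((s *\<^sub>R i) \<bullet> x + - s * (a \<bullet> i)) * flat_exp 1 ((- s *\<^sub>R i) \<bullet> x + s * (b \<bullet> i)))"
    by (auto simp: box_bump_def fun_eq_iff algebra_simps inner_commute intro!: prod.cong)
  then show ?thesis
    by (simp only:) (intro C_k_prod C_k_mult C_k_flat_exp)
qed

lemma box_bump_bounds: "0 \<le> box_bump a b s x" "box_bump a b s x \<le> 1"
  by (auto simp: box_bump_def intro!: prod_nonneg prod_le_1 mult_nonneg_nonneg mult_le_one flat_exp_1_bounds)

lemma box_bump_pos_iff: "0 < s \<Longrightarrow> 0 < box_bump a b s x \<longleftrightarrow> x \<in> box a b"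
proof -
  assume s: "0 < s"
  have "0 < box_bump a b s x \<longleftrightarrow> box_bump a b s x \<noteq> 0"
    using box_bump_bounds(1)[of a b s x] by auto
  also have "\<dots> \<longleftrightarrow> (\<forall>i\<in>Basis. 0 < flat_exp 1 (s * ((x - a) \<bullet> i)) \<and> 0 < flat_exp 1 (s * ((b - x) \<bullet> i)))"
    using flat_exp_1_bounds(1) by (auto simp: box_bump_def order_less_le)
  also have "\<dots> \<longleftrightarrow> x \<in> box a b"
    using s by (auto simp: flat_exp_1_bounds(3) zero_less_mult_iff box_def inner_diff_left)
  finally show ?thesis .
qed

lemma box_bump_eq_0: "0 < s \<Longrightarrow> x \<notin> box a b \<Longrightarrow> box_bump a b s x = 0"
  using box_bump_pos_iff[of s a b x] box_bump_bounds(1)[of a b s x] by auto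

lemma box_bump_test: "0 < s \<Longrightarrow> cbox a b \<subseteq> U \<Longrightarrow> test_function U (box_bump a b s)"
  unfolding test_function_def
  using box_bump_C_k box_bump_eq_0 compact_cbox box_subset_cbox by (metis in_mono)

lemma box_bump_tendsto: "(\<lambda>n. box_bump a b (real (Suc n)) x) \<longlonglongrightarrow> indicator (box a b) x"
proof -
  have "(\<lambda>n. box_bump a b (real (Suc n)) x) \<longlonglongrightarrow>
     (\<Prod>i\<in>Basis. (if 0 < (x - a) \<bullet> i then 1 else 0) * (if 0 < (b - x) \<bullet> i then 1 else 0))"
    unfolding box_bump_def by (intro tendsto_intros flat_exp_tendsto)
  also have "(\<Prod>i\<in>Basis. (if 0 < (x - a) \<bullet> i then 1 else 0) * (if 0 < (b - x) \<bullet> i then 1 else 0))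
     = (indicator (box a b) x :: real)"
  proof (cases "x \<in> box a b")
    case True
    then have "(\<Prod>i\<in>Basis. (if 0 < (x - a) \<bullet> i then 1 else 0) * (if 0 < (b - x) \<bullet> i then 1 else 0))
      = (\<Prod>i\<in>(Basis :: 'a set). (1 :: real))"
      by (intro prod.cong) (auto simp: box_def inner_diff_left)
    with True show ?thesis by simp
  next
    case False
    then obtain i where "i \<in> Basis" "\<not> (0 < (x - a) \<bullet> i \<and> 0 < (b - x) \<bullet> i)"
      by (auto simp: box_def inner_diff_left)
    with False show ?thesis by (auto intro!: bexI[of _ i])
  qed
  finally show ?thesis .
qed

section \<open>Weak gradients\<close>

text \<open>Open boxes form an intersection-stable generator of the Borel sets, and the sets over
  which \<open>g\<close> integrates to 0 form a Dynkin system; the hypothesis on the whole space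
  provides its closure under complements.\<close>

lemma integrable_on_boxes_eq_0:
  fixes g :: "'a::euclidean_space \<Rightarrow> real"
  assumes g: "integrable lborel g"
    and box: "\<And>a b. (\<integral>x. indicator (box a b) x * g x \<partial>lborel) = 0"
    and UNIV: "(\<integral>x. g x \<partial>lborel) = 0"
  shows "AE x in lborel. g x = 0"
proof (rule density_unique_real[OF g])
  fix A :: "'a set" assume "A \<in> sets lborel"
  then have A: "A \<in> sigma_sets UNIV (range (\<lambda>(a, b). box a b))"
    by (simp add: borel_eq_box sets_measure_of)
  have int: "integrable lborel (\<lambda>x. indicator A x * g x)" if "A \<in> sets borel" for A :: "'a set"
    using integrable_mult_indicator[of A lborel g] that g by simp
  have range_sub: "range (\<lambda>(a::'a, b). box a b) \<subseteq> Pow UNIV" by simp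
  have stable: "Int_stable (range (\<lambda>(a::'a, b). box a b))"
    by (auto simp: Int_stable_def box_Int_box)
  have "(\<integral>x. indicator A x * g x \<partial>lborel) = 0"
    using stable range_sub A
  proof (induction rule: sigma_sets_induct_disjoint)
    case (basic A)
    then show ?case by (auto simp: box)
  next
    case empty
    show ?case by simp
  next
    fix A assume "A \<in> sigma_sets UNIV (range (\<lambda>(a::'a, b). box a b))"
    then have A: "A \<in> sets borel" by (simp add: borel_eq_box sets_measure_of)
    assume *: "(\<integral>x. indicator A x * g x \<partial>lborel) = 0"
    have "(\<integral>x. indicator (UNIV - A) x * g x \<partial>lborel) = (\<integral>x. g x - indicator A x * g x \<partial>lborel)"
      by (intro Bochner_Integration.integral_cong) (auto simp: indicator_def)
    then show "(\<integral>x. indicator (UNIV - A) x * g x \<partial>lborel) = 0"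
      using * UNIV g int[OF A] by simp
  next
    fix A :: "nat \<Rightarrow> 'a set"
    assume d: "disjoint_family A" and r: "range A \<subseteq> sigma_sets UNIV (range (\<lambda>(a::'a, b). box a b))"
      and *: "\<And>i. (\<integral>x. indicator (A i) x * g x \<partial>lborel) = 0"
    from r have A: "A i \<in> sets borel" for i by (auto simp: borel_eq_box sets_measure_of)
    have "(LINT x:(\<Union>i. A i)|lborel. g x) = (\<Sum>i. (LINT x:(A i)|lborel. g x))"
    proof (rule lebesgue_integral_countable_add)
      show "set_integrable lborel (\<Union>i. A i) g"
        using int[of "\<Union>i. A i"] A by (simp add: set_integrable_def)
    qed (use A d in \<open>auto simp: disjoint_family_on_def\<close>)
    then show "(\<integral>x. indicator (\<Union>i. A i) x * g x \<partial>lborel) = 0"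
      using * by (simp add: set_lebesgue_integral_def)
  qed
  then show "(LINT x:A|lborel. g x) = (LINT x:A|lborel. 0)"
    by (simp add: set_lebesgue_integral_def)
qed simp

text \<open>Bump functions converge boundedly to the indicator of a box, so \<open>g\<close>
  integrates to 0 over every open box whose closed box lies in \<open>U\<close>. This determines
  \<open>g\<close> on each such box, and countably many of them cover \<open>U\<close> up to a null
  set.\<close>

lemma fundamental_lemma:
  fixes g :: "'a::euclidean_space \<Rightarrow> real"
  assumes U: "open U" and g: "integrable (lebesgue_on U) g"
    and test: "\<And>\<psi>. test_function U \<psi> \<Longrightarrow> (\<integral>x. \<psi> x * g x \<partial>lebesgue_on U) = 0"
  shows "AE x in lebesgue_on U. g x = 0"
proof -
  have Us: "U \<in> sets lebesgue" using U by auto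
  have on_box: "(\<integral>x. indicator (box a b) x * g x \<partial>lebesgue_on U) = 0" if ab: "cbox a b \<subseteq> U" for a b
  proof -
    have "(\<lambda>n. \<integral>x. box_bump a b (real (Suc n)) x * g x \<partial>lebesgue_on U)
        \<longlonglongrightarrow> (\<integral>x. indicator (box a b) x * g x \<partial>lebesgue_on U)"
    proof (rule integral_dominated_convergence)
      show "integrable (lebesgue_on U) (\<lambda>x. norm (g x))" using g by simp
      have m: "box_bump a b s \<in> borel_measurable (lebesgue_on U)" for s
        using continuous_on_subset[OF C_k_continuous[OF box_bump_C_k[of 0]]]
        by (intro continuous_imp_measurable_on_sets_lebesgue Us) auto
      have gm: "g \<in> borel_measurable (lebesgue_on U)" using g by auto
      show "(\<lambda>x. box_bump a b (real (Suc n)) x * g x) \<in> borel_measurable (lebesgue_on U)" for n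
        using m gm by measurable
      show "(\<lambda>x. indicator (box a b) x * g x) \<in> borel_measurable (lebesgue_on U)"
        using gm ab box_subset_cbox[of a b] by (intro borel_measurable_times borel_measurable_indicator)
          (auto simp: sets_restrict_space_iff Us intro!: image_eqI[of _ _ "box a b"] sets_completionI_sets)
      show "AE x in lebesgue_on U. (\<lambda>n. box_bump a b (real (Suc n)) x * g x)
          \<longlonglongrightarrow> indicator (box a b) x * g x"
        by (intro AE_I2 tendsto_mult_right box_bump_tendsto)
      show "AE x in lebesgue_on U. norm (box_bump a b (real (Suc n)) x * g x) \<le> norm (g x)" for n
        by (intro AE_I2) (simp add: abs_mult box_bump_bounds mult_left_le_one_le)
    qed
    moreover have "(\<integral>x. box_bump a b (real (Suc n)) x * g x \<partial>lebesgue_on U) = 0" for n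
      using ab by (intro test box_bump_test) auto
    ultimately show ?thesis by (simp add: LIMSEQ_const_iff)
  qed
  have ae_box: "AE x in lebesgue. x \<in> box a b \<longrightarrow> g x = 0" if ab: "cbox a b \<subseteq> U" for a b
  proof -
    have "box a b \<subseteq> U" using ab box_subset_cbox by blast
    \<comment> \<open>Cutting \<open>g\<close> off to one box makes arbitrary boxes admissible:
      intersected with \<open>box a b\<close> they are boxes inside \<open>U\<close> again.\<close>
    define G where "G = (\<lambda>x. indicator (box a b) x * g x)"
    have "integrable lebesgue (\<lambda>x. indicator U x *\<^sub>R g x)"
      using g Us by (simp add: integrable_restrict_space)
    then have "integrable lebesgue (\<lambda>x. indicator (box a b) x *\<^sub>R indicator U x *\<^sub>R g x)"
      by (rule integrable_mult_indicator[rotated]) auto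
    also have "(\<lambda>x. indicator (box a b) x *\<^sub>R indicator U x *\<^sub>R g x) = G"
      using \<open>box a b \<subseteq> U\<close> by (auto simp: G_def fun_eq_iff indicator_def)
    finally have G: "integrable lebesgue G" .
    \<comment> \<open>The uniqueness argument on boxes lives on Borel sets, so the Lebesgue
      measurable \<open>G\<close> is replaced by a Borel representative.\<close>
    then obtain G' where G': "G' \<in> borel_measurable lborel" "AE x in lborel. G x = G' x"
      using completion_ex_borel_measurable_real[of G lborel] by auto
    have eq: "AE x in lebesgue. G x = G' x" using G'(2) by (rule AE_completion)
    have G'm: "G' \<in> borel_measurable lebesgue" using G'(1) by (rule measurable_completion)
    have intG': "integrable lborel G'"
      using integrable_cong_AE_imp[OF G G'm] eq G'(1)
      by (simp add: integrable_completion eq_commute)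
    have z: "(\<integral>x. indicator (box c d) x * G' x \<partial>lborel) = 0" for c d
    proof -
      have "(\<integral>x. indicator (box c d) x * G' x \<partial>lborel) = (\<integral>x. indicator (box c d) x * G' x \<partial>lebesgue)"
        using G'(1) by (intro integral_completion[symmetric]) auto
      also have "\<dots> = (\<integral>x. indicator (box c d) x * G x \<partial>lebesgue)"
        using eq G'm G by (intro integral_cong_AE) (auto intro!: borel_measurable_times borel_measurable_indicator)
      also have "\<dots> = (\<integral>x. indicator U x * (indicator (box c d \<inter> box a b) x * g x) \<partial>lebesgue)"
        using \<open>box a b \<subseteq> U\<close> by (intro Bochner_Integration.integral_cong) (auto simp: G_def indicator_def)
      also have "\<dots> = (\<integral>x. indicator (box c d \<inter> box a b) x * g x \<partial>lebesgue_on U)"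
        using Us by (simp add: integral_restrict_space)
      also have "\<dots> = 0"
        unfolding box_Int_box
      proof (rule on_box)
        show "cbox (\<Sum>i\<in>Basis. max (c \<bullet> i) (a \<bullet> i) *\<^sub>R i) (\<Sum>i\<in>Basis. min (d \<bullet> i) (b \<bullet> i) *\<^sub>R i) \<subseteq> U"
          using ab by (force simp: cbox_def)
      qed
      finally show ?thesis .
    qed
    have "(\<integral>x. G' x \<partial>lborel) = (\<integral>x. G x \<partial>lebesgue)"
      using G'(1) eq G'm G by (subst integral_completion[symmetric]) (auto intro!: integral_cong_AE)
    also have "\<dots> = (\<integral>x. indicator (box a b) x * G x \<partial>lebesgue)"
      by (intro Bochner_Integration.integral_cong) (auto simp: G_def indicator_def)
    also have "\<dots> = (\<integral>x. indicator (box a b) x * G' x \<partial>lebesgue)"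
      using eq G'm G by (intro integral_cong_AE) (auto intro!: borel_measurable_times borel_measurable_indicator)
    also have "\<dots> = 0"
      using z[of a b] G'(1) by (subst integral_completion) auto
    finally have "AE x in lborel. G' x = 0"
      by (rule integrable_on_boxes_eq_0[OF intG' z])
    then have "AE x in lebesgue. G' x = 0" by (rule AE_completion)
    with eq show ?thesis
      by eventually_elim (auto simp: G_def)
  qed
  obtain D where D: "countable D" "D \<subseteq> Pow U" "\<And>X. X \<in> D \<Longrightarrow> \<exists>a b. X = cbox a b"
    and "\<Union>D = U"
    using open_countable_Union_open_cbox[OF U] by auto
  have "AE x in lebesgue. x \<in> X \<longrightarrow> g x = 0" if "X \<in> D" for X
  proof -
    from D(3)[OF that] obtain a b where X: "X = cbox a b" by auto
    \<comment> \<open>The covering consists of closed boxes, the vanishing is known on open ones;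
      the difference is a null set.\<close>
    have "negligible (cbox a b - box a b)" by (rule negligible_frontier_interval)
    then have "AE x in lebesgue. x \<notin> cbox a b - box a b"
      by (intro AE_not_in) (simp add: negligible_iff_null_sets)
    moreover have "AE x in lebesgue. x \<in> box a b \<longrightarrow> g x = 0"
      using that D(2) X by (intro ae_box) auto
    ultimately show ?thesis
      by eventually_elim (auto simp: X)
  qed
  then have "AE x in lebesgue. \<forall>X\<in>D. x \<in> X \<longrightarrow> g x = 0"
    by (subst AE_ball_countable[OF D(1)]) blast
  then have "AE x in lebesgue. x \<in> U \<longrightarrow> g x = 0"
    by eventually_elim (use \<open>\<Union>D = U\<close> in blast)
  then show ?thesis
    using Us by (simp add: AE_restrict_space_iff)
qed

lemma test_function_has_derivative:
  assumes "test_function U \<phi>"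
  shows "(\<phi> has_derivative (\<lambda>h. grad \<phi> x \<bullet> h)) (at x)"
proof -
  have d: "(\<phi> has_derivative frechet_derivative \<phi> (at x)) (at x)"
    using assms by (intro C_k_differentiable[of 0]) (auto simp: test_function_def simp del: C_k.simps)
  have "frechet_derivative \<phi> (at x) = (\<lambda>h. grad \<phi> x \<bullet> h)"
  proof
    fix h
    interpret linear "frechet_derivative \<phi> (at x)"
      using d by (rule has_derivative_linear)
    have "frechet_derivative \<phi> (at x) (\<Sum>b\<in>Basis. (h \<bullet> b) *\<^sub>R b)
       = (\<Sum>b\<in>Basis. (h \<bullet> b) * frechet_derivative \<phi> (at x) b)"
      by (simp add: sum scale)
    also have "\<dots> = grad \<phi> x \<bullet> h"
      by (simp add: grad_def inner_sum_left inner_sum_right inner_commute mult.commute)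
    finally show "frechet_derivative \<phi> (at x) h = grad \<phi> x \<bullet> h"
      by (simp add: euclidean_representation)
  qed
  with d show ?thesis by simp
qed

lemma grad_eqI:
  assumes "test_function U \<phi>" "(\<phi> has_derivative (\<lambda>h. c \<bullet> h)) (at x)"
  shows "grad \<phi> x = c"
  using has_derivative_unique[OF test_function_has_derivative[OF assms(1)] assms(2)]
  by (simp add: fun_eq_iff vector_eq_rdot)

lemma test_function_continuous: "test_function U \<phi> \<Longrightarrow> continuous_on S \<phi>"
  using continuous_on_subset[OF C_k_continuous[of 0 \<phi>] subset_UNIV] by (simp add: test_function_def del: C_k.simps)

lemma grad_continuous:
  assumes "test_function U \<phi>"
  shows "continuous_on S (grad \<phi>)"
proof -
  have "continuous_on UNIV (\<lambda>x. frechet_derivative \<phi> (at x) b)" if "b \<in> Basis" for b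
  proof -
    have "C_k (Suc 0) \<phi>" using assms unfolding test_function_def by blast
    with that show ?thesis by simp
  qed
  then have "continuous_on UNIV (grad \<phi>)"
    unfolding grad_def by (intro continuous_intros) auto
  then show ?thesis by (rule continuous_on_subset) simp
qed

lemma test_function_support:
  assumes "test_function U \<phi>"
  obtains K where "compact K" "K \<subseteq> U" "\<And>x. x \<notin> K \<Longrightarrow> \<phi> x = 0" "\<And>x. x \<notin> K \<Longrightarrow> grad \<phi> x = 0"
proof -
  from assms obtain K where K: "compact K" "K \<subseteq> U" "\<And>x. x \<notin> K \<Longrightarrow> \<phi> x = 0"
    by (auto simp: test_function_def)
  have "grad \<phi> x = 0" if "x \<notin> K" for x
  proof (rule grad_eqI[OF assms])
    have "open (- K)" using K(1) compact_imp_closed by auto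
    then show "(\<phi> has_derivative (\<lambda>h. 0 \<bullet> h)) (at x)"
      by (intro has_derivative_transform_within_open[of "\<lambda>x. 0" _ x UNIV "- K" \<phi>]) (use K(3) that in auto)
  qed
  with K show ?thesis using that by blast
qed

lemma bounded_of_compact_support:
  fixes f :: "'a::euclidean_space \<Rightarrow> 'b::real_normed_vector"
  assumes "continuous_on K f" "compact K" "\<And>x. x \<notin> K \<Longrightarrow> f x = 0"
  obtains B where "0 < B" "\<And>x. norm (f x) \<le> B"
proof -
  have "bounded (f ` K)" using assms compact_continuous_image compact_imp_bounded by blast
  then obtain B where "0 < B" "\<forall>y\<in>f ` K. norm y \<le> B" by (auto simp: bounded_pos)
  then show ?thesis using assms(3) by (intro that[of B]) (metis image_eqI less_eq_real_def norm_zero)+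
qed

lemma grad_bounded:
  assumes "test_function U \<phi>"
  obtains B where "0 < B" "\<And>x. norm (grad \<phi> x) \<le> B"
proof -
  obtain K where "compact K" "\<And>x. x \<notin> K \<Longrightarrow> grad \<phi> x = 0"
    using test_function_support[OF assms] by metis
  from bounded_of_compact_support[OF grad_continuous[OF assms] this] show ?thesis
    using that by blast
qed

lemma test_function_bounded:
  assumes "test_function U \<phi>"
  obtains B where "0 < B" "\<And>x. norm (\<phi> x) \<le> B"
proof -
  obtain K where "compact K" "\<And>x. x \<notin> K \<Longrightarrow> \<phi> x = 0"
    using test_function_support[OF assms] by metis
  from bounded_of_compact_support[OF test_function_continuous[OF assms] this] show ?thesis
    using that by blast
qed

lemma test_function_L2:
  assumes "open U" "bounded U" "test_function V \<phi>"
  shows "L2_on U \<phi>" "L2_on U (grad \<phi>)"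
proof -
  have U: "U \<in> lmeasurable" using assms by (intro lmeasurable_open)
  obtain B B' where B: "\<And>x. norm (\<phi> x) \<le> B" and B': "\<And>x. norm (grad \<phi> x) \<le> B'"
    using test_function_bounded[OF assms(3)] grad_bounded[OF assms(3)] by metis
  from B show "L2_on U \<phi>"
    by (rule L2_on_continuous_bounded[OF U test_function_continuous[OF assms(3)]])
  from B' show "L2_on U (grad \<phi>)"
    by (rule L2_on_continuous_bounded[OF U grad_continuous[OF assms(3)]])
qed

text \<open>The fundamental lemma is applied to each component of the difference. Since
  \<open>weak_grad\<close> is chosen by \<open>SOME\<close>, every later identity for gradients is
  derived from this uniqueness.\<close>

lemma has_weak_grad_unique:
  assumes U: "open U" "bounded U" and g: "has_weak_grad U u g" and h: "has_weak_grad U u h"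
  shows "AE x in lebesgue_on U. g x = h x"
proof -
  have L2: "L2_on U (\<lambda>x. g x - h x)"
    using g h by (intro L2_on_diff) (auto simp: has_weak_grad_def)
  have "AE x in lebesgue_on U. (g x - h x) \<bullet> b = 0" if "b \<in> Basis" for b
  proof (rule fundamental_lemma[OF U(1)])
    have "L2_on U (\<lambda>x. b)"
      using U by (intro L2_on_bounded[of _ _ "norm b"] lmeasurable_open) auto
    with L2 show "integrable (lebesgue_on U) (\<lambda>x. (g x - h x) \<bullet> b)"
      by (rule L2_on_inner_integrable)
    fix \<psi> assume \<psi>: "test_function U \<psi>"
    have ig: "integrable (lebesgue_on U) (\<lambda>x. \<psi> x *\<^sub>R g x)" "integrable (lebesgue_on U) (\<lambda>x. \<psi> x *\<^sub>R h x)"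
      using g h test_function_L2[OF U \<psi>] by (auto intro!: L2_on_scaled_integrable simp: has_weak_grad_def)
    have "(\<integral>x. \<psi> x *\<^sub>R g x \<partial>lebesgue_on U) = (\<integral>x. \<psi> x *\<^sub>R h x \<partial>lebesgue_on U)"
      using g h \<psi> by (auto simp: has_weak_grad_def)
    moreover have "(\<integral>x. \<psi> x * ((g x - h x) \<bullet> b) \<partial>lebesgue_on U)
       = ((\<integral>x. \<psi> x *\<^sub>R g x \<partial>lebesgue_on U) - (\<integral>x. \<psi> x *\<^sub>R h x \<partial>lebesgue_on U)) \<bullet> b"
      using ig by (simp add: Bochner_Integration.integral_diff[symmetric] integral_inner_left[symmetric]
          inner_diff_left right_diff_distrib del: Bochner_Integration.integral_diff integral_inner_left)
    ultimately show "(\<integral>x. \<psi> x * ((g x - h x) \<bullet> b) \<partial>lebesgue_on U) = 0"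
      by simp
  qed
  then have "AE x in lebesgue_on U. \<forall>b\<in>Basis. (g x - h x) \<bullet> b = 0"
    by (simp add: AE_finite_all)
  then show ?thesis
    by eventually_elim (metis euclidean_all_zero_iff right_minus_eq)
qed

lemma has_weak_grad_lincomb:
  assumes U: "open U" "bounded U" and g: "has_weak_grad U u g" and h: "has_weak_grad U v h"
  shows "has_weak_grad U (\<lambda>x. u x + c * v x) (\<lambda>x. g x + c *\<^sub>R h x)"
  unfolding has_weak_grad_def
proof (intro conjI allI impI)
  show "L2_on U (\<lambda>x. u x + c * v x)" "L2_on U (\<lambda>x. g x + c *\<^sub>R h x)"
    using g h L2_on_scaleR[of U v c] by (auto simp: has_weak_grad_def intro!: L2_on_add L2_on_scaleR)
  fix \<psi> assume \<psi>: "test_function U \<psi>"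
  have ig: "integrable (lebesgue_on U) (\<lambda>x. \<psi> x *\<^sub>R g x)" "integrable (lebesgue_on U) (\<lambda>x. \<psi> x *\<^sub>R h x)"
    "integrable (lebesgue_on U) (\<lambda>x. u x *\<^sub>R grad \<psi> x)" "integrable (lebesgue_on U) (\<lambda>x. v x *\<^sub>R grad \<psi> x)"
    using g h test_function_L2[OF U \<psi>] by (auto intro!: L2_on_scaled_integrable simp: has_weak_grad_def)
  have "(\<integral>x. (u x + c * v x) *\<^sub>R grad \<psi> x \<partial>lebesgue_on U)
    = (\<integral>x. u x *\<^sub>R grad \<psi> x \<partial>lebesgue_on U) + c *\<^sub>R (\<integral>x. v x *\<^sub>R grad \<psi> x \<partial>lebesgue_on U)"
    using ig by (simp add: scaleR_add_left scaleR_scaleR[symmetric] del: scaleR_scaleR)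
  also have "\<dots> = - (\<integral>x. \<psi> x *\<^sub>R g x \<partial>lebesgue_on U) - c *\<^sub>R (\<integral>x. \<psi> x *\<^sub>R h x \<partial>lebesgue_on U)"
    using g h \<psi> by (simp add: has_weak_grad_def)
  also have "\<dots> = - (\<integral>x. \<psi> x *\<^sub>R (g x + c *\<^sub>R h x) \<partial>lebesgue_on U)"
    using ig by (simp add: scaleR_add_right scaleR_left_commute[of _ c] del: scaleR_scaleR)
  finally show "(\<integral>x. (u x + c * v x) *\<^sub>R grad \<psi> x \<partial>lebesgue_on U)
    = - (\<integral>x. \<psi> x *\<^sub>R (g x + c *\<^sub>R h x) \<partial>lebesgue_on U)" .
qed

lemma test_function_lincomb:
  assumes "test_function U \<phi>" "test_function U \<psi>"
  shows "test_function U (\<lambda>x. \<phi> x + c * \<psi> x)"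
proof -
  obtain K K' where "compact K" "K \<subseteq> U" "\<And>x. x \<notin> K \<Longrightarrow> \<phi> x = 0"
    "compact K'" "K' \<subseteq> U" "\<And>x. x \<notin> K' \<Longrightarrow> \<psi> x = 0"
    using assms unfolding test_function_def by metis
  then have "\<exists>K. compact K \<and> K \<subseteq> U \<and> (\<forall>x. x \<notin> K \<longrightarrow> \<phi> x + c * \<psi> x = 0)"
    by (intro exI[of _ "K \<union> K'"]) auto
  then show ?thesis
    using assms by (auto simp: test_function_def intro!: C_k_add C_k_mult C_k_const)
qed

text \<open>A single coefficient covers sums and, with \<open>c = -1\<close>, differences. The
  approximating test functions are combined with the same coefficient, and the triangle inequality
  controls both norms.\<close>

lemma H10_lincomb:
  assumes U: "open U" "bounded U" and u: "u \<in> H10 U" and v: "v \<in> H10 U"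
  shows "(\<lambda>x. u x + c * v x) \<in> H10 U"
proof -
  obtain g \<phi> where g: "has_weak_grad U u g" and \<phi>: "\<And>n. test_function U (\<phi> n)"
    "(\<lambda>n::nat. L2_norm U (\<lambda>x. \<phi> n x - u x)) \<longlonglongrightarrow> 0" "(\<lambda>n. L2_norm U (\<lambda>x. grad (\<phi> n) x - g x)) \<longlonglongrightarrow> 0"
    using u by (auto simp: H10_def)
  obtain h \<psi> where h: "has_weak_grad U v h" and \<psi>: "\<And>n. test_function U (\<psi> n)"
    "(\<lambda>n::nat. L2_norm U (\<lambda>x. \<psi> n x - v x)) \<longlonglongrightarrow> 0" "(\<lambda>n. L2_norm U (\<lambda>x. grad (\<psi> n) x - h x)) \<longlonglongrightarrow> 0"
    using v by (auto simp: H10_def)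
  have L2: "L2_on U u" "L2_on U g" "L2_on U v" "L2_on U h"
    using g h by (auto simp: has_weak_grad_def)
  note tl = test_function_lincomb[OF \<phi>(1) \<psi>(1)]
  have gr: "grad (\<lambda>x. \<phi> n x + c * \<psi> n x) x = grad (\<phi> n) x + c *\<^sub>R grad (\<psi> n) x" for n x
    by (rule grad_eqI[OF tl])
       (auto intro!: derivative_eq_intros test_function_has_derivative[OF \<phi>(1)]
          test_function_has_derivative[OF \<psi>(1)] simp: inner_add_left)
  have squeeze: "(\<lambda>n. L2_norm U (\<lambda>x. F n x + c *\<^sub>R G n x)) \<longlonglongrightarrow> 0"
    if "\<And>n. L2_on U (F n)" "\<And>n. L2_on U (G n)"
      "(\<lambda>n. L2_norm U (F n)) \<longlonglongrightarrow> 0" "(\<lambda>n. L2_norm U (G n)) \<longlonglongrightarrow> 0"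
    for F G :: "nat \<Rightarrow> 'a \<Rightarrow> 'b::euclidean_space"
  proof (rule tendsto_sandwich[OF _ _ tendsto_const])
    show "(\<lambda>n. L2_norm U (F n) + \<bar>c\<bar> * L2_norm U (G n)) \<longlonglongrightarrow> 0"
      using that(3,4) by (auto intro!: tendsto_eq_intros)
    show "\<forall>\<^sub>F n in sequentially. L2_norm U (\<lambda>x. F n x + c *\<^sub>R G n x) \<le> L2_norm U (F n) + \<bar>c\<bar> * L2_norm U (G n)"
      using L2_norm_triangle[OF that(1) L2_on_scaleR[OF that(2)]] by (simp add: L2_norm_scaleR)
  qed (simp add: L2_norm_nonneg)
  have 1: "(\<lambda>n. L2_norm U (\<lambda>x. (\<phi> n x - u x) + c *\<^sub>R (\<psi> n x - v x))) \<longlonglongrightarrow> 0"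
    using test_function_L2[OF U \<phi>(1)] test_function_L2[OF U \<psi>(1)] \<phi> \<psi> L2 by (intro squeeze L2_on_diff)
  have 2: "(\<lambda>n. L2_norm U (\<lambda>x. (grad (\<phi> n) x - g x) + c *\<^sub>R (grad (\<psi> n) x - h x))) \<longlonglongrightarrow> 0"
    using test_function_L2[OF U \<phi>(1)] test_function_L2[OF U \<psi>(1)] \<phi> \<psi> L2 by (intro squeeze L2_on_diff)
  show ?thesis
    unfolding H10_def
    apply (clarsimp, intro exI[of _ "\<lambda>x. g x + c *\<^sub>R h x"] conjI has_weak_grad_lincomb U g h
      exI[of _ "\<lambda>n x. \<phi> n x + c * \<psi> n x"] allI tl)
    using 1 2 by (simp_all add: gr algebra_simps)
qed

lemma has_weak_grad_weak_grad:
  assumes "u \<in> H10 U"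
  shows "has_weak_grad U u (weak_grad U u)"
proof -
  obtain g where "has_weak_grad U u g" using assms by (auto simp: H10_def)
  then show ?thesis unfolding weak_grad_def by (rule someI[of "has_weak_grad U u"])
qed

lemma weak_grad_lincomb:
  assumes U: "open U" "bounded U" and u: "u \<in> H10 U" and v: "v \<in> H10 U"
  shows "AE x in lebesgue_on U. weak_grad U (\<lambda>x. u x + c * v x) x = weak_grad U u x + c *\<^sub>R weak_grad U v x"
  by (rule has_weak_grad_unique[OF U has_weak_grad_weak_grad[OF H10_lincomb[OF assms]]
        has_weak_grad_lincomb[OF U u[THEN has_weak_grad_weak_grad] v[THEN has_weak_grad_weak_grad]]])

section \<open>The energy\<close>

definition A_field :: "(real \<Rightarrow> real) \<Rightarrow> 'a::euclidean_space \<Rightarrow> 'a" where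
  "A_field m y = m ((norm y)\<^sup>2) *\<^sub>R y"

text \<open>The potential of \<open>A_field\<close>: its gradient at y is
  \<open>m ((norm y)^2)\<close> times y, which makes the operator the derivative of the
  energy.\<close>

definition energy_density :: "(real \<Rightarrow> real) \<Rightarrow> 'a::euclidean_space \<Rightarrow> real" where
  "energy_density m y = 1 / 2 * integral {0..(norm y)\<^sup>2} m"

lemma A_field_0 [simp]: "A_field m 0 = 0"
  by (simp add: A_field_def)

lemma energy_density_0 [simp]: "energy_density m 0 = 0"
  by (simp add: energy_density_def)

text \<open>The growth condition between 0 and r, divided by r; hence no bound results at the
  argument 0.\<close>

lemma admissible_coefficient_bounds:
  assumes "admissible_coefficient m \<alpha> L" "0 < r"
  shows "\<alpha> \<le> m (r\<^sup>2)" "m (r\<^sup>2) \<le> L / 3"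
proof -
  have "\<alpha> * (r - 0) \<le> m (r\<^sup>2) * r - m (0\<^sup>2) * 0" "m (r\<^sup>2) * r - m (0\<^sup>2) * 0 \<le> L / 3 * (r - 0)"
    using assms unfolding admissible_coefficient_def by (metis less_eq_real_def order_refl)+
  with \<open>0 < r\<close> show "\<alpha> \<le> m (r\<^sup>2)" "m (r\<^sup>2) \<le> L / 3" by simp_all
qed

text \<open>Both sides split into a radial part, in \<open>a - b\<close>, and an angular part, in
  the Cauchy-Schwarz defect \<open>p\<close>. The growth condition controls the radial part and the
  bounds \<open>\<alpha> \<le> m \<le> L / 3\<close> the angular one. The upper bound keeps
  \<open>L / 3\<close> because the increment is paired with the same difference.\<close>

lemma A_field_monotone:
  fixes y z :: "'a::euclidean_space"
  assumes m: "admissible_coefficient m \<alpha> L"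
  shows "\<alpha> * (norm (y - z))\<^sup>2 \<le> (A_field m y - A_field m z) \<bullet> (y - z)"
    and "(A_field m y - A_field m z) \<bullet> (y - z) \<le> L / 3 * (norm (y - z))\<^sup>2"
proof -
  define a b ma mb p where "a = norm y" and "b = norm z" and "ma = m (a\<^sup>2)" and "mb = m (b\<^sup>2)"
    and "p = a * b - y \<bullet> z"
  have nn: "0 \<le> a" "0 \<le> b" by (simp_all add: a_def b_def)
  have p: "0 \<le> p" using norm_cauchy_schwarz[of y z] by (simp add: p_def a_def b_def)
  have inner: "(A_field m y - A_field m z) \<bullet> (y - z) = (ma * a - mb * b) * (a - b) + (ma + mb) * p"
    unfolding A_field_def a_def[symmetric] b_def[symmetric] ma_def[symmetric] mb_def[symmetric]
    by (simp add: algebra_simps inner_commute p_def dot_square_norm power2_eq_square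
        flip: a_def b_def)
  have norm: "(norm (y - z))\<^sup>2 = (a - b)\<^sup>2 + 2 * p"
    using norm_add_sq[of y "- z"] by (simp add: power2_diff p_def a_def b_def)
  have 1: "\<alpha> * (a - b)\<^sup>2 \<le> (ma * a - mb * b) * (a - b) \<and> (ma * a - mb * b) * (a - b) \<le> L / 3 * (a - b)\<^sup>2"
  proof (cases "b \<le> a")
    case True
    have "\<alpha> * (a - b) \<le> ma * a - mb * b" "ma * a - mb * b \<le> L / 3 * (a - b)"
      using m True nn unfolding admissible_coefficient_def ma_def mb_def by blast+
    then have "\<alpha> * (a - b) * (a - b) \<le> (ma * a - mb * b) * (a - b)"
      "(ma * a - mb * b) * (a - b) \<le> L / 3 * (a - b) * (a - b)"
      using True by (intro mult_right_mono; simp)+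
    then show ?thesis by (simp add: power2_eq_square mult.assoc)
  next
    case False
    have "\<alpha> * (b - a) \<le> mb * b - ma * a" "mb * b - ma * a \<le> L / 3 * (b - a)"
      using m False nn unfolding admissible_coefficient_def ma_def mb_def by (metis not_le less_imp_le)+
    then have "\<alpha> * (b - a) * (b - a) \<le> (mb * b - ma * a) * (b - a)"
      "(mb * b - ma * a) * (b - a) \<le> L / 3 * (b - a) * (b - a)"
      using False by (intro mult_right_mono; simp)+
    then show ?thesis by (simp add: power2_eq_square algebra_simps)
  qed
  have 2: "2 * \<alpha> * p \<le> (ma + mb) * p \<and> (ma + mb) * p \<le> 2 * (L / 3) * p"
  proof (cases "a = 0 \<or> b = 0")
    case True
    then have "p = 0" by (auto simp: p_def a_def b_def)
    then show ?thesis by simp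
  next
    case False
    then have "\<alpha> \<le> ma" "ma \<le> L / 3" "\<alpha> \<le> mb" "mb \<le> L / 3"
      using admissible_coefficient_bounds[OF m] nn by (auto simp: ma_def mb_def)
    with p show ?thesis by (intro conjI mult_right_mono) auto
  qed
  show "\<alpha> * (norm (y - z))\<^sup>2 \<le> (A_field m y - A_field m z) \<bullet> (y - z)"
    using 1 2 unfolding inner norm by (simp add: algebra_simps)
  show "(A_field m y - A_field m z) \<bullet> (y - z) \<le> L / 3 * (norm (y - z))\<^sup>2"
    using 1 2 unfolding inner norm by (simp add: algebra_simps)
qed

lemma admissible_coefficient_continuous:
  assumes "admissible_coefficient m \<alpha> L"
  shows "continuous_on {0..} m"
proof -
  obtain m' where "\<forall>t\<ge>0. (m has_real_derivative m' t) (at t within {0..})"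
    using assms by (auto simp: admissible_coefficient_def)
  then show ?thesis
    by (intro DERIV_continuous_on) auto
qed

lemma primitive_has_derivative:
  assumes m: "admissible_coefficient m \<alpha> L" and r: "0 \<le> r"
  shows "((\<lambda>r. integral {0..r} m) has_real_derivative m r) (at r within {0..})"
proof -
  \<comment> \<open>The interval extends beyond r so that near r it looks like the half line, also
    when \<open>r = 0\<close>.\<close>
  have "((\<lambda>r. integral {0..r} m) has_real_derivative m r) (at r within {0..r + 1})"
    using r by (intro integral_has_real_derivative continuous_on_subset[OF admissible_coefficient_continuous[OF m]]) auto
  moreover have "at r within {0..r + 1} = at r within {0..}"
    by (rule at_within_nhd[of _ "{..<r + 1}"]) (use r in auto)
  ultimately show ?thesis by simp
qed

lemma energy_density_has_derivative:
  fixes y h :: "'a::euclidean_space"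
  assumes m: "admissible_coefficient m \<alpha> L"
  shows "((\<lambda>t. energy_density m (y + t *\<^sub>R h)) has_real_derivative A_field m (y + t *\<^sub>R h) \<bullet> h) (at t)"
proof -
  define q where "q = (\<lambda>t. (norm (y + t *\<^sub>R h))\<^sup>2)"
  have q: "(q has_real_derivative 2 * ((y + t *\<^sub>R h) \<bullet> h)) (at t)"
    unfolding q_def power2_norm_eq_inner has_field_derivative_def
    by (auto intro!: derivative_eq_intros simp: inner_commute algebra_simps)
  \<comment> \<open>The primitive is differentiable only within the half line. The squared norm
    \<open>q\<close> never leaves it, so the chain rule relative to the range of \<open>q\<close>
    works even where \<open>y + t h\<close> vanishes.\<close>
  have "((\<lambda>r. integral {0..r} m) has_real_derivative m (q t)) (at (q t) within range q)"
    by (rule DERIV_subset[OF primitive_has_derivative[OF m]]) (auto simp: q_def)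
  from DERIV_image_chain[OF this q]
  have "((\<lambda>t. integral {0..q t} m) has_real_derivative m (q t) * (2 * ((y + t *\<^sub>R h) \<bullet> h))) (at t)"
    by (simp add: o_def)
  from DERIV_cmult[OF this, of "1 / 2"] show ?thesis
    by (simp add: energy_density_def A_field_def q_def)
qed

text \<open>Along the segment the derivative of the remainder is
  \<open>(A_field m (y + t h) - A_field m y)\<close> paired with h, which lies between 0 and
  \<open>L * t * (norm h)^2\<close>. Integration over the unit interval produces the factor
  \<open>L / 2\<close>.\<close>

lemma energy_density_taylor:
  fixes y h :: "'a::euclidean_space"
  assumes m: "admissible_coefficient m \<alpha> L"
  shows "0 \<le> energy_density m (y + h) - energy_density m y - A_field m y \<bullet> h"
    and "energy_density m (y + h) - energy_density m y - A_field m y \<bullet> h \<le> L / 2 * (norm h)\<^sup>2"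
proof -
  define \<phi> where "\<phi> = (\<lambda>t. energy_density m (y + t *\<^sub>R h) - t * (A_field m y \<bullet> h))"
  have L: "0 < \<alpha>" "\<alpha> \<le> L / 3" using m by (auto simp: admissible_coefficient_def)
  have D: "(\<phi> has_real_derivative (A_field m (y + t *\<^sub>R h) - A_field m y) \<bullet> h) (at t)" for t
    unfolding \<phi>_def
    by (auto intro!: derivative_eq_intros energy_density_has_derivative[OF m] simp: inner_diff_left)
  have bounds: "0 \<le> (A_field m (y + t *\<^sub>R h) - A_field m y) \<bullet> h \<and>
    (A_field m (y + t *\<^sub>R h) - A_field m y) \<bullet> h \<le> L * t * (norm h)\<^sup>2" if t: "0 \<le> t" for t
  proof (cases "t = 0")
    case False
    \<comment> \<open>Monotonicity is formulated for the difference \<open>t h\<close> of the two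
      points, so it bounds \<open>t * I\<close>; division by t needs
      \<open>t \<noteq> 0\<close>.\<close>
    define I where "I = (A_field m (y + t *\<^sub>R h) - A_field m y) \<bullet> h"
    have "\<alpha> * (t\<^sup>2 * (norm h)\<^sup>2) \<le> t * I" "t * I \<le> L / 3 * (t\<^sup>2 * (norm h)\<^sup>2)"
      using A_field_monotone[OF m, of "y + t *\<^sub>R h" y] by (simp_all add: power_mult_distrib I_def)
    moreover have "0 \<le> \<alpha> * (t\<^sup>2 * (norm h)\<^sup>2)" using L by simp
    moreover have "L / 3 * (t\<^sup>2 * (norm h)\<^sup>2) \<le> L * (t\<^sup>2 * (norm h)\<^sup>2)"
      using L by (intro mult_right_mono) auto
    ultimately have "t * 0 \<le> t * I" "t * I \<le> t * (L * t * (norm h)\<^sup>2)"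
      by (auto simp: power2_eq_square mult_ac)
    then show ?thesis using False t unfolding I_def by (simp only: mult_le_cancel_left)
  qed simp
  have "\<phi> 0 \<le> \<phi> 1"
  proof (rule DERIV_nonneg_imp_nondecreasing[of 0 1 \<phi>])
    fix t :: real assume "0 \<le> t" "t \<le> 1"
    then show "\<exists>d. (\<phi> has_real_derivative d) (at t) \<and> 0 \<le> d"
      using D[of t] bounds[of t] by blast
  qed simp
  then show "0 \<le> energy_density m (y + h) - energy_density m y - A_field m y \<bullet> h"
    by (simp add: \<phi>_def)
  have "\<phi> 1 - L / 2 * 1\<^sup>2 * (norm h)\<^sup>2 \<le> \<phi> 0 - L / 2 * 0\<^sup>2 * (norm h)\<^sup>2"
  proof (rule DERIV_nonpos_imp_nonincreasing[of 0 1 "\<lambda>t. \<phi> t - L / 2 * t\<^sup>2 * (norm h)\<^sup>2"])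
    fix t :: real assume t: "0 \<le> t" "t \<le> 1"
    have "((\<lambda>t. L / 2 * t\<^sup>2 * (norm h)\<^sup>2) has_real_derivative L * t * (norm h)\<^sup>2) (at t)"
      by (auto intro!: derivative_eq_intros)
    note DERIV_diff[OF D this]
    with bounds[OF t(1)] show "\<exists>d. ((\<lambda>t. \<phi> t - L / 2 * t\<^sup>2 * (norm h)\<^sup>2) has_real_derivative d) (at t) \<and> d \<le> 0"
      by (intro exI conjI) auto
  qed simp
  then show "energy_density m (y + h) - energy_density m y - A_field m y \<bullet> h \<le> L / 2 * (norm h)\<^sup>2"
    by (simp add: \<phi>_def)
qed

lemma A_field_bound:
  assumes m: "admissible_coefficient m \<alpha> L"
  shows "norm (A_field m y) \<le> L / 3 * norm y"
proof (cases "y = 0")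
  case False
  then have "\<alpha> \<le> m ((norm y)\<^sup>2)" "m ((norm y)\<^sup>2) \<le> L / 3"
    using admissible_coefficient_bounds[OF m, of "norm y"] by auto
  moreover have "0 < \<alpha>" using m by (auto simp: admissible_coefficient_def)
  ultimately have "\<bar>m ((norm y)\<^sup>2)\<bar> \<le> L / 3" by simp
  then show ?thesis unfolding A_field_def norm_scaleR by (rule mult_right_mono) simp
qed simp

lemma A_field_continuous:
  assumes "admissible_coefficient m \<alpha> L"
  shows "continuous_on UNIV (A_field m :: 'a::euclidean_space \<Rightarrow> 'a)"
proof -
  have "continuous_on UNIV (\<lambda>y :: 'a. m ((norm y)\<^sup>2))"
  proof (rule continuous_on_compose2[OF admissible_coefficient_continuous[OF assms]])
    show "continuous_on UNIV (\<lambda>y :: 'a. (norm y)\<^sup>2)" by (intro continuous_intros)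
  qed auto
  then show ?thesis
    unfolding A_field_def by (intro continuous_on_scaleR continuous_on_id)
qed

lemma energy_density_continuous:
  assumes "admissible_coefficient m \<alpha> L"
  shows "continuous_on UNIV (energy_density m :: 'a::euclidean_space \<Rightarrow> real)"
proof -
  have "continuous_on {0..} (\<lambda>r. integral {0..r} m)"
    by (rule DERIV_continuous_on[OF primitive_has_derivative[OF assms]]) simp
  then have "continuous_on UNIV (\<lambda>y :: 'a. integral {0..(norm y)\<^sup>2} m)"
  proof (rule continuous_on_compose2)
    show "continuous_on UNIV (\<lambda>y :: 'a. (norm y)\<^sup>2)" by (intro continuous_intros)
  qed auto
  then show ?thesis
    unfolding energy_density_def by (rule continuous_on_mult_left)
qed

section \<open>The nonlinear operator and the energy on the Sobolev space\<close>

lemma L2_on_A_field: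
  assumes m: "admissible_coefficient m \<alpha> L" and g: "L2_on S g"
  shows "L2_on S (\<lambda>x. A_field m (g x))"
  unfolding L2_on_def
proof
  show meas: "(\<lambda>x. A_field m (g x)) \<in> borel_measurable (lebesgue_on S)"
    using borel_measurable_continuous_onI[OF A_field_continuous[OF m]] L2_on_measurable[OF g]
    by (rule measurable_compose[rotated])
  show "integrable (lebesgue_on S) (\<lambda>x. (norm (A_field m (g x)))\<^sup>2)"
  proof (rule Bochner_Integration.integrable_bound)
    show "integrable (lebesgue_on S) (\<lambda>x. (L / 3)\<^sup>2 * (norm (g x))\<^sup>2)"
      using g by (simp add: L2_on_def)
    have "(norm (A_field m y))\<^sup>2 \<le> (L / 3)\<^sup>2 * (norm y)\<^sup>2" for y :: 'b
      unfolding power_mult_distrib[symmetric] by (rule power_mono[OF A_field_bound[OF m]]) simp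
    then show "AE x in lebesgue_on S. norm ((norm (A_field m (g x)))\<^sup>2) \<le> norm ((L / 3)\<^sup>2 * (norm (g x))\<^sup>2)"
      by (intro AE_I2) simp
  qed (use meas in measurable)
qed

lemma energy_density_integrable:
  assumes m: "admissible_coefficient m \<alpha> L" and g: "L2_on S g"
  shows "integrable (lebesgue_on S) (\<lambda>x. energy_density m (g x))"
proof (rule Bochner_Integration.integrable_bound)
  show "integrable (lebesgue_on S) (\<lambda>x. L / 2 * (norm (g x))\<^sup>2)"
    using g by (simp add: L2_on_def)
  show "(\<lambda>x. energy_density m (g x)) \<in> borel_measurable (lebesgue_on S)"
    using borel_measurable_continuous_onI[OF energy_density_continuous[OF m]] L2_on_measurable[OF g]
    by (rule measurable_compose[rotated])
  \<comment> \<open>Expansion about 0, where density and field both vanish, yields quadratic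
    growth.\<close>
  have "\<bar>energy_density m y\<bar> \<le> \<bar>L / 2 * (norm y)\<^sup>2\<bar>" for y :: 'b
    using energy_density_taylor[OF m, of 0 y] by simp
  then show "AE x in lebesgue_on S. norm (energy_density m (g x)) \<le> norm (L / 2 * (norm (g x))\<^sup>2)"
    by (intro AE_I2) simp
qed

lemma model_problem_domain:
  assumes "model_problem P \<alpha> L"
  shows "open (Omega P)" "bounded (Omega P)" "admissible_coefficient (mu P) \<alpha> L"
  using assms by (auto simp: model_problem_def lipschitz_domain_def)

lemma X_space_L2:
  assumes "u \<in> X_space P"
  shows "L2_on (Omega P) u" "L2_on (Omega P) (nabla P u)"
  using has_weak_grad_weak_grad[of u] assms by (auto simp: X_space_def has_weak_grad_def)

lemma fe_space_X_space: "u \<in> fe_space P p T \<Longrightarrow> u \<in> X_space P"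
  by (simp add: fe_space_def)

lemma tdist_nonneg: "0 \<le> tdist P u v"
  by (simp add: tdist_def tnorm_def L2_norm_nonneg)

context
  fixes P :: "('a::euclidean_space) problem" and \<alpha> L :: real
  assumes mp: "model_problem P \<alpha> L"
begin

lemmas dom = model_problem_domain[OF mp]

lemma X_space_diff: "u \<in> X_space P \<Longrightarrow> v \<in> X_space P \<Longrightarrow> (\<lambda>x. u x - v x) \<in> X_space P"
  using H10_lincomb[OF dom(1,2), of u v "-1"] by (simp add: X_space_def)

lemma nabla_diff:
  assumes "u \<in> X_space P" "v \<in> X_space P"
  shows "AE x in lebesgue_on (Omega P). nabla P (\<lambda>x. u x - v x) x = nabla P u x - nabla P v x"
  using weak_grad_lincomb[OF dom(1,2), of u v "-1"] assms by (simp add: X_space_def)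

lemma tnorm_diff:
  assumes "u \<in> X_space P" "v \<in> X_space P"
  shows "tnorm P (\<lambda>x. u x - v x) = L2_norm (Omega P) (\<lambda>x. nabla P u x - nabla P v x)"
  unfolding tnorm_def
  using assms by (intro L2_norm_cong_AE nabla_diff L2_on_diff X_space_L2 X_space_diff)

lemma tdist_triangle:
  assumes "u \<in> X_space P" "v \<in> X_space P" "w \<in> X_space P"
  shows "tdist P u w \<le> tdist P u v + tdist P v w"
proof -
  have "L2_norm (Omega P) (\<lambda>x. (nabla P u x - nabla P v x) + (nabla P v x - nabla P w x))
    \<le> L2_norm (Omega P) (\<lambda>x. nabla P u x - nabla P v x) + L2_norm (Omega P) (\<lambda>x. nabla P v x - nabla P w x)"
    using assms by (intro L2_norm_triangle L2_on_diff X_space_L2)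
  then show ?thesis using assms by (simp add: tdist_def tnorm_diff)
qed

lemma A_op_diff:
  assumes "u \<in> X_space P" "v \<in> X_space P" "w \<in> X_space P"
  shows "A_op P u (\<lambda>x. v x - w x)
    = (\<integral>x. A_field (mu P) (nabla P u x) \<bullet> (nabla P v x - nabla P w x) \<partial>lebesgue_on (Omega P))"
proof -
  have L2: "L2_on (Omega P) (\<lambda>x. A_field (mu P) (nabla P u x))"
    using assms by (intro L2_on_A_field[OF dom(3)] X_space_L2)
  have "A_op P u (\<lambda>x. v x - w x)
    = (\<integral>x. A_field (mu P) (nabla P u x) \<bullet> nabla P (\<lambda>x. v x - w x) x \<partial>lebesgue_on (Omega P))"
    by (simp add: A_op_def A_field_def)
  also have "\<dots> = (\<integral>x. A_field (mu P) (nabla P u x) \<bullet> (nabla P v x - nabla P w x) \<partial>lebesgue_on (Omega P))"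
    using nabla_diff[OF assms(2,3)]
    by (intro integral_cong_AE borel_measurable_integrable L2_on_inner_integrable L2 L2_on_diff
        X_space_L2 X_space_diff assms) auto
  finally show ?thesis .
qed

lemma F_rhs_diff:
  assumes "u \<in> X_space P" "v \<in> X_space P"
  shows "F_rhs P (\<lambda>x. u x - v x) = F_rhs P u - F_rhs P v"
proof -
  have data: "L2_on (Omega P) (src P)" "L2_on (Omega P) (flux P)"
    using mp by (auto simp: model_problem_def)
  note L2 = data assms[THEN X_space_L2(1)] assms[THEN X_space_L2(2)]
  have "(\<integral>x. flux P x \<bullet> nabla P (\<lambda>x. u x - v x) x \<partial>lebesgue_on (Omega P))
    = (\<integral>x. flux P x \<bullet> (nabla P u x - nabla P v x) \<partial>lebesgue_on (Omega P))"
    using nabla_diff[OF assms]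
    by (intro integral_cong_AE borel_measurable_integrable L2_on_inner_integrable L2 L2_on_diff
        X_space_L2 X_space_diff assms) auto
  moreover have "integrable (lebesgue_on (Omega P)) (\<lambda>x. src P x * u x)"
    "integrable (lebesgue_on (Omega P)) (\<lambda>x. src P x * v x)"
    using L2_on_inner_integrable[of "Omega P" "src P"] L2 by auto
  moreover have "integrable (lebesgue_on (Omega P)) (\<lambda>x. flux P x \<bullet> nabla P u x)"
    "integrable (lebesgue_on (Omega P)) (\<lambda>x. flux P x \<bullet> nabla P v x)"
    using L2_on_inner_integrable L2 by auto
  ultimately show ?thesis
    by (simp add: F_rhs_def right_diff_distrib inner_diff_right)
qed

lemma A_op_strongly_monotone:
  assumes u: "u \<in> X_space P" and v: "v \<in> X_space P"
  shows "\<alpha> * (tdist P v u)\<^sup>2 \<le> A_op P v (\<lambda>x. v x - u x) - A_op P u (\<lambda>x. v x - u x)"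
proof -
  let ?M = "lebesgue_on (Omega P)" and ?A = "\<lambda>u x. A_field (mu P) (nabla P u x)"
  note L2 = L2_on_A_field[OF dom(3) X_space_L2(2)[OF u]] L2_on_A_field[OF dom(3) X_space_L2(2)[OF v]]
    L2_on_diff[OF X_space_L2(2)[OF v] X_space_L2(2)[OF u]]
  have "\<alpha> * (tdist P v u)\<^sup>2 = (\<integral>x. \<alpha> * (norm (nabla P v x - nabla P u x))\<^sup>2 \<partial>?M)"
    by (simp add: tdist_def tnorm_diff[OF v u] L2_norm_sq)
  also have "\<dots> \<le> (\<integral>x. (?A v x - ?A u x) \<bullet> (nabla P v x - nabla P u x) \<partial>?M)"
    using L2 by (intro Bochner_Integration.integral_mono A_field_monotone[OF dom(3)] L2_on_inner_integrable L2_on_diff[of _ "?A v"])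
      (auto simp: L2_on_def)
  also have "\<dots> = A_op P v (\<lambda>x. v x - u x) - A_op P u (\<lambda>x. v x - u x)"
    unfolding A_op_diff[OF u v u] A_op_diff[OF v v u]
    using L2_on_inner_integrable[OF L2(1,3)] L2_on_inner_integrable[OF L2(2,3)]
    by (simp add: inner_diff_left)
  finally show ?thesis .
qed

text \<open>The pointwise expansion, integrated. The linear term is kept explicit: it is the
  residual of u in direction \<open>v - u\<close>, which vanishes when u is the discrete solution
  and v a discrete function.\<close>

lemma energy_taylor:
  assumes u: "u \<in> X_space P" and v: "v \<in> X_space P"
  shows "0 \<le> d2 P u v - (A_op P u (\<lambda>x. v x - u x) - F_rhs P (\<lambda>x. v x - u x))"
    and "d2 P u v - (A_op P u (\<lambda>x. v x - u x) - F_rhs P (\<lambda>x. v x - u x)) \<le> L / 2 * (tdist P v u)\<^sup>2"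
proof -
  let ?M = "lebesgue_on (Omega P)" and ?e = "\<lambda>u x. energy_density (mu P) (nabla P u x)"
  let ?T = "\<lambda>x. ?e v x - ?e u x - A_field (mu P) (nabla P u x) \<bullet> (nabla P v x - nabla P u x)"
  note L2 = L2_on_A_field[OF dom(3) X_space_L2(2)[OF u]]
    L2_on_diff[OF X_space_L2(2)[OF v] X_space_L2(2)[OF u]]
  note int = energy_density_integrable[OF dom(3) X_space_L2(2)[OF u]]
    energy_density_integrable[OF dom(3) X_space_L2(2)[OF v]] L2_on_inner_integrable[OF L2]
  have e: "energy P w = (\<integral>x. ?e w x \<partial>?M) - F_rhs P w" for w
    by (simp add: energy_def energy_density_def)
  have eq: "d2 P u v - (A_op P u (\<lambda>x. v x - u x) - F_rhs P (\<lambda>x. v x - u x)) = (\<integral>x. ?T x \<partial>?M)"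
    using int by (simp add: d2_def e A_op_diff[OF u v u] F_rhs_diff[OF v u])
  have T: "0 \<le> ?T x" "?T x \<le> L / 2 * (norm (nabla P v x - nabla P u x))\<^sup>2" for x
    using energy_density_taylor[OF dom(3), of "nabla P u x" "nabla P v x - nabla P u x"] by auto
  show "0 \<le> d2 P u v - (A_op P u (\<lambda>x. v x - u x) - F_rhs P (\<lambda>x. v x - u x))"
    unfolding eq by (intro Bochner_Integration.integral_nonneg T)
  have "(\<integral>x. ?T x \<partial>?M) \<le> (\<integral>x. L / 2 * (norm (nabla P v x - nabla P u x))\<^sup>2 \<partial>?M)"
    using int L2 by (intro Bochner_Integration.integral_mono T) (auto simp: L2_on_def)
  then show "d2 P u v - (A_op P u (\<lambda>x. v x - u x) - F_rhs P (\<lambda>x. v x - u x)) \<le> L / 2 * (tdist P v u)\<^sup>2"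
    unfolding eq by (simp add: tdist_def tnorm_diff[OF v u] L2_norm_sq)
qed

section \<open>Discrete solutions and the linearization error\<close>

lemma fe_space_diff:
  assumes "u \<in> fe_space P p T" "v \<in> fe_space P p T"
  shows "(\<lambda>x. u x - v x) \<in> fe_space P p T"
proof -
  have poly: "poly_deg_le p (\<lambda>x. q x - r x)" if "poly_deg_le p q" "poly_deg_le p r" for q r :: "'a \<Rightarrow> real"
  proof -
    from that obtain c d where "q = (\<lambda>x. \<Sum>k\<in>{k. (\<forall>b. b \<notin> Basis \<longrightarrow> k b = 0) \<and> (\<Sum>b\<in>Basis. k b) \<le> p}.
       c k * (\<Prod>b\<in>Basis. (x \<bullet> b) ^ k b))"
      "r = (\<lambda>x. \<Sum>k\<in>{k. (\<forall>b. b \<notin> Basis \<longrightarrow> k b = 0) \<and> (\<Sum>b\<in>Basis. k b) \<le> p}.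
       d k * (\<Prod>b\<in>Basis. (x \<bullet> b) ^ k b))"
      by (auto simp: poly_deg_le_def)
    then show ?thesis
      unfolding poly_deg_le_def
      by (intro exI[of _ "\<lambda>k. c k - d k"]) (simp add: left_diff_distrib sum_subtractf)
  qed
  have "\<exists>q. poly_deg_le p q \<and> ae_equal_on (elem t) (\<lambda>x. u x - v x) q" if "t \<in> T" for t
  proof -
    have "\<exists>q. poly_deg_le p q \<and> ae_equal_on (elem t) u q" "\<exists>q. poly_deg_le p q \<and> ae_equal_on (elem t) v q"
      using assms that by (simp_all add: fe_space_def)
    then obtain q r where q: "poly_deg_le p q" "ae_equal_on (elem t) u q"
      and r: "poly_deg_le p r" "ae_equal_on (elem t) v r"
      by auto
    have "ae_equal_on (elem t) (\<lambda>x. u x - v x) (\<lambda>x. q x - r x)"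
      using q(2) r(2) unfolding ae_equal_on_def by eventually_elim simp
    with poly[OF q(1) r(1)] show ?thesis by blast
  qed
  then show ?thesis
    using assms X_space_diff by (auto simp: fe_space_def)
qed

text \<open>The discrete equation, tested with \<open>u - s\<close>, removes the linear term of the
  expansion at s. What remains is minimality of s in the space and the quadratic bound on the energy
  error.\<close>

lemma discrete_solution_energy:
  assumes s: "discrete_solution P (fe_space P p T) s" and u: "u \<in> fe_space P p T"
  shows "0 \<le> d2 P s u" "d2 P s u \<le> L / 2 * (tdist P u s)\<^sup>2"
proof -
  have "s \<in> fe_space P p T" "A_op P s (\<lambda>x. u x - s x) = F_rhs P (\<lambda>x. u x - s x)"
    using s u fe_space_diff by (auto simp: discrete_solution_def)
  with energy_taylor[of s u] u show "0 \<le> d2 P s u" "d2 P s u \<le> L / 2 * (tdist P u s)\<^sup>2"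
    by (simp_all add: fe_space_X_space)
qed

lemma tdist_commute:
  assumes "u \<in> X_space P" "v \<in> X_space P"
  shows "tdist P u v = tdist P v u"
  unfolding tdist_def tnorm_diff[OF assms] tnorm_diff[OF assms(2,1)] L2_norm_def
  by (simp add: norm_minus_commute)

text \<open>All forms are tested with \<open>w = s - u\<close>. Monotonicity bounds the squared
  error by the residual of u, the linearization equation expresses this residual by
  \<open>\<Phi> - u\<close>, and continuity allows one factor \<open>tdist P s u\<close> to be
  cancelled.\<close>

lemma discrete_error_bound:
  assumes s: "discrete_solution P (fe_space P p T) s" and u: "u \<in> fe_space P p T"
    and a: "linearization_form P a C_ell C_cnt"
    and \<Phi>: "\<Phi> \<in> fe_space P p T" "\<And>v. v \<in> fe_space P p T \<Longrightarrow> a u \<Phi> v = a u u v + F_rhs P v - A_op P u v"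
  shows "\<alpha> * tdist P s u \<le> C_cnt * tdist P \<Phi> u"
proof -
  have s': "s \<in> fe_space P p T" "A_op P s (\<lambda>x. s x - u x) = F_rhs P (\<lambda>x. s x - u x)"
    using s u fe_space_diff by (auto simp: discrete_solution_def)
  define w where "w = (\<lambda>x. s x - u x)"
  have w: "w \<in> fe_space P p T" using s' u fe_space_diff by (auto simp: w_def)
  note X = fe_space_X_space[OF u] fe_space_X_space[OF w] fe_space_X_space[OF \<Phi>(1)] fe_space_X_space[OF s'(1)]
  have bil: "symmetric_bilinear_on (X_space P) (a u)"
    and cnt: "\<And>v w. v \<in> X_space P \<Longrightarrow> w \<in> X_space P \<Longrightarrow> \<bar>a u v w\<bar> \<le> C_cnt * tnorm P v * tnorm P w"
    using a X(1) by (auto simp: linearization_form_def)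
  have "a u (\<lambda>x. \<Phi> x + - 1 * u x) w = a u \<Phi> w - a u u w"
  proof -
    \<comment> \<open>Minus u is written as \<open>(u - u) - u\<close>: bilinearity is formulated
      with sums and multiples, closure of the space with differences.\<close>
    have neg: "(\<lambda>x. - 1 * u x) \<in> X_space P"
      using X_space_diff[OF X_space_diff[OF X(1) X(1)] X(1)] by simp
    moreover have add: "a u (\<lambda>x. v x + w x) z = a u v z + a u w z"
      if "v \<in> X_space P" "w \<in> X_space P" "z \<in> X_space P" for v w z
      using bil that unfolding symmetric_bilinear_on_def by blast
    moreover have "a u (\<lambda>x. - 1 * u x) w = - 1 * a u u w"
      using bil X unfolding symmetric_bilinear_on_def by blast
    ultimately show ?thesis using add[OF X(3) neg X(2)] by simp
  qed
  also have "\<dots> = A_op P s w - A_op P u w"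
    using \<Phi>(2)[OF w] s'(2) by (simp add: w_def)
  finally have "\<alpha> * (tdist P s u)\<^sup>2 \<le> a u (\<lambda>x. \<Phi> x - u x) w"
    using A_op_strongly_monotone[OF X(1,4)] by (simp add: w_def)
  also have "\<dots> \<le> C_cnt * tdist P \<Phi> u * tdist P s u"
    using cnt[of "\<lambda>x. \<Phi> x - u x" w] X X_space_diff by (auto simp: tdist_def w_def abs_le_iff)
  finally have *: "(\<alpha> * tdist P s u) * tdist P s u \<le> (C_cnt * tdist P \<Phi> u) * tdist P s u"
    by (simp add: power2_eq_square mult.assoc)
  show ?thesis
  proof (cases "tdist P s u = 0")
    case True
    then show ?thesis using a tdist_nonneg[of P \<Phi> u] by (simp add: linearization_form_def)
  next
    case False
    with tdist_nonneg[of P s u] have "0 < tdist P s u" by simp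
    with * show ?thesis by (simp only: mult_le_cancel_right_pos)
  qed
qed

end

section \<open>Iterates of the algorithm\<close>

text \<open>The three facts are carried through one rule induction. The second implies that a solver
  index at which the loop stops has no successor, which identifies it as the last one.\<close>

lemma index_set_lower:
  assumes "(l, k, j) \<in> index_set P c R"
  shows "(l, k, 0) \<in> index_set P c R \<and>
    (\<forall>i. 1 \<le> i \<and> i < j \<longrightarrow> \<not> tau_stop P c R l k i \<and> \<not> j_stop P R l k i) \<and> (k = 0 \<longrightarrow> j = 0)"
  using assms
proof (induction l k j rule: index_set.induct)
  case (first_linearization l)
  then show ?case using index_set.first_linearization[of l P c R] by auto
next
  case (next_solver_step l k j)
  then show ?case using less_Suc_eq by auto
next
  case start
  show ?case using index_set.start[of P c R] by simp
next
  case (first_solver_step l k)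
  then show ?case by simp
next
  case (next_linearization l k j)
  then show ?case using index_set.next_linearization[of l k j P c R] by simp
next
  case (next_level l k j)
  then show ?case using index_set.next_level[of l k j P c R] by simp
qed

lemma j_last_eqI:
  assumes "(l, k, j) \<in> index_set P c R" "\<And>i. (l, k, i) \<in> index_set P c R \<Longrightarrow> i \<le> j"
  shows "j_last P c R l k = enat j"
  unfolding j_last_def
proof (rule antisym)
  show "(SUP j\<in>{j. (l, k, j) \<in> index_set P c R}. enat j) \<le> enat j"
    by (rule SUP_least) (use assms(2) in simp)
  show "enat j \<le> (SUP j\<in>{j. (l, k, j) \<in> index_set P c R}. enat j)"
    by (rule SUP_upper) (use assms(1) in simp)
qed

lemma last_iter_eqI:
  assumes "(l, k, j) \<in> index_set P c R" "\<And>i. (l, k, i) \<in> index_set P c R \<Longrightarrow> i \<le> j"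
  shows "last_iter P c R l k = iter R l k j"
proof -
  have "j_last P c R l k = enat j" using assms by (rule j_last_eqI)
  then show ?thesis unfolding last_iter_def by (simp only: the_enat.simps)
qed

lemma last_iter_0:
  assumes "(l, 0, 0) \<in> index_set P c R"
  shows "last_iter P c R l 0 = iter R l 0 0"
proof (rule last_iter_eqI[OF assms])
  show "i \<le> 0" if "(l, 0, i) \<in> index_set P c R" for i
    using index_set_lower[OF that] by simp
qed

lemma last_iter_stop:
  assumes "(l, k, j) \<in> index_set P c R" "1 \<le> j" "j_stop P R l k j"
  shows "last_iter P c R l k = iter R l k j"
proof (rule last_iter_eqI[OF assms(1)])
  show "i \<le> j" if "(l, k, i) \<in> index_set P c R" for i
    using index_set_lower[OF that] assms(2,3) not_less by blast
qed

section \<open>Bisected elements and nested finite element spaces\<close>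

lemma list_first_last:
  assumes "2 \<le> length xs"
  obtains x zs y where "xs = x # zs @ [y]"
proof -
  obtain x us where "xs = x # us" "us \<noteq> []"
    using assms by (cases xs) (auto simp: Suc_le_eq)
  then show ?thesis by (metis append_butlast_last_id that)
qed

text \<open>The midpoint of the refinement edge is the only new vertex, and it lies in the convex
  parent.\<close>

lemma bisect_elem:
  fixes t :: "('a::euclidean_space) tsimplex"
  assumes len: "2 \<le> length (fst t)" and s: "s \<in> bisect t"
  shows "length (fst s) = length (fst t)" "elem s \<subseteq> elem t"
proof -
  define xs where "xs = fst t"
  obtain x ys y where xs: "xs = x # ys @ [y]"
    using list_first_last len unfolding xs_def by metis
  define m where "m = midpoint x y"
  have "set (fst s) \<subseteq> {x, y, m} \<union> set ys \<and> length (fst s) = length xs"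
    using s unfolding bisect_def Let_def xs_def[symmetric]
    by (auto simp: xs m_def dest: in_set_takeD in_set_dropD)
  moreover have "m \<in> elem t"
  proof -
    have "m \<in> closed_segment x y" by (simp add: m_def)
    moreover have "closed_segment x y \<subseteq> elem t"
      unfolding elem_def verts_def xs_def[symmetric] segment_convex_hull by (rule hull_mono) (simp add: xs)
    ultimately show ?thesis by blast
  qed
  moreover have "verts t \<subseteq> elem t" by (simp add: elem_def hull_subset)
  ultimately have "length (fst s) = length (fst t)" and sub: "verts s \<subseteq> elem t"
    by (auto simp: verts_def xs_def[symmetric] xs)
  then show "length (fst s) = length (fst t)" by simp
  show "elem s \<subseteq> elem t"
    unfolding elem_def[of s] by (rule hull_minimal[OF sub]) (simp add: elem_def)
qed

text \<open>Intermediate meshes of a refinement need not be conforming, so only the length of the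
  vertex lists is carried along; it guarantees that each refinement edge has two list
  entries.\<close>

lemma nvb_refinement_parent:
  assumes "nvb_refinement T T'" "\<And>t. t \<in> T \<Longrightarrow> 2 \<le> length (fst t)"
  shows "\<forall>t'\<in>T'. 2 \<le> length (fst t') \<and> (\<exists>t\<in>T. elem t' \<subseteq> elem t)"
  using assms(1) unfolding nvb_refinement_def
proof (induction rule: rtranclp_induct)
  case base
  then show ?case using assms(2) by auto
next
  case (step T' T'')
  from step.hyps(2) obtain t where t: "t \<in> T'" "T'' = (T' - {t}) \<union> bisect t"
    unfolding bisect_step_def by blast
  show ?case
  proof
    fix t' assume "t' \<in> T''"
    then consider "t' \<in> T'" | "t' \<in> bisect t" using t(2) by blast
    then show "2 \<le> length (fst t') \<and> (\<exists>t\<in>T. elem t' \<subseteq> elem t)"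
    proof cases
      case 1
      with step.IH show ?thesis by (rule bspec)
    next
      case 2
      obtain s where s: "s \<in> T" "elem t \<subseteq> elem s" "2 \<le> length (fst t)"
        using step.IH t(1) by blast
      from bisect_elem[OF s(3) 2] s show ?thesis by (metis subset_trans)
    qed
  qed
qed

lemma conforming_mesh_length:
  fixes T :: "('a::euclidean_space) mesh"
  assumes "conforming_mesh U T" "t \<in> T"
  shows "2 \<le> length (fst t)"
proof -
  have "tagged_simplex t" using assms by (simp add: conforming_mesh_def)
  then have "length (fst t) = Suc DIM('a)" by (simp add: tagged_simplex_def)
  then show ?thesis using DIM_positive[where 'a='a] by linarith
qed

text \<open>A polynomial on the parent restricts to each descendant. This is what makes the last
  iterate of a level an admissible start on the next mesh.\<close>

lemma fe_space_mono:
  fixes T :: "('a::euclidean_space) mesh"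
  assumes "nvb_refinement T T'" "conforming_mesh U T"
  shows "fe_space P p T \<subseteq> fe_space P p T'"
proof
  fix v assume v: "v \<in> fe_space P p T"
  have "\<exists>q. poly_deg_le p q \<and> ae_equal_on (elem t') v q" if t': "t' \<in> T'" for t'
  proof -
    obtain t where t: "t \<in> T" "elem t' \<subseteq> elem t"
      using nvb_refinement_parent[OF assms(1) conforming_mesh_length[OF assms(2)]] t' by blast
    obtain q where q: "poly_deg_le p q" "ae_equal_on (elem t) v q"
      using v t(1) by (auto simp: fe_space_def)
    have m: "elem s \<in> sets lebesgue" for s :: "'a tsimplex"
      by (simp add: elem_def verts_def finite_imp_compact_convex_hull lmeasurable_compact fmeasurableD)
    have "ae_equal_on (elem t') v q"
      using q(2) t(2) m by (auto simp: ae_equal_on_def AE_restrict_space_iff elim: eventually_mono)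
    with q(1) show ?thesis by blast
  qed
  with v show "v \<in> fe_space P p T'" by (auto simp: fe_space_def)
qed

lemma is_refine_meshes:
  assumes "T \<in> meshes U T\<^sub>0" "is_refine U T M T'"
  shows "T' \<in> meshes U T\<^sub>0" "nvb_refinement T T'" "conforming_mesh U T"
proof -
  have T: "nvb_refinement T\<^sub>0 T" "nvb_refinement T T'" "conforming_mesh U T'" "conforming_mesh U T"
    using assms unfolding meshes_def is_refine_def conforming_refinement_def by simp_all
  from T(1,2) have "nvb_refinement T\<^sub>0 T'"
    unfolding nvb_refinement_def by (rule rtranclp_trans)
  with T show "T' \<in> meshes U T\<^sub>0" "nvb_refinement T T'" "conforming_mesh U T"
    by (simp_all add: meshes_def)
qed

section \<open>Iterates of a run as powers of the solver map\<close>

context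
  fixes P :: "('a::euclidean_space) problem" and c \<Phi> \<Psi> T\<^sub>0 u\<^sub>0 R p q_alg
  assumes mesh: "conforming_mesh (Omega P) T\<^sub>0"
    and solver: "algebraic_solver P p T\<^sub>0 \<Phi> \<Psi> q_alg"
    and initial: "u\<^sub>0 \<in> fe_space P p T\<^sub>0"
    and run: "ailfem_run P c \<Phi> \<Psi> T\<^sub>0 u\<^sub>0 R"
begin

lemma run_step:
  assumes "(l, k, j) \<in> index_set P c R" "1 \<le> k" "1 \<le> j" "\<not> tau_stop P c R l k j" "j_stop P R l k j"
  shows "if k_stop P c R l k j then
           is_refine (Omega P) (level_mesh R l) (marked R l) (level_mesh R (Suc l)) \<and>
           iter R (Suc l) 0 0 = iter R l k j
         else iter R l (Suc k) 0 = iter R l k j"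
proof -
  have "\<forall>l k j. (l, k, j) \<in> index_set P c R \<and> 1 \<le> k \<and> 1 \<le> j \<and>
        \<not> tau_stop P c R l k j \<and> j_stop P R l k j \<longrightarrow>
        (if k_stop P c R l k j then
           marking P c (level_mesh R l) (iter R l k j) (marked R l) \<and>
           is_refine (Omega P) (level_mesh R l) (marked R l) (level_mesh R (Suc l)) \<and>
           iter R (Suc l) 0 0 = iter R l k j \<and>
           alpha_min R (Suc l) 1 = alpha_min_update c R l k j \<and>
           J_max R (Suc l) 1 = J_max_update R l k j
         else
           iter R l (Suc k) 0 = iter R l k j \<and>
           alpha_min R l (Suc k) = alpha_min_update c R l k j \<and>
           J_max R l (Suc k) = J_max_update R l k j)"
    using run unfolding ailfem_run_def by (elim conjE)
  then show ?thesis using assms by (simp split: if_splits)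
qed

lemma run_iter_Suc:
  assumes "(l, k, Suc j) \<in> index_set P c R"
  shows "iter R l k (Suc j) = \<Psi> (level_mesh R l) (\<Phi> (level_mesh R l) (iter R l k 0)) (iter R l k j)"
proof -
  have "\<forall>l k j. (l, k, Suc j) \<in> index_set P c R \<longrightarrow>
      iter R l k (Suc j) = \<Psi> (level_mesh R l) (\<Phi> (level_mesh R l) (iter R l k 0)) (iter R l k j)"
    using run unfolding ailfem_run_def by (elim conjE)
  then show ?thesis using assms by simp
qed

lemma solver_closed:
  assumes "T \<in> meshes (Omega P) T\<^sub>0" "u \<in> fe_space P p T" "w \<in> fe_space P p T"
  shows "\<Psi> T (\<Phi> T u) w \<in> fe_space P p T"
proof -
  have "\<forall>T\<in>meshes (Omega P) T\<^sub>0. \<forall>u\<in>fe_space P p T. \<forall>w\<in>fe_space P p T. \<Psi> T (\<Phi> T u) w \<in> fe_space P p T"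
    using solver unfolding algebraic_solver_def by (elim conjE) (intro ballI, drule bspec, assumption, drule bspec, assumption, elim conjE, drule bspec, assumption)
  then show ?thesis using assms by blast
qed

text \<open>Mesh, space and iterates depend on each other along the loops, so the invariants are
  proved jointly. The power form with base \<open>iter R l k 0\<close> is the one in which the
  solver contraction is assumed.\<close>

lemma run_iterates:
  assumes "(l, k, j) \<in> index_set P c R"
  shows "level_mesh R l \<in> meshes (Omega P) T\<^sub>0 \<and> iter R l k 0 \<in> fe_space P p (level_mesh R l) \<and>
    iter R l k j \<in> fe_space P p (level_mesh R l) \<and>
    iter R l k j = (\<Psi> (level_mesh R l) (\<Phi> (level_mesh R l) (iter R l k 0)) ^^ j) (iter R l k 0)"
  using assms
proof (induction l k j rule: index_set.induct)
  case start
  have "level_mesh R 0 = T\<^sub>0" "iter R 0 0 0 = u\<^sub>0" using run by (auto simp: ailfem_run_def)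
  then show ?case using mesh initial by (auto simp: meshes_def nvb_refinement_def)
next
  case (first_linearization l)
  have "iter R l 1 0 = iter R l 0 0"
    using run first_linearization.hyps unfolding ailfem_run_def by blast
  then show ?case using first_linearization.IH by simp
next
  case (first_solver_step l k)
  then have "iter R l k (Suc 0) = \<Psi> (level_mesh R l) (\<Phi> (level_mesh R l) (iter R l k 0)) (iter R l k 0)"
    using index_set.first_solver_step by (intro run_iter_Suc) fastforce
  then show ?case using first_solver_step.IH solver by (simp add: algebraic_solver_def)
next
  case (next_solver_step l k j)
  then have "iter R l k (Suc j) = \<Psi> (level_mesh R l) (\<Phi> (level_mesh R l) (iter R l k 0)) (iter R l k j)"
    using index_set.next_solver_step by (intro run_iter_Suc) fastforce
  moreover have "iter R l k (Suc j) \<in> fe_space P p (level_mesh R l)"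
    unfolding calculation by (rule solver_closed) (use next_solver_step.IH in auto)
  ultimately show ?case using next_solver_step.IH by simp
next
  case (next_linearization l k j)
  then have "iter R l (Suc k) 0 = iter R l k j" using run_step[of l k j] by simp
  then have "iter R l (Suc k) 0 \<in> fe_space P p (level_mesh R l)" using next_linearization.IH by metis
  then show ?case using next_linearization.IH by simp
next
  case (next_level l k j)
  then have r: "is_refine (Omega P) (level_mesh R l) (marked R l) (level_mesh R (Suc l))"
    "iter R (Suc l) 0 0 = iter R l k j"
    using run_step[of l k j] by simp_all
  have "level_mesh R l \<in> meshes (Omega P) T\<^sub>0" using next_level.IH by simp
  note is_refine_meshes[OF this r(1)]
  then have "level_mesh R (Suc l) \<in> meshes (Omega P) T\<^sub>0"
    "iter R l k j \<in> fe_space P p (level_mesh R (Suc l))"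
    using next_level.IH fe_space_mono by blast+
  then show ?case using r(2) by simp
qed

text \<open>Only two rules create such an index with \<open>k >= 1\<close>. One copies the initial
  iterate of the level, the other the iterate of a stopped solver loop, whose stopping index is the
  last.\<close>

lemma iter_start_last:
  assumes "(l, k, 0) \<in> index_set P c R" "1 \<le> k"
  shows "iter R l k 0 = last_iter P c R l (k - 1)"
  using assms(1)
proof (cases rule: index_set.cases)
  case (first_linearization)
  have "iter R l 1 0 = iter R l 0 0"
    using run first_linearization unfolding ailfem_run_def by blast
  then show ?thesis using first_linearization by (simp add: last_iter_0)
next
  case (next_linearization k' j)
  then show ?thesis using run_step[of l k' j] last_iter_stop[of l k' j P c R] by simp
next
  case start
  then show ?thesis using assms(2) by linarith
next
  case (next_level l' k' j)
  then show ?thesis using assms(2) by linarith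
qed simp_all

lemma completed_iterates:
  assumes "(l, k) \<in> completed P c R"
  defines "T \<equiv> level_mesh R l" and "u \<equiv> last_iter P c R l (k - 1)" and "w \<equiv> last_iter P c R l k"
  shows "T \<in> meshes (Omega P) T\<^sub>0" "u \<in> fe_space P p T" "w \<in> fe_space P p T"
    "(l, k, 0) \<in> index_set P c R" "\<exists>j\<ge>1. w = (\<Psi> T (\<Phi> T u) ^^ j) u"
proof -
  define j where "j = the_enat (j_last P c R l k)"
  have k: "1 \<le> k" and fin: "j_last P c R l k \<noteq> \<infinity>" and ind: "(l, k, j) \<in> index_set P c R"
    using assms(1) by (auto simp: completed_def j_def)
  show start: "(l, k, 0) \<in> index_set P c R" using index_set_lower[OF ind] by simp
  have u: "u = iter R l k 0" using iter_start_last[OF start k] by (simp add: u_def)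
  have w: "w = iter R l k j" by (simp add: w_def last_iter_def j_def)
  \<comment> \<open>The first solver step is unconditional, so the last index is at least 1; without
    a solver step there would be no contraction.\<close>
  have "(l, k, 1) \<in> index_set P c R" using start k by (rule index_set.first_solver_step)
  then have "enat 1 \<le> j_last P c R l k" unfolding j_last_def by (intro SUP_upper) simp
  then have "1 \<le> j" using fin by (cases "j_last P c R l k") (auto simp: j_def)
  then show "\<exists>j\<ge>1. w = (\<Psi> T (\<Phi> T u) ^^ j) u"
    using run_iterates[OF ind] by (auto simp: w u T_def)
  show "T \<in> meshes (Omega P) T\<^sub>0" "u \<in> fe_space P p T" "w \<in> fe_space P p T"
    using run_iterates[OF ind] by (auto simp: w u T_def)
qed

end

section \<open>Barycentric coordinates\<close>

text \<open>The gradient of the barycentric coordinate of \<open>v\<close>: along each edge the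
  coordinate drops from 1 at \<open>v\<close> to 0 at the other end, hence the value -1.\<close>

definition bgrad :: "'a::euclidean_space set \<Rightarrow> 'a \<Rightarrow> 'a" where
  "bgrad S v = (SOME c. \<forall>w\<in>S - {v}. c \<bullet> (w - v) = - 1)"

definition bary :: "'a::euclidean_space set \<Rightarrow> 'a \<Rightarrow> 'a \<Rightarrow> real" where
  "bary S v x = 1 + bgrad S v \<bullet> (x - v)"

lemma bary_self [simp]: "bary S v v = 1"
  by (simp add: bary_def)

lemma bary_convex_comb: "bary S v (z + r *\<^sub>R (x - z)) = (1 - r) * bary S v z + r * bary S v x"
  by (simp add: bary_def inner_simps algebra_simps)

lemma bary_midpoint: "bary S v (midpoint x y) = (bary S v x + bary S v y) / 2"
  by (simp add: bary_def midpoint_def inner_simps field_simps)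

lemma bary_affine_sum:
  assumes "finite W" "sum u W = 1"
  shows "bary S v (\<Sum>w\<in>W. u w *\<^sub>R w) = (\<Sum>w\<in>W. u w * bary S v w)"
proof -
  have "(\<Sum>w\<in>W. u w * bary S v w) = (\<Sum>w\<in>W. u w) * (1 - bgrad S v \<bullet> v) + bgrad S v \<bullet> (\<Sum>w\<in>W. u w *\<^sub>R w)"
    by (simp add: bary_def inner_diff_right inner_sum_right sum_distrib_left sum_distrib_right
        sum.distrib[symmetric] algebra_simps)
  then show ?thesis using assms by (simp add: bary_def inner_diff_right)
qed

lemma bary_lipschitz: "\<bar>bary V z x - bary V z y\<bar> \<le> norm (bgrad V z) * dist x y"
proof -
  have "bary V z x - bary V z y = bgrad V z \<bullet> (x - y)" by (simp add: bary_def inner_diff_right)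
  then show ?thesis using Cauchy_Schwarz_ineq2[of "bgrad V z" "x - y"] by (simp add: dist_norm)
qed

locale full_simplex =
  fixes S :: "'a::euclidean_space set"
  assumes indep: "\<not> affine_dependent S" and card: "card S = Suc DIM('a)"
begin

lemma finite: "finite S"
  using card by (metis card.infinite nat.distinct(1))

text \<open>The edge vectors at \<open>v\<close> are independent, so some linear functional takes
  the value -1 on all of them; hence the choice in \<open>bgrad\<close> is not vacuous.\<close>

lemma bary_other:
  assumes "v \<in> S" "w \<in> S" "v \<noteq> w"
  shows "bary S v w = 0"
proof -
  let ?B = "(\<lambda>x. - v + x) ` (S - {v})"
  have "independent ?B"
    using indep affine_dependent_iff_dependent2[OF assms(1)] by simp
  then obtain g :: "'a \<Rightarrow> real" where g: "linear g" "\<forall>x\<in>?B. g x = - 1"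
    using linear_independent_extend[of ?B "\<lambda>_. - 1"] by auto
  \<comment> \<open>The adjoint at 1 is the vector that represents \<open>g\<close> by the inner
    product.\<close>
  have "\<forall>w\<in>S - {v}. adjoint g 1 \<bullet> (w - v) = - 1"
    using g(2) adjoint_works[OF g(1), of _ 1] by (auto simp: inner_commute)
  then have "\<forall>w\<in>S - {v}. bgrad S v \<bullet> (w - v) = - 1"
    unfolding bgrad_def by (rule someI)
  with assms show ?thesis by (simp add: bary_def)
qed

lemma bary_sum:
  assumes "finite W" "sum u W = 1" "W \<subseteq> S" "v \<in> S"
  shows "bary S v (\<Sum>w\<in>W. u w *\<^sub>R w) = (if v \<in> W then u v else 0)"
proof -
  have "(\<Sum>w\<in>W. u w * bary S v w) = (\<Sum>w\<in>W. if w = v then u v else 0)"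
    using assms(3,4) bary_other by (intro sum.cong) auto
  also have "\<dots> = (if v \<in> W then u v else 0)"
    using assms(1) by simp
  finally show ?thesis by (simp add: bary_affine_sum assms)
qed

lemma bary_representation: "sum (\<lambda>v. bary S v x) S = 1" "(\<Sum>v\<in>S. bary S v x *\<^sub>R v) = x"
proof -
  have "x \<in> affine hull S"
    using affine_independent_span_eq[OF indep] card by simp
  then obtain u where u: "sum u S = 1" "(\<Sum>v\<in>S. u v *\<^sub>R v) = x"
    by (auto simp: affine_hull_finite[OF finite])
  have "bary S v x = u v" if "v \<in> S" for v
    using bary_sum[OF finite u(1) _ that] u(2) that by simp
  with u show "sum (\<lambda>v. bary S v x) S = 1" "(\<Sum>v\<in>S. bary S v x *\<^sub>R v) = x"
    by simp_all
qed

text \<open>Describes the faces of the simplex. In a conforming mesh two elements meet in such a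
  face, so this decides which coordinates vanish on an intersection.\<close>

lemma bary_subset_hull:
  assumes "W \<subseteq> S" "x \<in> convex hull W" "v \<in> S"
  shows "0 \<le> bary S v x" "v \<notin> W \<Longrightarrow> bary S v x = 0"
proof -
  have W: "finite W" using assms(1) finite finite_subset by blast
  obtain u where "\<forall>w\<in>W. 0 \<le> u w" "sum u W = 1" "(\<Sum>w\<in>W. u w *\<^sub>R w) = x"
    using assms(2) by (auto simp: convex_hull_finite[OF W])
  with bary_sum[OF W _ assms(1,3), of u]
  show "0 \<le> bary S v x" "v \<notin> W \<Longrightarrow> bary S v x = 0" by auto
qed

lemma hull_iff: "x \<in> convex hull S \<longleftrightarrow> (\<forall>v\<in>S. 0 \<le> bary S v x)"
proof
  show "\<forall>v\<in>S. 0 \<le> bary S v x" if "x \<in> convex hull S"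
    using that bary_subset_hull(1) by blast
  show "x \<in> convex hull S" if "\<forall>v\<in>S. 0 \<le> bary S v x"
    unfolding convex_hull_finite[OF finite] mem_Collect_eq
    using that bary_representation[of x] by (intro exI[of _ "\<lambda>v. bary S v x"]) simp
qed

lemma interior_hullI:
  assumes "\<And>v. v \<in> S \<Longrightarrow> 0 < bary S v x"
  shows "x \<in> interior (convex hull S)"
proof (rule interiorI)
  show "open (\<Inter>v\<in>S. {x. 0 < bary S v x})"
    unfolding bary_def using finite
    by (intro open_INT ballI open_Collect_less) (auto intro!: continuous_intros)
  show "(\<Inter>v\<in>S. {x. 0 < bary S v x}) \<subseteq> convex hull S"
    by (auto simp: hull_iff less_imp_le)
qed (use assms in auto)

lemma bgrad_nonzero:
  assumes "v \<in> S"
  shows "bgrad S v \<noteq> 0"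
proof -
  have "S \<noteq> {v}" using card by auto
  then obtain w where "w \<in> S" "w \<noteq> v" using assms by auto
  with bary_other[OF assms, of w] show ?thesis by (auto simp: bary_def)
qed

lemma interior_hullD:
  assumes "x \<in> interior (convex hull S)" "v \<in> S"
  shows "0 < bary S v x"
proof -
  obtain e where e: "0 < e" "ball x e \<subseteq> convex hull S"
    using assms(1) by (auto simp: mem_interior)
  define c where "c = bgrad S v"
  have c: "0 < norm c" using bgrad_nonzero[OF assms(2)] by (simp add: c_def)
  \<comment> \<open>A step against the gradient, short enough to remain in the ball, lowers the
    coordinate strictly, while it must stay nonnegative.\<close>
  define y where "y = x - (e / (2 * norm c)) *\<^sub>R c"
  have "y \<in> ball x e" using e(1) c by (simp add: y_def dist_norm)
  then have "0 \<le> bary S v y" using e(2) assms(2) hull_iff by auto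
  moreover have "bary S v y = bary S v x - e / (2 * norm c) * (norm c)\<^sup>2"
    by (simp add: bary_def y_def c_def inner_simps power2_norm_eq_inner)
  moreover have "0 < e / (2 * norm c) * (norm c)\<^sup>2" using e(1) c by simp
  ultimately show ?thesis by linarith
qed

end

lemma tagged_simplex_full: "tagged_simplex t \<Longrightarrow> full_simplex (verts t)"
  unfolding tagged_simplex_def full_simplex_def verts_def by (auto simp: distinct_card)

section \<open>Vertices produced by bisection\<close>

definition child :: "('a::euclidean_space) tsimplex \<Rightarrow> 'a tsimplex \<Rightarrow> bool" where
  "child t s \<longleftrightarrow> s \<in> bisect t"

text \<open>The type is forgotten: it influences only the order of the tail of the second child, and
  the arguments below use the first child and the head of the second.\<close>

definition reach :: "('a::euclidean_space) tsimplex \<Rightarrow> 'a list \<Rightarrow> bool" where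
  "reach t xs \<longleftrightarrow> (\<exists>\<gamma>. child\<^sup>*\<^sup>* t (xs, \<gamma>))"

lemma reach_first:
  assumes "reach t (x # zs @ [y])"
  shows "reach t (x # midpoint x y # zs)"
proof -
  obtain \<gamma> where \<gamma>: "child\<^sup>*\<^sup>* t (x # zs @ [y], \<gamma>)" using assms by (auto simp: reach_def)
  have "\<exists>\<gamma>'. child (x # zs @ [y], \<gamma>) (x # midpoint x y # zs, \<gamma>')"
    by (auto simp: child_def bisect_def Let_def)
  with \<gamma> show ?thesis unfolding reach_def by (meson rtranclp.rtrancl_into_rtrancl)
qed

lemma reach_second:
  assumes "reach t (x # zs @ [y])"
  shows "\<exists>ws. reach t (y # ws)"
proof -
  obtain \<gamma> where \<gamma>: "child\<^sup>*\<^sup>* t (x # zs @ [y], \<gamma>)" using assms by (auto simp: reach_def)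
  have "\<exists>ws \<gamma>'. child (x # zs @ [y], \<gamma>) (y # ws, \<gamma>')"
    by (auto simp: child_def bisect_def Let_def)
  with \<gamma> show ?thesis unfolding reach_def by (meson rtranclp.rtrancl_into_rtrancl)
qed

text \<open>Taking first children keeps the head \<open>x\<close>, removes the last vertex and
  inserts its midpoint with \<open>x\<close> directly behind \<open>x\<close>. Iteration processes
  the whole suffix \<open>bs\<close>.\<close>

lemma reach_map:
  assumes "reach t (x # as @ bs)"
  shows "reach t (x # map (midpoint x) bs @ as)"
  using assms
proof (induction bs arbitrary: as rule: rev_induct)
  case (snoc b bs)
  from snoc.prems have "reach t (x # (as @ bs) @ [b])" by simp
  from reach_first[OF this] have "reach t (x # (midpoint x b # as) @ bs)" by simp
  from snoc.IH[OF this] show ?case by simp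
qed simp

text \<open>Once the vertices behind \<open>z\<close> are processed, \<open>z\<close> is last and
  its midpoint with \<open>x\<close> moves to second position. Processing all others brings this
  midpoint to the end of the list, and the second child then starts with it.\<close>

lemma reach_midpoint:
  assumes "reach t (x # ys)" "z \<in> set ys"
  shows "\<exists>ws. reach t (midpoint x z # ws)"
proof -
  obtain as bs where ys: "ys = as @ z # bs" using assms(2) by (auto simp: in_set_conv_decomp)
  have "reach t (x # (as @ [z]) @ bs)" using assms(1) ys by simp
  from reach_map[OF this] have "reach t (x # (map (midpoint x) bs @ as) @ [z])" by simp
  from reach_first[OF this] have "reach t (x # [midpoint x z] @ (map (midpoint x) bs @ as))" by simp
  from reach_map[OF this]
  have "reach t (x # map (midpoint x) (map (midpoint x) bs @ as) @ [midpoint x z])" .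
  then show ?thesis by (rule reach_second)
qed

lemma child_cases:
  assumes "child t s" "2 \<le> length (fst t)"
  obtains x zs y where "fst t = x # zs @ [y]"
    "set (fst s) = insert x (insert (midpoint x y) (set zs)) \<or> set (fst s) = insert y (insert (midpoint x y) (set zs))"
proof -
  obtain x zs y where t: "fst t = x # zs @ [y]"
    using list_first_last[OF assms(2)] by metis
  have "set (take n zs) \<union> set (drop n zs) = set zs" for n
    by (metis append_take_drop_id set_append)
  with assms(1) t show ?thesis
    by (intro that[OF t]) (auto simp: child_def bisect_def Let_def)
qed

text \<open>The last invariant says that no descendant falls into a facet of \<open>t\<close>: a
  bisection drops just one end of the refinement edge, and the midpoint inherits every positive
  coordinate of that end.\<close>

lemma reach_invariants:
  assumes t: "tagged_simplex t" and r: "child\<^sup>*\<^sup>* t s"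
  shows "length (fst s) = length (fst t) \<and> verts s \<subseteq> elem t \<and>
    (\<forall>v\<in>verts t. \<exists>y\<in>verts s. 0 < bary (verts t) v y)"
  using r
proof (induction rule: rtranclp_induct)
  case base
  have "\<exists>y\<in>verts t. 0 < bary (verts t) v y" if "v \<in> verts t" for v
    using that by (intro bexI[of _ v]) auto
  then show ?case by (auto simp: elem_def hull_inc)
next
  case (step s s')
  interpret full_simplex "verts t" using t by (rule tagged_simplex_full)
  have len: "2 \<le> length (fst s)"
    using step.IH t DIM_positive[where 'a='a] by (auto simp: tagged_simplex_def Suc_le_eq)
  have nn: "0 \<le> bary (verts t) v y" if "v \<in> verts t" "y \<in> elem t" for v y
    using that by (simp add: elem_def hull_iff)
  have "length (fst s') = length (fst s)" and "elem s' \<subseteq> elem s"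
    using bisect_elem[OF len] step.hyps(2) by (auto simp: child_def)
  moreover have "elem s \<subseteq> elem t"
    unfolding elem_def[of s] by (rule hull_minimal) (use step.IH in \<open>auto simp: elem_def\<close>)
  moreover have "verts s' \<subseteq> elem s'" by (simp add: elem_def hull_subset)
  moreover have "\<exists>y\<in>verts s'. 0 < bary (verts t) v y" if v: "v \<in> verts t" for v
  proof -
    obtain y where y: "y \<in> verts s" "0 < bary (verts t) v y" using step.IH v by blast
    from step.hyps(2) len show ?thesis
    proof (cases rule: child_cases)
      case (1 a zs b)
      have ab: "a \<in> verts s" "b \<in> verts s" using 1(1) by (auto simp: verts_def)
      then have nnab: "0 \<le> bary (verts t) v a" "0 \<le> bary (verts t) v b"
        using nn[OF v] step.IH by auto
      show ?thesis
      proof (cases "y \<in> verts s'")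
        case False
        then have "y = a \<or> y = b" using 1 y(1) by (auto simp: verts_def)
        then have "0 < bary (verts t) v (midpoint a b)"
          using nnab y(2) by (auto simp: bary_midpoint)
        moreover have "midpoint a b \<in> verts s'" using 1(2) by (auto simp: verts_def)
        ultimately show ?thesis by blast
      qed (use y in blast)
    qed
  qed
  ultimately show ?case using step.IH by auto
qed

text \<open>A reachable head vertex with the largest number of positive barycentric coordinates has only
  positive ones: otherwise its midpoint with a suitable vertex of the same simplex has more.\<close>

lemma interior_descendant_vertex:
  fixes t :: "('a::euclidean_space) tsimplex"
  assumes t: "tagged_simplex t"
  shows "\<exists>s z. child\<^sup>*\<^sup>* t s \<and> z \<in> verts s \<and> z \<in> interior (elem t)"
proof -
  interpret full_simplex "verts t" using t by (rule tagged_simplex_full)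
  define supp where "supp x = {v \<in> verts t. 0 < bary (verts t) v x}" for x
  define Q where "Q n \<longleftrightarrow> (\<exists>x ys. reach t (x # ys) \<and> card (supp x) = n)" for n
  have fin: "finite (supp x)" for x unfolding supp_def using finite by simp
  have "fst t \<noteq> []" using t by (auto simp: tagged_simplex_def)
  then obtain x0 ys0 where "t = (x0 # ys0, snd t)" by (cases t; cases "fst t") auto
  then have "reach t (x0 # ys0)" unfolding reach_def by (metis rtranclp.rtrancl_refl)
  then have "Q (card (supp x0))" by (auto simp: Q_def)
  moreover have "n \<le> card (verts t)" if "Q n" for n
    using that finite by (auto simp: Q_def supp_def intro!: card_mono)
  ultimately obtain n where n: "Q n" "\<And>m. Q m \<Longrightarrow> m \<le> n"
    using GreatestI_nat[of Q] Greatest_le_nat[of Q] by metis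
  then obtain x ys where x: "reach t (x # ys)" "card (supp x) = n" by (auto simp: Q_def)
  then obtain \<gamma> where \<gamma>: "child\<^sup>*\<^sup>* t (x # ys, \<gamma>)" by (auto simp: reach_def)
  note inv = reach_invariants[OF t \<gamma>]
  have "0 < bary (verts t) v x" if v: "v \<in> verts t" for v
  proof (rule ccontr)
    assume neg: "\<not> 0 < bary (verts t) v x"
    obtain z where z: "z \<in> set (x # ys)" "0 < bary (verts t) v z"
      using inv v by (auto simp: verts_def)
    with neg have "z \<in> set ys" by auto
    then obtain ws where ws: "reach t (midpoint x z # ws)" using reach_midpoint[OF x(1)] by blast
    have "x \<in> elem t" "z \<in> elem t" using inv z(1) by (auto simp: verts_def)
    then have nn: "0 \<le> bary (verts t) w x" "0 \<le> bary (verts t) w z" if "w \<in> verts t" for w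
      using that by (simp_all add: elem_def hull_iff)
    have "insert v (supp x) \<subseteq> supp (midpoint x z)"
      using nn z(2) v by (auto simp: supp_def bary_midpoint add_pos_nonneg add_nonneg_pos)
    then have "card (insert v (supp x)) \<le> card (supp (midpoint x z))"
      by (rule card_mono[OF fin])
    moreover have "v \<notin> supp x" using neg by (simp add: supp_def)
    moreover have "card (supp (midpoint x z)) \<le> n" using ws n(2) by (auto simp: Q_def)
    ultimately show False using x(2) fin by simp
  qed
  then have "x \<in> interior (elem t)" unfolding elem_def by (rule interior_hullI)
  moreover have "x \<in> verts (x # ys, \<gamma>)" by (simp add: verts_def)
  ultimately show ?thesis using \<gamma> by blast
qed

section \<open>Following a path of bisections through conforming refinements\<close>

lemma bisect_verts:
  assumes "2 \<le> length (fst t)"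
  shows "verts t \<subseteq> \<Union>(verts ` bisect t)"
proof -
  obtain x zs y where t: "fst t = x # zs @ [y]"
    using list_first_last[OF assms] by metis
  then show ?thesis by (auto simp: verts_def bisect_def Let_def)
qed

text \<open>Three states of a refinement relative to the path from \<open>t\<close> to
  \<open>s\<close>: not started, advanced to a later element of the path, or past \<open>s\<close>,
  whose vertices then persist because bisection never removes vertices. Only bisecting an element on
  the path changes the state. Marking \<open>t\<close> excludes the first state.\<close>

lemma nvb_refinement_path:
  fixes s :: "('a::euclidean_space) tsimplex"
  assumes r: "nvb_refinement T T'" and len: "\<And>t. t \<in> T \<Longrightarrow> 2 \<le> length (fst t)"
    and t: "t \<in> T" "(child ^^ m) t s"
  shows "t \<in> T' \<or> (\<exists>k<m. \<exists>r\<in>T'. (child ^^ k) r s) \<or> verts s \<subseteq> \<Union>(verts ` T')"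
  using r unfolding nvb_refinement_def
proof (induction rule: rtranclp_induct)
  case base
  then show ?case using t by simp
next
  case (step T1 T2)
  have "nvb_refinement T T1" using step.hyps(1) by (simp add: nvb_refinement_def)
  from nvb_refinement_parent[OF this len] have len1: "2 \<le> length (fst t)" if "t \<in> T1" for t
    using that by blast
  from step.hyps(2) obtain b where b: "b \<in> T1" "T2 = (T1 - {b}) \<union> bisect b"
    unfolding bisect_step_def by blast
  have V: "\<Union>(verts ` T1) \<subseteq> \<Union>(verts ` T2)"
    using bisect_verts[OF len1[OF b(1)]] b by blast
  have main: "r \<in> T2 \<or> (\<exists>k'<k. \<exists>r\<in>T2. (child ^^ k') r s) \<or> verts s \<subseteq> \<Union>(verts ` T2)"
    if r: "r \<in> T1" "(child ^^ k) r s" for r k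
  proof (cases "r = b")
    case True
    show ?thesis
    proof (cases k)
      case 0
      then have "r = s" using r(2) by simp
      then show ?thesis using r(1) V by blast
    next
      case (Suc k')
      then obtain r' where "child r r'" "(child ^^ k') r' s"
        using r(2) relpowp_Suc_D2[of k' child r s] by blast
      then show ?thesis using True b(2) Suc by (auto simp: child_def)
    qed
  qed (use b r in blast)
  from step.IH consider "t \<in> T1" | k r where "k < m" "r \<in> T1" "(child ^^ k) r s"
    | "verts s \<subseteq> \<Union>(verts ` T1)" by blast
  then show ?case
  proof cases
    case 1
    then show ?thesis using main[OF 1 t(2)] by blast
  next
    case 2
    show ?thesis using main[OF 2(2,3)] 2 less_trans by blast
  next
    case 3
    then show ?thesis using V by blast
  qed
qed

text \<open>Each round of refining all elements moves at least one step along the path from \<open>t\<close> to \<open>s\<close>.\<close>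

lemma admissible_reaches_vertices:
  fixes s :: "('a::euclidean_space) tsimplex"
  assumes adm: "nvb_admissible U T\<^sub>0"
    and "T \<in> meshes U T\<^sub>0" "t \<in> T" "(child ^^ m) t s"
  shows "\<exists>T'\<in>meshes U T\<^sub>0. verts s \<subseteq> \<Union>(verts ` T')"
  using assms(2-)
proof (induction m arbitrary: T t rule: less_induct)
  case (less m)
  have conf: "conforming_mesh U T" using less.prems(1) by (simp add: meshes_def)
  obtain T' where T': "is_refine U T T T'"
    using adm less.prems(1) unfolding nvb_admissible_def by blast
  note m' = is_refine_meshes[OF less.prems(1) T']
  have "T \<inter> T' = {}" using T' by (simp add: is_refine_def conforming_refinement_def)
  then have "t \<notin> T'" using less.prems(2) by blast
  with nvb_refinement_path[OF m'(2) conforming_mesh_length[OF conf] less.prems(2,3)]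
  show ?case using less.IH m'(1) by blast
qed

text \<open>Near a boundary point the domain lies strictly on one side of a Lipschitz graph, so
  points slightly above it have a neighbourhood outside \<open>U\<close>. Thus no boundary point,
  such as one on a slit, is interior to the closure.\<close>

lemma lipschitz_domain_interior_closure:
  assumes "lipschitz_domain U"
  shows "interior (closure U) \<subseteq> U"
proof
  fix x assume x: "x \<in> interior (closure U)"
  show "x \<in> U"
  proof (rule ccontr)
    assume "x \<notin> U"
    have "open U" using assms by (simp add: lipschitz_domain_def)
    have "x \<in> frontier U"
      using x \<open>x \<notin> U\<close> interior_subset \<open>open U\<close> by (auto simp: frontier_def interior_open)
    then obtain n r C \<gamma> where n: "norm n = 1" "0 < r" and lip: "C-lipschitz_on UNIV \<gamma>"
      and \<gamma>: "\<And>y t. \<gamma> (y + t *\<^sub>R n) = \<gamma> y" and U: "\<And>y. y \<in> ball x r \<Longrightarrow> y \<in> U \<longleftrightarrow> y \<bullet> n < \<gamma> y"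
      using assms unfolding lipschitz_domain_def by metis
    obtain e where e: "0 < e" "ball x e \<subseteq> closure U" using x by (auto simp: mem_interior)
    \<comment> \<open>Small enough for \<open>y\<close> to lie in the chart ball and in the ball
      contained in the closure.\<close>
    define s where "s = min e r / 2"
    define y where "y = x + s *\<^sub>R n"
    have s: "0 < s" "s < e" "s < r" using e n by (auto simp: s_def)
    have "\<gamma> x \<le> x \<bullet> n" using U[of x] n(2) \<open>x \<notin> U\<close> by simp
    moreover have "n \<bullet> n = 1" using n(1) by (simp add: dot_square_norm)
    ultimately have "\<gamma> y < y \<bullet> n" using s(1) by (simp add: y_def \<gamma> inner_add_left)
    have "dist x y = s" using s n by (simp add: y_def dist_norm)
    define W where "W = ball x r \<inter> {y. \<gamma> y < y \<bullet> n}"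
    have "open W" unfolding W_def
      using lipschitz_on_continuous_on[OF lip] by (intro open_Int open_Collect_less continuous_intros) auto
    moreover have "W \<inter> U = {}" using U by (auto simp: W_def)
    ultimately have "W \<inter> closure U = {}" by (simp add: open_Int_closure_eq_empty)
    moreover have "y \<in> W" using \<open>\<gamma> y < y \<bullet> n\<close> \<open>dist x y = s\<close> s by (simp add: W_def)
    moreover have "y \<in> closure U" using e(2) \<open>dist x y = s\<close> s by auto
    ultimately show False by blast
  qed
qed

lemma admissible_interior_vertex:
  assumes adm: "nvb_admissible U T\<^sub>0" and U: "lipschitz_domain U"
  obtains T t z where "T \<in> meshes U T\<^sub>0" "t \<in> T" "z \<in> verts t" "z \<in> U"
proof -
  have conf: "conforming_mesh U T\<^sub>0" using adm by (simp add: nvb_admissible_def)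
  then have mesh: "T\<^sub>0 \<in> meshes U T\<^sub>0" by (simp add: meshes_def nvb_refinement_def)
  have "U \<noteq> {}" using U by (simp add: lipschitz_domain_def)
  moreover have "(\<Union>t\<in>T\<^sub>0. elem t) = closure U" using conf by (simp add: conforming_mesh_def)
  ultimately obtain t where t: "t \<in> T\<^sub>0" using closure_subset[of U] by blast
  then have "tagged_simplex t" using conf by (simp add: conforming_mesh_def)
  from interior_descendant_vertex[OF this] obtain s z
    where s: "child\<^sup>*\<^sup>* t s" "z \<in> verts s" "z \<in> interior (elem t)" by blast
  obtain m where "(child ^^ m) t s" using s(1) by (auto dest: rtranclp_imp_relpowp)
  from admissible_reaches_vertices[OF adm mesh t this] s(2)
  obtain T t' where "T \<in> meshes U T\<^sub>0" "t' \<in> T" "z \<in> verts t'" by blast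
  moreover have "elem t \<subseteq> closure U" using conf t by (auto simp: conforming_mesh_def)
  then have "z \<in> U" using s(3) interior_mono lipschitz_domain_interior_closure[OF U] by blast
  ultimately show ?thesis using that by blast
qed

section \<open>Mollification of Lipschitz functions\<close>

lemma integrable_compact_support:
  fixes f :: "'a::euclidean_space \<Rightarrow> 'b::{banach, second_countable_topology}"
  assumes "continuous_on UNIV f" "compact K" "\<And>x. x \<notin> K \<Longrightarrow> f x = 0"
  shows "integrable lborel f"
proof -
  have "integrable lborel (\<lambda>x. indicator K x *\<^sub>R f x)"
    using assms by (intro borel_integrable_compact continuous_on_subset[OF assms(1)]) auto
  also have "(\<lambda>x. indicator K x *\<^sub>R f x) = f"
    using assms(3) by (auto simp: fun_eq_iff indicator_def)
  finally show ?thesis .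
qed

lemma lborel_distr_reflect: "distr lborel borel (\<lambda>y. x - y) = (lborel :: 'a::euclidean_space measure)"
  using lborel_affine[of "-1" x] by (simp add: density_1)

lemma lborel_integral_reflect:
  fixes g :: "'a::euclidean_space \<Rightarrow> real"
  assumes "continuous_on UNIV g"
  shows "(\<integral>y. g (x - y) \<partial>lborel) = (\<integral>y. g y \<partial>lborel)"
proof -
  have "(\<integral>y. g y \<partial>lborel) = (\<integral>y. g y \<partial>distr lborel borel (\<lambda>y. x - y))"
    by (simp add: lborel_distr_reflect)
  also have "\<dots> = (\<integral>y. g (x - y) \<partial>lborel)"
    using borel_measurable_continuous_onI[OF assms] by (intro integral_distr) auto
  finally show ?thesis by simp
qed

lemma lborel_integral_translate:
  fixes g :: "'a::euclidean_space \<Rightarrow> real"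
  assumes "continuous_on UNIV g"
  shows "(\<integral>y. g (y + v) \<partial>lborel) = (\<integral>y. g y \<partial>lborel)"
proof -
  have "(\<integral>y. g y \<partial>lborel) = (\<integral>y. g y \<partial>distr lborel borel ((+) v))"
    by (simp add: lborel_distr_plus)
  also have "\<dots> = (\<integral>y. g (v + y) \<partial>lborel)"
    using borel_measurable_continuous_onI[OF assms] by (intro integral_distr) auto
  finally show ?thesis by (simp add: add.commute)
qed

text \<open>Differentiation under the integral over a fixed box; all derivatives fall on the smooth
  factor, so \<open>w\<close> need only be continuous.\<close>

lemma convolution_has_derivative:
  fixes \<rho> w :: "'a::euclidean_space \<Rightarrow> real"
  assumes w: "continuous_on (cbox a b) w" and \<rho>: "\<And>k. C_k k \<rho>"
  shows "((\<lambda>x. integral (cbox a b) (\<lambda>t. w t * \<rho> (x - t))) has_derivative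
    (\<lambda>h. integral (cbox a b) (\<lambda>t. w t * frechet_derivative \<rho> (at (x - t)) h))) (at x)"
proof -
  \<comment> \<open>The Leibniz rule asks for a continuous operator-valued derivative; its
    continuity is checked on basis vectors.\<close>
  define D where "D z = Blinfun (frechet_derivative \<rho> (at z))" for z
  have der: "(\<rho> has_derivative frechet_derivative \<rho> (at z)) (at z)" for z
    using \<rho>[of "Suc 0"] by (rule C_k_differentiable)
  have D: "blinfun_apply (D z) = frechet_derivative \<rho> (at z)" for z
    unfolding D_def by (rule bounded_linear_Blinfun_apply) (rule has_derivative_bounded_linear[OF der])
  have comp: "continuous_on UNIV (\<lambda>z. D z i)" if "i \<in> Basis" for i
  proof -
    have "C_k 0 (\<lambda>x. frechet_derivative \<rho> (at x) i)" using \<rho>[of "Suc 0"] that by simp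
    then show ?thesis by (simp add: D)
  qed
  have contD: "continuous_on UNIV D"
    by (rule continuous_on_blinfun_componentwise) (rule comp)
  have cont: "continuous_on (UNIV \<times> cbox a b) (\<lambda>(x, t). w t *\<^sub>R D (x - t))"
    unfolding case_prod_beta
  proof (rule continuous_on_scaleR)
    show "continuous_on (UNIV \<times> cbox a b) (\<lambda>p :: 'a \<times> 'a. w (snd p))"
      by (rule continuous_on_compose2[OF w]) (auto intro: continuous_on_snd continuous_on_id)
    show "continuous_on (UNIV \<times> cbox a b) (\<lambda>p. D (fst p - snd p))"
      by (rule continuous_on_compose2[OF contD]) (auto intro!: continuous_intros)
  qed
  have cont\<rho>: "continuous_on UNIV \<rho>" by (rule C_k_continuous[OF \<rho>])
  have "((\<lambda>x. integral (cbox a b) (\<lambda>t. w t * \<rho> (x - t))) has_derivative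
      blinfun_apply (integral (cbox a b) (\<lambda>t. w t *\<^sub>R D (x - t)))) (at x within UNIV)"
  proof (rule leibniz_rule[OF _ _ cont])
    fix x t
    have "((\<lambda>x. w t * \<rho> (x - t)) has_derivative (\<lambda>h. w t * frechet_derivative \<rho> (at (x - t)) h)) (at x)"
      by (intro has_derivative_mult_right has_derivative_compose[OF _ der, of "\<lambda>x. x - t" "\<lambda>h. h", simplified])
         (auto intro!: derivative_eq_intros)
    then show "((\<lambda>x. w t * \<rho> (x - t)) has_derivative blinfun_apply (w t *\<^sub>R D (x - t))) (at x within UNIV)"
      by (simp add: D scaleR_blinfun.rep_eq fun_eq_iff)
    show "(\<lambda>t. w t * \<rho> (x - t)) integrable_on cbox a b"
      by (intro integrable_continuous continuous_on_mult w continuous_on_compose2[OF cont\<rho>])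
         (auto intro!: continuous_intros)
  qed auto
  moreover have eq: "blinfun_apply (integral (cbox a b) (\<lambda>t. w t *\<^sub>R D (x - t))) h
      = integral (cbox a b) (\<lambda>t. w t * frechet_derivative \<rho> (at (x - t)) h)" for h
  proof (subst blinfun_apply_integral)
    show "(\<lambda>t. w t *\<^sub>R D (x - t)) integrable_on cbox a b"
      by (intro integrable_continuous continuous_on_scaleR w continuous_on_compose2[OF contD])
         (auto intro!: continuous_intros)
  qed (simp add: D scaleR_blinfun.rep_eq)
  ultimately show ?thesis unfolding eq[THEN ext] by simp
qed

text \<open>The kernel varies in the induction, because a partial derivative of the convolution is
  the convolution with a partial derivative of the kernel.\<close>

lemma C_k_convolution:
  fixes \<rho> w :: "'a::euclidean_space \<Rightarrow> real"
  assumes w: "continuous_on (cbox a b) w" and "\<And>k. C_k k \<rho>"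
  shows "C_k k (\<lambda>x. integral (cbox a b) (\<lambda>t. w t * \<rho> (x - t)))"
  using assms(2)
proof (induction k arbitrary: \<rho>)
  case 0
  have "isCont (\<lambda>x. integral (cbox a b) (\<lambda>t. w t * \<rho> (x - t))) x" for x
    using convolution_has_derivative[OF w 0] by (rule has_derivative_continuous)
  then show ?case by (simp add: continuous_at_imp_continuous_on)
next
  case (Suc k)
  show ?case
  proof (rule C_k_I[OF convolution_has_derivative[OF w Suc.prems]])
    fix i :: 'a assume i: "i \<in> Basis"
    have "C_k n (\<lambda>z. frechet_derivative \<rho> (at z) i)" for n
      using Suc.prems[of "Suc n"] i by simp
    then show "C_k k (\<lambda>x. integral (cbox a b) (\<lambda>t. w t * frechet_derivative \<rho> (at (x - t)) i))"
      by (rule Suc.IH)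
  qed
qed

section \<open>Mollifiers and the regularity of mollified functions\<close>

definition mollifier :: "real \<Rightarrow> ('a::euclidean_space \<Rightarrow> real) \<Rightarrow> bool" where
  "mollifier r \<rho> \<longleftrightarrow> (\<forall>k. C_k k \<rho>) \<and> (\<forall>y. 0 \<le> \<rho> y) \<and> (\<forall>y. r \<le> norm y \<longrightarrow> \<rho> y = 0) \<and>
     (\<integral>y. \<rho> y \<partial>lborel) = 1"

lemma mollifier_exists:
  assumes "0 < r"
  obtains \<rho> :: "'a::euclidean_space \<Rightarrow> real" where "mollifier r \<rho>"
proof -
  obtain a b :: 'a where ab: "cbox a b \<subseteq> ball 0 r" "0 \<in> box a b"
    using open_contains_cbox[of "ball (0::'a) r" 0] assms by (metis open_ball centre_in_ball)
  define \<psi> where "\<psi> = box_bump a b 1"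
  have cont: "continuous_on UNIV \<psi>"
    unfolding \<psi>_def by (rule C_k_continuous[OF box_bump_C_k[of 0]])
  have 0: "\<psi> y = 0" if "y \<notin> box a b" for y
    using that box_bump_eq_0[of 1 y a b] by (simp add: \<psi>_def)
  have int: "integrable lborel \<psi>"
    by (rule integrable_compact_support[OF cont, of "cbox a b"]) (use 0 box_subset_cbox in auto)
  define Z where "Z = (\<integral>y. \<psi> y \<partial>lborel)"
  have "Z \<noteq> 0"
  proof
    assume "Z = 0"
    then have "AE y in lborel. \<psi> y = 0"
      using integral_nonneg_eq_0_iff_AE[OF int] box_bump_bounds(1)[of a b 1] by (simp add: Z_def \<psi>_def)
    then have "AE y in lborel. y \<notin> box a b"
      by eventually_elim (metis \<psi>_def box_bump_pos_iff less_irrefl zero_less_one)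
    then have "AE y in lebesgue. y \<notin> box a b" by (rule AE_completion)
    then have "negligible (box a b)"
      by (simp add: negligible_iff_null_sets AE_iff_null_sets)
    then show False using open_not_negligible[OF open_box] ab(2) by blast
  qed
  moreover have "0 \<le> Z"
    unfolding Z_def using box_bump_bounds(1)[of a b 1]
    by (intro Bochner_Integration.integral_nonneg) (simp add: \<psi>_def)
  ultimately have Z: "0 < Z" by simp
  have "mollifier r (\<lambda>y. (1 / Z) * \<psi> y)"
    unfolding mollifier_def
  proof (intro conjI allI impI)
    show "C_k k (\<lambda>y. (1 / Z) * \<psi> y)" for k
      unfolding \<psi>_def by (intro C_k_mult C_k_const box_bump_C_k)
    show "0 \<le> (1 / Z) * \<psi> y" for y
      using Z box_bump_bounds(1)[of a b 1 y] by (simp add: \<psi>_def)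
    show "(1 / Z) * \<psi> y = 0" if "r \<le> norm y" for y
    proof -
      have "y \<notin> ball 0 r" using that by simp
      then have "y \<notin> box a b" using ab(1) box_subset_cbox by blast
      then show ?thesis by (simp add: 0)
    qed
    show "(\<integral>y. (1 / Z) * \<psi> y \<partial>lborel) = 1"
      using Z int by (simp add: Z_def)
  qed
  then show ?thesis by (rule that)
qed

text \<open>The translation is put on \<open>w\<close>, which suits Lipschitz and distance
  estimates. For smoothness it is moved to the kernel by reflecting the integral.\<close>

definition mollify :: "('a::euclidean_space \<Rightarrow> real) \<Rightarrow> ('a \<Rightarrow> real) \<Rightarrow> 'a \<Rightarrow> real" where
  "mollify \<rho> w x = (\<integral>y. w (x - y) * \<rho> y \<partial>lborel)"

context
  fixes r :: real and \<rho> :: "'a::euclidean_space \<Rightarrow> real"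
  assumes \<rho>: "mollifier r \<rho>"
begin

lemma mollifier_0: "r \<le> norm y \<Longrightarrow> \<rho> y = 0"
  using \<rho> by (simp add: mollifier_def)

lemma mollifier_nonneg: "0 \<le> \<rho> y"
  using \<rho> by (simp add: mollifier_def)

lemma mollifier_integral: "(\<integral>y. \<rho> y \<partial>lborel) = 1"
  using \<rho> by (simp add: mollifier_def)

lemma mollifier_C_k: "C_k k \<rho>"
  using \<rho> by (simp add: mollifier_def)

lemma mollifier_times_integrable:
  assumes "continuous_on UNIV g"
  shows "integrable lborel (\<lambda>y. (g y :: real) * \<rho> y)"
proof (rule integrable_compact_support[of _ "cball 0 r"])
  show "continuous_on UNIV (\<lambda>y. g y * \<rho> y)"
    by (intro continuous_on_mult assms C_k_continuous[OF mollifier_C_k])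
qed (auto simp: mollifier_0)

text \<open>The kernel is a probability density supported in the ball of radius r, so only the
  values of \<open>g\<close> there matter.\<close>

lemma mollifier_average_bound:
  assumes "continuous_on UNIV g" "\<And>y. norm y < r \<Longrightarrow> \<bar>g y\<bar> \<le> B"
  shows "\<bar>\<integral>y. g y * \<rho> y \<partial>lborel\<bar> \<le> B"
proof -
  note int = mollifier_times_integrable[OF assms(1)]
  have "\<bar>\<integral>y. g y * \<rho> y \<partial>lborel\<bar> \<le> (\<integral>y. \<bar>g y * \<rho> y\<bar> \<partial>lborel)"
    using integral_norm_bound[of lborel "\<lambda>y. g y * \<rho> y"] by simp
  also have "\<dots> \<le> (\<integral>y. B * \<rho> y \<partial>lborel)"
  proof (rule Bochner_Integration.integral_mono)
    show "integrable lborel (\<lambda>y. \<bar>g y * \<rho> y\<bar>)" using int by simp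
    show "integrable lborel (\<lambda>y. B * \<rho> y)"
      by (rule mollifier_times_integrable) simp
    show "\<bar>g y * \<rho> y\<bar> \<le> B * \<rho> y" for y
    proof (cases "norm y < r")
      case True
      then show ?thesis using assms(2) mollifier_nonneg by (simp add: abs_mult mult_right_mono)
    qed (simp add: mollifier_0)
  qed
  also have "\<dots> = B" by (simp add: mollifier_integral)
  finally show ?thesis .
qed

lemma mollify_diff:
  assumes "continuous_on UNIV w" "continuous_on UNIV v"
  shows "mollify \<rho> w x - mollify \<rho> v z = (\<integral>y. (w (x - y) - v (z - y)) * \<rho> y \<partial>lborel)"
proof -
  have "continuous_on UNIV (\<lambda>y. w (x - y))" "continuous_on UNIV (\<lambda>y. v (z - y))"
    by (auto intro!: continuous_on_compose2[OF assms(1)] continuous_on_compose2[OF assms(2)] continuous_intros)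
  from this[THEN mollifier_times_integrable] show ?thesis
    by (simp add: mollify_def left_diff_distrib)
qed

lemma mollify_lipschitz:
  assumes w: "C-lipschitz_on UNIV w"
  shows "\<bar>mollify \<rho> w x - mollify \<rho> w z\<bar> \<le> C * dist x z"
proof -
  have cont: "continuous_on UNIV w" by (rule lipschitz_on_continuous_on[OF w])
  show ?thesis
    unfolding mollify_diff[OF cont cont]
  proof (rule mollifier_average_bound)
    show "continuous_on UNIV (\<lambda>y. w (x - y) - w (z - y))"
      by (auto intro!: continuous_on_compose2[OF cont] continuous_intros)
    show "\<bar>w (x - y) - w (z - y)\<bar> \<le> C * dist x z" for y
      using lipschitz_onD[OF w, of "x - y" "z - y"] by (simp add: dist_norm)
  qed
qed

lemma mollify_close:
  assumes w: "C-lipschitz_on UNIV w"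
  shows "\<bar>mollify \<rho> w x - w x\<bar> \<le> C * r"
proof -
  have cont: "continuous_on UNIV w" by (rule lipschitz_on_continuous_on[OF w])
  \<comment> \<open>A constant is its own average, so the error is itself an average of increments
    of \<open>w\<close> over distances below r.\<close>
  have "w x = mollify \<rho> (\<lambda>_. w x) x" by (simp add: mollify_def mollifier_integral)
  then have "\<bar>mollify \<rho> w x - w x\<bar> = \<bar>mollify \<rho> w x - mollify \<rho> (\<lambda>_. w x) x\<bar>" by simp
  also have "\<dots> \<le> C * r"
    unfolding mollify_diff[OF cont continuous_on_const]
  proof (rule mollifier_average_bound)
    show "continuous_on UNIV (\<lambda>y. w (x - y) - w x)"
      by (auto intro!: continuous_on_compose2[OF cont] continuous_intros)
    show "\<bar>w (x - y) - w x\<bar> \<le> C * r" if "norm y < r" for y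
      using lipschitz_onD[OF w, of "x - y" x] that lipschitz_on_nonneg[OF w]
        mult_left_mono[of "norm y" r C] by (simp add: dist_norm)
  qed
  finally show ?thesis .
qed

lemma mollify_cong:
  assumes "\<And>y. dist x y < r \<Longrightarrow> w y = v y"
  shows "mollify \<rho> w x = mollify \<rho> v x"
  unfolding mollify_def
proof (rule Bochner_Integration.integral_cong)
  show "w (x - y) * \<rho> y = v (x - y) * \<rho> y" for y
    using assms[of "x - y"] by (cases "norm y < r") (auto simp: dist_norm mollifier_0)
qed simp

text \<open>Averaging changes only the constant term of an affine function and keeps its gradient.
  The constant is left unevaluated since the kernel is not assumed symmetric.\<close>

lemma mollify_affine: "mollify \<rho> (\<lambda>y. a + c \<bullet> y) x = mollify \<rho> (\<lambda>y. a + c \<bullet> y) 0 + c \<bullet> x"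
proof -
  have cont: "continuous_on UNIV (\<lambda>y. a + c \<bullet> y)" by (intro continuous_intros)
  have "mollify \<rho> (\<lambda>y. a + c \<bullet> y) x - mollify \<rho> (\<lambda>y. a + c \<bullet> y) 0 = (\<integral>y. (c \<bullet> x) * \<rho> y \<partial>lborel)"
    unfolding mollify_diff[OF cont cont] by (simp add: inner_diff_right)
  then show ?thesis by (simp add: mollifier_integral)
qed

lemma mollify_C_k:
  assumes cont: "continuous_on UNIV w" and K: "compact K" "\<And>x. x \<notin> K \<Longrightarrow> w x = 0"
  shows "C_k k (mollify \<rho> w)"
proof -
  obtain a b where ab: "K \<subseteq> cbox a b"
    using bounded_subset_cbox_symmetric[OF compact_imp_bounded[OF K(1)]] by blast
  have cont\<rho>: "continuous_on UNIV \<rho>" by (rule C_k_continuous[OF mollifier_C_k])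
  have "mollify \<rho> w x = integral (cbox a b) (\<lambda>t. w t * \<rho> (x - t))" for x
  proof -
    have c: "continuous_on UNIV (\<lambda>y. w (x - y) * \<rho> y)" "continuous_on UNIV (\<lambda>t. w t * \<rho> (x - t))"
      by (auto intro!: continuous_on_mult cont cont\<rho> continuous_on_compose2[OF cont]
          continuous_on_compose2[OF cont\<rho>] continuous_intros)
    have "mollify \<rho> w x = (\<integral>t. w t * \<rho> (x - t) \<partial>lborel)"
      using lborel_integral_reflect[OF c(1), of x] by (simp add: mollify_def)
    also have "\<dots> = integral UNIV (\<lambda>t. w t * \<rho> (x - t))"
      using K by (intro integral_lborel[symmetric] integrable_compact_support[OF c(2), of K]) auto
    also have "\<dots> = integral UNIV (\<lambda>t. if t \<in> cbox a b then w t * \<rho> (x - t) else 0)"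
      using K(2) ab by (intro Henstock_Kurzweil_Integration.integral_cong) auto
    also have "\<dots> = integral (cbox a b) (\<lambda>t. w t * \<rho> (x - t))"
      by (rule Henstock_Kurzweil_Integration.integral_restrict_UNIV)
    finally show ?thesis .
  qed
  then have "mollify \<rho> w = (\<lambda>x. integral (cbox a b) (\<lambda>t. w t * \<rho> (x - t)))" by blast
  then show ?thesis
    using C_k_convolution[OF continuous_on_subset[OF cont subset_UNIV] mollifier_C_k] by simp
qed

lemma mollify_test_function:
  assumes cont: "continuous_on UNIV w" and K: "compact K" "\<And>x. x \<notin> K \<Longrightarrow> w x = 0"
    and U: "(\<Union>x\<in>K. cball x r) \<subseteq> U"
  shows "test_function U (mollify \<rho> w)"
  unfolding test_function_def
proof (intro conjI allI)
  show "C_k k (mollify \<rho> w)" for k by (rule mollify_C_k[OF cont K])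
  \<comment> \<open>The Minkowski sum of the support with the closed ball is compact and contains
    the support of the mollification.\<close>
  define K' where "K' = {x + y |x y. x \<in> K \<and> y \<in> cball 0 r}"
  have "compact K'" unfolding K'_def by (intro compact_sums K compact_cball)
  moreover have "K' \<subseteq> U"
    using U by (force simp: K'_def dist_norm)
  moreover have "mollify \<rho> w x = 0" if x: "x \<notin> K'" for x
  proof -
    have "w y = 0" if "dist x y < r" for y
    proof (rule K(2))
      show "y \<notin> K"
      proof
        assume "y \<in> K"
        moreover have "x = y + (x - y)" "x - y \<in> cball 0 r" using that by (simp_all add: dist_norm norm_minus_commute)
        ultimately show False using x unfolding K'_def by blast
      qed
    qed
    then have "mollify \<rho> w x = mollify \<rho> (\<lambda>_. 0) x" by (rule mollify_cong)
    then show ?thesis by (simp add: mollify_def)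
  qed
  ultimately show "\<exists>K. compact K \<and> K \<subseteq> U \<and> (\<forall>x. x \<notin> K \<longrightarrow> mollify \<rho> w x = 0)" by blast
qed

end

section \<open>Gradient bounds and integration by parts for test functions\<close>

lemma grad_norm_le_lipschitz:
  assumes \<phi>: "test_function U \<phi>" and lip: "\<And>x z. \<bar>\<phi> x - \<phi> z\<bar> \<le> C * dist x z"
  shows "norm (grad \<phi> x) \<le> C"
proof -
  define D where "D = grad \<phi> x"
  \<comment> \<open>In the direction of the gradient itself the directional derivative is
    \<open>(norm D)^2\<close>, while the Lipschitz bound limits it to
    \<open>C * norm D\<close>.\<close>
  define g where "g = (\<lambda>t::real. \<phi> (x + t *\<^sub>R D))"
  have "((\<lambda>t. x + t *\<^sub>R D) has_derivative (\<lambda>t. t *\<^sub>R D)) (at 0)"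
    by (auto intro!: derivative_eq_intros)
  moreover have "(\<phi> has_derivative (\<lambda>h. D \<bullet> h)) (at (x + 0 *\<^sub>R D))"
    using test_function_has_derivative[OF \<phi>, of x] by (simp add: D_def)
  ultimately have "(g has_derivative (\<lambda>t. D \<bullet> (t *\<^sub>R D))) (at 0)"
    unfolding g_def by (rule has_derivative_compose)
  then have "(g has_real_derivative (norm D)\<^sup>2) (at 0)"
    by (simp add: has_field_derivative_def power2_norm_eq_inner mult_commute_abs)
  then have "((\<lambda>h. (g (0 + h) - g 0) / h) \<longlongrightarrow> (norm D)\<^sup>2) (at 0)"
    by (simp add: DERIV_def)
  moreover have "\<forall>\<^sub>F h in at 0. (g (0 + h) - g 0) / h \<le> C * norm D"
  proof -
    have "(g (0 + h) - g 0) / h \<le> C * norm D" if "h \<noteq> 0" for h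
    proof -
      have "\<bar>g (0 + h) - g 0\<bar> \<le> C * (\<bar>h\<bar> * norm D)"
        using lip[of "x + h *\<^sub>R D" x] by (simp add: g_def dist_norm)
      then have "\<bar>(g (0 + h) - g 0) / h\<bar> \<le> C * norm D"
        using that by (simp add: abs_divide divide_le_eq mult_ac)
      then show ?thesis by linarith
    qed
    then show ?thesis by (simp add: eventually_at_filter)
  qed
  ultimately have "(norm D)\<^sup>2 \<le> C * norm D"
    by (rule tendsto_upperbound) simp
  \<comment> \<open>Two points at distance 1 show this; it settles the case of a vanishing gradient,
    where no cancellation is possible.\<close>
  moreover have "0 \<le> C"
    using lip[of x "x + (SOME b. b \<in> Basis)"] SOME_Basis[where 'a='a]
    by (smt (verit, best) dist_norm norm_Basis add_diff_cancel_left' diff_add_cancel mult_cancel_left2 norm_minus_commute abs_ge_zero)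
  ultimately show ?thesis
    by (cases "norm D = 0") (auto simp: power2_eq_square D_def)
qed

text \<open>By translation invariance every difference quotient of \<open>f\<close> has integral 0.
  They converge boundedly to the directional derivative, on a common bounded set.\<close>

lemma integral_grad_eq_0:
  fixes f :: "'a::euclidean_space \<Rightarrow> real"
  assumes U: "bounded U" "open U" and f: "test_function U f"
  shows "(\<integral>x. grad f x \<partial>lebesgue_on U) = 0"
proof -
  obtain K where K: "compact K" "K \<subseteq> U" "\<And>x. x \<notin> K \<Longrightarrow> f x = 0" "\<And>x. x \<notin> K \<Longrightarrow> grad f x = 0"
    using test_function_support[OF f] by metis
  obtain B where B: "0 < B" "\<And>x. norm (grad f x) \<le> B" using grad_bounded[OF f] by metis
  have contf: "continuous_on UNIV f" by (rule test_function_continuous[OF f])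
  have contg: "continuous_on UNIV (grad f)" by (rule grad_continuous[OF f])
  have lip: "\<bar>f x - f y\<bar> \<le> B * norm (x - y)" for x y
  proof -
    have "norm (f x - f y) \<le> B * norm (x - y)"
    proof (rule differentiable_bound[of UNIV f "\<lambda>x h. grad f x \<bullet> h"])
      show "onorm (\<lambda>h. grad f x \<bullet> h) \<le> B" for x
      proof (rule onorm_bound)
        show "norm (grad f x \<bullet> h) \<le> B * norm h" for h
          using Cauchy_Schwarz_ineq2[of "grad f x" h] mult_right_mono[OF B(2)[of x], of "norm h"] by simp
      qed (use B in simp)
    qed (auto intro: test_function_has_derivative[OF f])
    then show ?thesis by simp
  qed
  have intf: "integrable lborel f" by (rule integrable_compact_support[OF contf K(1,3)])
  have intg: "integrable lborel (grad f)" by (rule integrable_compact_support[OF contg K(1,4)])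
  obtain \<rho> where \<rho>: "K \<subseteq> cball 0 \<rho>" using bounded_subset_ballD[OF compact_imp_bounded[OF K(1)], of 0] ball_subset_cball by blast
  have comp: "(\<integral>x. grad f x \<bullet> b \<partial>lborel) = 0" if b: "b \<in> Basis" for b
  proof -
    define F where "F n x = (f (x + (1 / real (Suc n)) *\<^sub>R b) - f x) * real (Suc n)" for n x
    have "(\<lambda>n. \<integral>x. F n x \<partial>lborel) \<longlonglongrightarrow> (\<integral>x. grad f x \<bullet> b \<partial>lborel)"
    proof (rule integral_dominated_convergence)
      show "(\<lambda>x. grad f x \<bullet> b) \<in> borel_measurable lborel"
        using intg by (intro borel_measurable_integrable integrable_inner_left) auto
      have c: "continuous_on UNIV (F n)" for n
        unfolding F_def by (auto intro!: continuous_intros continuous_on_compose2[OF contf])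
      show "F n \<in> borel_measurable lborel" for n
        using borel_measurable_continuous_onI[OF c] by simp
      \<comment> \<open>Translations have length at most 1, so a ball enlarged by 1 supports all
        difference quotients.\<close>
      show "integrable lborel (\<lambda>x. indicator (cball (0::'a) (\<rho> + 1)) x *\<^sub>R B)"
        by (intro borel_integrable_compact) auto
      have "norm (F n x) \<le> indicator (cball (0::'a) (\<rho> + 1)) x *\<^sub>R B" for n x
      proof (cases "x \<in> cball 0 (\<rho> + 1)")
        case True
        have "\<bar>f (x + (1 / real (Suc n)) *\<^sub>R b) - f x\<bar> \<le> B * (1 / real (Suc n))"
          using lip[of "x + (1 / real (Suc n)) *\<^sub>R b" x] b by simp
        then have "\<bar>f (x + (1 / real (Suc n)) *\<^sub>R b) - f x\<bar> * real (Suc n) \<le> B"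
          by (simp add: field_simps)
        then show ?thesis using True by (simp add: F_def abs_mult)
      next
        case False
        then have x: "\<rho> + 1 < norm x" by simp
        have "norm ((1 / real (Suc n)) *\<^sub>R b) \<le> 1" using b by simp
        then have "\<rho> < norm (x + (1 / real (Suc n)) *\<^sub>R b)"
          using x norm_diff_ineq[of x "(1 / real (Suc n)) *\<^sub>R b"] by linarith
        then have "x + (1 / real (Suc n)) *\<^sub>R b \<notin> K" "x \<notin> K" using \<rho> x by auto
        then show ?thesis using K(3) B(1) by (simp add: F_def)
      qed
      then show "AE x in lborel. norm (F n x) \<le> indicator (cball (0::'a) (\<rho> + 1)) x *\<^sub>R B" for n
        by simp
      have "(\<lambda>n. F n x) \<longlonglongrightarrow> grad f x \<bullet> b" for x
      proof -
        have "((\<lambda>t. x + t *\<^sub>R b) has_derivative (\<lambda>t. t *\<^sub>R b)) (at 0)"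
          by (auto intro!: derivative_eq_intros)
        moreover have "(f has_derivative (\<lambda>h. grad f x \<bullet> h)) (at (x + 0 *\<^sub>R b))"
          using test_function_has_derivative[OF f, of x] by simp
        ultimately have "((\<lambda>t. f (x + t *\<^sub>R b)) has_derivative (\<lambda>t. grad f x \<bullet> (t *\<^sub>R b))) (at 0)"
          by (rule has_derivative_compose)
        then have "((\<lambda>t. f (x + t *\<^sub>R b)) has_real_derivative grad f x \<bullet> b) (at 0)"
          by (simp add: has_field_derivative_def mult_commute_abs)
        then have "((\<lambda>h. (f (x + h *\<^sub>R b) - f x) / h) \<longlongrightarrow> grad f x \<bullet> b) (at 0)"
          by (simp add: DERIV_def)
        moreover have "filterlim (\<lambda>n. 1 / real (Suc n)) (at 0) sequentially"
          using LIMSEQ_inverse_real_of_nat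
          by (auto simp: filterlim_at inverse_eq_divide eventually_sequentially)
        ultimately have "(\<lambda>n. (f (x + (1 / real (Suc n)) *\<^sub>R b) - f x) / (1 / real (Suc n))) \<longlonglongrightarrow> grad f x \<bullet> b"
          by (rule filterlim_compose)
        then show ?thesis by (simp add: F_def)
      qed
      then show "AE x in lborel. (\<lambda>n. F n x) \<longlonglongrightarrow> grad f x \<bullet> b" by simp
    qed
    moreover have "(\<integral>x. F n x \<partial>lborel) = 0" for n
    proof -
      define v where "v = (1 / real (Suc n)) *\<^sub>R b"
      have c: "continuous_on UNIV (\<lambda>x. f (x + v))"
        by (auto intro!: continuous_intros continuous_on_compose2[OF contf])
      have "integrable lborel (\<lambda>x. f (x + v))"
      proof (rule integrable_compact_support[OF c])
        show "compact ((\<lambda>y. y + (- v)) ` K)"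
          using compact_translation[OF K(1), of "- v"] by (simp add: add.commute)
        show "f (x + v) = 0" if "x \<notin> (\<lambda>y. y + (- v)) ` K" for x
          using that K(3)[of "x + v"] by (force intro: image_eqI[of _ _ "x + v"])
      qed
      moreover have "F n = (\<lambda>x. (f (x + v) - f x) * real (Suc n))"
        by (simp add: F_def v_def fun_eq_iff)
      ultimately show ?thesis
        using intf lborel_integral_translate[OF contf, of v] by simp
    qed
    ultimately show ?thesis by (simp add: LIMSEQ_const_iff)
  qed
  have "(\<integral>x. grad f x \<partial>lebesgue_on U) = (\<integral>x. (if x \<in> U then grad f x else 0) \<partial>lebesgue)"
    using U by (intro Lebesgue_Measure.integral_restrict_UNIV[symmetric]) auto
  also have "(\<lambda>x. if x \<in> U then grad f x else 0) = grad f"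
    using K(2,4) by (auto simp: fun_eq_iff)
  also have "(\<integral>x. grad f x \<partial>lebesgue) = (\<integral>x. grad f x \<partial>lborel)"
    using borel_measurable_continuous_onI[OF contg] by (intro integral_completion) simp
  also have "\<dots> = 0"
  proof (rule euclidean_eqI)
    fix b :: 'a assume b: "b \<in> Basis"
    have "(\<integral>x. grad f x \<partial>lborel) \<bullet> b = (\<integral>x. grad f x \<bullet> b \<partial>lborel)"
      by (rule integral_inner_left[symmetric]) (rule intg)
    then show "(\<integral>x. grad f x \<partial>lborel) \<bullet> b = 0 \<bullet> b" using comp[OF b] by simp
  qed
  finally show ?thesis .
qed

lemma test_function_mult:
  assumes "test_function U \<phi>" "test_function U \<psi>"
  shows "test_function U (\<lambda>x. \<phi> x * \<psi> x)"
proof -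
  obtain K where "compact K" "K \<subseteq> U" "\<And>x. x \<notin> K \<Longrightarrow> \<phi> x = 0"
    using assms(1) unfolding test_function_def by metis
  then have "\<exists>K. compact K \<and> K \<subseteq> U \<and> (\<forall>x. x \<notin> K \<longrightarrow> \<phi> x * \<psi> x = 0)"
    by (intro exI[of _ K]) auto
  then show ?thesis
    using assms by (auto simp: test_function_def intro!: C_k_mult)
qed

text \<open>The product is a test function, so the integral of its gradient vanishes.\<close>

lemma test_function_integration_by_parts:
  fixes \<phi> \<psi> :: "'a::euclidean_space \<Rightarrow> real"
  assumes U: "bounded U" "open U" and \<phi>: "test_function U \<phi>" and \<psi>: "test_function U \<psi>"
  shows "(\<integral>x. \<phi> x *\<^sub>R grad \<psi> x \<partial>lebesgue_on U) = - (\<integral>x. \<psi> x *\<^sub>R grad \<phi> x \<partial>lebesgue_on U)"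
proof -
  have "grad (\<lambda>x. \<phi> x * \<psi> x) x = \<phi> x *\<^sub>R grad \<psi> x + \<psi> x *\<^sub>R grad \<phi> x" for x
  proof (rule grad_eqI[OF test_function_mult[OF \<phi> \<psi>]])
    have "((\<lambda>x. \<phi> x * \<psi> x) has_derivative (\<lambda>h. \<phi> x * (grad \<psi> x \<bullet> h) + (grad \<phi> x \<bullet> h) * \<psi> x)) (at x)"
      by (intro has_derivative_mult test_function_has_derivative[OF \<phi>] test_function_has_derivative[OF \<psi>])
    then show "((\<lambda>x. \<phi> x * \<psi> x) has_derivative (\<lambda>h. (\<phi> x *\<^sub>R grad \<psi> x + \<psi> x *\<^sub>R grad \<phi> x) \<bullet> h)) (at x)"
      by (simp add: inner_add_left mult.commute)
  qed
  moreover have "integrable (lebesgue_on U) (\<lambda>x. \<phi> x *\<^sub>R grad \<psi> x)" "integrable (lebesgue_on U) (\<lambda>x. \<psi> x *\<^sub>R grad \<phi> x)"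
    by (intro L2_on_scaled_integrable test_function_L2[OF U(2,1) \<phi>] test_function_L2[OF U(2,1) \<psi>])+
  ultimately show ?thesis
    using integral_grad_eq_0[OF U test_function_mult[OF \<phi> \<psi>]] by (simp add: eq_neg_iff_add_eq_0)
qed

section \<open>Piecewise affine functions vanishing outside the domain\<close>

lemma grad_mollify_affine:
  fixes v :: "'a::euclidean_space \<Rightarrow> real"
  assumes aff: "\<And>y. dist x y < \<delta> \<Longrightarrow> v y = a + c \<bullet> y" and \<delta>: "0 < r" "2 * r \<le> \<delta>"
    and \<rho>: "mollifier r \<rho>" and test: "test_function U (mollify \<rho> v)"
  shows "grad (mollify \<rho> v) x = c"
proof (rule grad_eqI[OF test])
  have eq: "mollify \<rho> v y = mollify \<rho> (\<lambda>y. a + c \<bullet> y) 0 + c \<bullet> y" if "y \<in> ball x r" for y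
  proof -
    have "mollify \<rho> v y = mollify \<rho> (\<lambda>y. a + c \<bullet> y) y"
    proof (rule mollify_cong[OF \<rho>])
      fix z assume "dist y z < r"
      \<comment> \<open>The derivative at \<open>x\<close> involves points within r of
        \<open>x\<close>, and averaging there looks r further, hence
        \<open>2 * r \<le> \<delta>\<close>.\<close>
      then have "dist x z < \<delta>" using that \<delta> dist_triangle[of x z y] by simp
      then show "v z = a + c \<bullet> z" by (rule aff)
    qed
    from trans[OF this mollify_affine[OF \<rho>]] show ?thesis .
  qed
  have "((\<lambda>y. mollify \<rho> (\<lambda>y. a + c \<bullet> y) 0 + c \<bullet> y) has_derivative (\<lambda>h. c \<bullet> h)) (at x)"
    by (auto intro!: derivative_eq_intros)
  then show "(mollify \<rho> v has_derivative (\<lambda>h. c \<bullet> h)) (at x)"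
    by (rule has_derivative_transform_within_open[OF _ open_ball[of x r]]) (use \<delta> eq in auto)
qed

text \<open>The approximating test functions are mollifications of \<open>max 0 (w - 1 / (n + 1))\<close>, whose
  supports are compact in \<open>U\<close>.\<close>

lemma piecewise_affine_H10:
  fixes w :: "'a::euclidean_space \<Rightarrow> real"
  assumes U: "bounded U" "open U" and lip: "C-lipschitz_on UNIV w"
    and nn: "\<And>x. 0 \<le> w x" and zero: "\<And>x. x \<notin> U \<Longrightarrow> w x = 0"
    and gm: "g \<in> borel_measurable (lebesgue_on U)"
    and affine: "AE x in lebesgue_on U. \<exists>\<delta>>0. \<forall>y. dist x y < \<delta> \<longrightarrow> w y = w x + g x \<bullet> (y - x)"
  shows "w \<in> H10 U" "has_weak_grad U w g"
proof -
  have Ul: "U \<in> lmeasurable" using U by (intro lmeasurable_open)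
  have cont: "continuous_on UNIV w" by (rule lipschitz_on_continuous_on[OF lip])
  have C: "0 \<le> C" by (rule lipschitz_on_nonneg[OF lip])
  define e where "e n = 1 / real (Suc n)" for n
  have e: "0 < e n" for n by (simp add: e_def)
  have elim: "e \<longlonglongrightarrow> 0" unfolding e_def using LIMSEQ_inverse_real_of_nat by (simp add: inverse_eq_divide)
  define v where "v n = (\<lambda>x. max 0 (w x - e n))" for n
  define K where "K n = {x. e n \<le> w x}" for n
  have KU: "K n \<subseteq> U" for n using zero e[of n] by (force simp: K_def)
  have "compact (K n)" for n
  proof -
    have "closed (K n)" unfolding K_def by (intro closed_Collect_le continuous_intros cont)
    moreover have "bounded (K n)" using KU U(1) bounded_subset by blast
    ultimately show ?thesis by (simp add: compact_eq_bounded_closed)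
  qed
  \<comment> \<open>The radius keeps the support, widened by mollification, inside \<open>U\<close>,
    and tends to 0 together with \<open>e n\<close>.\<close>
  then have "\<exists>r>0. r \<le> e n \<and> (\<Union>x\<in>K n. cball x r) \<subseteq> U" for n
  proof -
    obtain r where r: "0 < r" "(\<Union>x\<in>K n. cball x r) \<subseteq> U"
      using compact_subset_open_imp_cball_epsilon_subset[OF \<open>compact (K n)\<close> U(2) KU] by blast
    have "(\<Union>x\<in>K n. cball x (min r (e n))) \<subseteq> (\<Union>x\<in>K n. cball x r)" by auto
    with r e[of n] show ?thesis by (intro exI[of _ "min r (e n)"]) auto
  qed
  then obtain r where r: "\<And>n. 0 < r n" "\<And>n. r n \<le> e n" "\<And>n. (\<Union>x\<in>K n. cball x (r n)) \<subseteq> U" by metis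
  have "\<exists>\<rho>. mollifier (r n) (\<rho> :: 'a \<Rightarrow> real)" for n using mollifier_exists[OF r(1)] by metis
  then obtain \<rho> :: "nat \<Rightarrow> 'a \<Rightarrow> real" where \<rho>: "\<And>n. mollifier (r n) (\<rho> n)" by metis
  have vlip: "C-lipschitz_on UNIV (v n)" for n
  proof (rule lipschitz_onI[OF _ C])
    fix x y
    have "\<bar>v n x - v n y\<bar> \<le> \<bar>w x - w y\<bar>" by (simp add: v_def max_def)
    then show "dist (v n x) (v n y) \<le> C * dist x y"
      using lipschitz_onD[OF lip, of x y] by (simp add: dist_norm)
  qed
  have vcont: "continuous_on UNIV (v n)" for n by (rule lipschitz_on_continuous_on[OF vlip])
  define \<phi> where "\<phi> n = mollify (\<rho> n) (v n)" for n
  have test: "test_function U (\<phi> n)" for n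
    unfolding \<phi>_def
    by (rule mollify_test_function[OF \<rho> vcont \<open>compact (K n)\<close> _ r(3)]) (auto simp: K_def v_def)
  have \<phi>close: "\<bar>\<phi> n x - w x\<bar> \<le> (C + 1) * e n" for n x
  proof -
    have "\<bar>\<phi> n x - v n x\<bar> \<le> C * r n" unfolding \<phi>_def by (rule mollify_close[OF \<rho> vlip])
    moreover have "\<bar>v n x - w x\<bar> \<le> e n" using nn[of x] e[of n] by (auto simp: v_def max_def)
    moreover have "C * r n \<le> C * e n" using r(2) C by (rule mult_left_mono)
    ultimately show ?thesis by (simp add: algebra_simps)
  qed
  have e1: "e n \<le> 1" for n by (simp add: e_def)
  have \<phi>bd: "\<bar>\<phi> n x - w x\<bar> \<le> C + 1" for n x
  proof -
    have "(C + 1) * e n \<le> (C + 1) * 1" by (rule mult_left_mono) (use e1 C in auto)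
    from order_trans[OF \<phi>close this] show ?thesis by simp
  qed
  have \<phi>lim: "(\<lambda>n. \<phi> n x - w x) \<longlonglongrightarrow> 0" for x
  proof (rule tendsto_rabs_zero_cancel, rule tendsto_sandwich[OF _ _ tendsto_const])
    show "(\<lambda>n. (C + 1) * e n) \<longlonglongrightarrow> 0" using tendsto_mult_right_zero[OF elim] .
  qed (simp_all add: \<phi>close)
  have gradbd: "norm (grad (\<phi> n) x) \<le> C" for n x
    using test
  proof (rule grad_norm_le_lipschitz)
    show "\<bar>\<phi> n x - \<phi> n z\<bar> \<le> C * dist x z" for x z
      unfolding \<phi>_def by (rule mollify_lipschitz[OF \<rho> vlip])
  qed
  \<comment> \<open>If \<open>w x = 0\<close>, then \<open>x\<close> is a minimum of
    \<open>w\<close>, so \<open>g x = 0\<close> and the truncation vanishes nearby. If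
    \<open>w x > 0\<close>, the truncation is eventually just \<open>w - e n\<close> near
    \<open>x\<close>. In both cases it is affine with gradient \<open>g x\<close>, which
    mollification preserves.\<close>
  have gradlim: "\<forall>\<^sub>F n in sequentially. grad (\<phi> n) x = g x"
    if "0 < \<delta>" and aff: "\<And>y. dist x y < \<delta> \<Longrightarrow> w y = w x + g x \<bullet> (y - x)" for x \<delta>
  proof (cases "w x = 0")
    case True
    have "g x = 0"
    proof (rule ccontr)
      assume "g x \<noteq> 0"
      define y where "y = x - (\<delta> / (2 * norm (g x))) *\<^sub>R g x"
      have "dist x y < \<delta>" using \<open>0 < \<delta>\<close> \<open>g x \<noteq> 0\<close> by (simp add: y_def dist_norm)
      from aff[OF this] True have "w y = - (\<delta> / (2 * norm (g x)) * (norm (g x))\<^sup>2)"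
        by (simp add: y_def power2_norm_eq_inner)
      moreover have "0 < \<delta> / (2 * norm (g x)) * (norm (g x))\<^sup>2"
        using \<open>0 < \<delta>\<close> \<open>g x \<noteq> 0\<close> by simp
      ultimately show False using nn[of y] by linarith
    qed
    have "\<forall>\<^sub>F n in sequentially. e n < \<delta> / 2"
      using order_tendstoD(2)[OF elim, of "\<delta> / 2"] \<open>0 < \<delta>\<close> by simp
    then show ?thesis
    proof eventually_elim
      case (elim n)
      show ?case unfolding \<phi>_def
      proof (rule grad_mollify_affine[OF _ r(1) _ \<rho> test[unfolded \<phi>_def]])
        show "v n y = 0 + g x \<bullet> y" if "dist x y < \<delta>" for y
          using aff[OF that] True \<open>g x = 0\<close> e[of n] by (simp add: v_def)
        show "2 * r n \<le> \<delta>" using elim r(2)[of n] by simp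
      qed
    qed
  next
    case False
    then have wx: "0 < w x" using nn[of x] by simp
    have "isCont w x" using cont by (simp add: continuous_on_eq_continuous_at)
    then obtain \<delta>' where \<delta>': "0 < \<delta>'" "\<And>y. dist y x < \<delta>' \<Longrightarrow> dist (w y) (w x) < w x / 2"
      using wx unfolding continuous_at_eps_delta by (metis half_gt_zero)
    define d where "d = min \<delta> \<delta>'"
    have "0 < min (d / 2) (w x / 2)" using \<open>0 < \<delta>\<close> \<delta>'(1) wx by (simp add: d_def)
    then have "\<forall>\<^sub>F n in sequentially. e n < min (d / 2) (w x / 2)"
      by (rule order_tendstoD(2)[OF elim])
    then show ?thesis
    proof eventually_elim
      case (elim n)
      show ?case unfolding \<phi>_def
      proof (rule grad_mollify_affine[OF _ r(1) _ \<rho> test[unfolded \<phi>_def]])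
        show "v n y = (w x - e n - g x \<bullet> x) + g x \<bullet> y" if "dist x y < d" for y
        proof -
          have "w y = w x + g x \<bullet> (y - x)" using that by (intro aff) (simp add: d_def)
          moreover have "dist (w y) (w x) < w x / 2"
            using that by (intro \<delta>'(2)) (simp add: d_def dist_commute)
          then have "e n \<le> w y" using elim by (auto simp: dist_real_def abs_if split: if_splits)
          ultimately show ?thesis by (simp add: v_def inner_diff_right)
        qed
        show "2 * r n \<le> d" using elim r(2)[of n] by simp
      qed
    qed
  qed
  have gradlim_AE: "AE x in lebesgue_on U. \<forall>\<^sub>F n in sequentially. grad (\<phi> n) x = g x"
    using affine by eventually_elim (use gradlim in blast)
  then have gradtends: "AE x in lebesgue_on U. (\<lambda>n. grad (\<phi> n) x) \<longlonglongrightarrow> g x"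
    by eventually_elim (rule tendsto_eventually)
  \<comment> \<open>No bound on \<open>g\<close> is assumed; it is inherited from the gradients of
    the approximations, which eventually coincide with \<open>g\<close>.\<close>
  have gbd: "AE x in lebesgue_on U. norm (g x) \<le> C"
    using gradlim_AE
  proof eventually_elim
    case (elim x)
    then obtain n where "grad (\<phi> n) x = g x" by (auto simp: eventually_sequentially)
    then show ?case using gradbd[of n x] by simp
  qed
  have \<phi>m: "\<phi> n \<in> borel_measurable (lebesgue_on U)" "grad (\<phi> n) \<in> borel_measurable (lebesgue_on U)" for n
    using test_function_L2[OF U(2,1) test] by (auto simp: L2_on_def)
  have wm: "w \<in> borel_measurable (lebesgue_on U)"
    using Ul by (intro continuous_imp_measurable_on_sets_lebesgue continuous_on_subset[OF cont]) auto
  have conv1: "(\<lambda>n. L2_norm U (\<lambda>x. \<phi> n x - w x)) \<longlonglongrightarrow> 0"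
    using Ul
  proof (rule L2_norm_tendsto_0_bounded)
    show "(\<lambda>x. \<phi> n x - w x) \<in> borel_measurable (lebesgue_on U)" for n
      using \<phi>m wm by measurable
    show "AE x in lebesgue_on U. norm (\<phi> n x - w x) \<le> C + 1" for n using \<phi>bd by simp
    show "AE x in lebesgue_on U. (\<lambda>n. \<phi> n x - w x) \<longlonglongrightarrow> 0" using \<phi>lim by simp
  qed
  have finU: "finite_measure (lebesgue_on U)" by (rule finite_measure_lebesgue_on[OF Ul])
  have L2g: "L2_on U g" by (rule L2_on_bounded[OF Ul gm gbd])
  have L2w: "L2_on U w"
  proof -
    have "L2_on U (\<lambda>x. \<phi> 0 x - (\<phi> 0 x - w x))"
    proof (rule L2_on_diff)
      show "L2_on U (\<phi> 0)" by (rule test_function_L2(1)[OF U(2,1) test])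
      show "L2_on U (\<lambda>x. \<phi> 0 x - w x)"
        using \<phi>m wm \<phi>bd by (intro L2_on_bounded[OF Ul, of _ "C + 1"]) auto
    qed
    then show ?thesis by simp
  qed
  have conv2: "(\<lambda>n. L2_norm U (\<lambda>x. grad (\<phi> n) x - g x)) \<longlonglongrightarrow> 0"
    using Ul
  proof (rule L2_norm_tendsto_0_bounded)
    show "(\<lambda>x. grad (\<phi> n) x - g x) \<in> borel_measurable (lebesgue_on U)" for n
      using \<phi>m gm by measurable
    show "AE x in lebesgue_on U. norm (grad (\<phi> n) x - g x) \<le> 2 * C" for n
      using gbd
    proof eventually_elim
      case (elim x)
      then show ?case
        using gradbd[of n x] norm_triangle_ineq4[of "grad (\<phi> n) x" "g x"] by linarith
    qed
    show "AE x in lebesgue_on U. (\<lambda>n. grad (\<phi> n) x - g x) \<longlonglongrightarrow> 0"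
      using gradtends by eventually_elim (rule LIM_zero)
  qed
  \<comment> \<open>Integration by parts holds for each smooth \<open>\<phi> n\<close>, and
    dominated convergence carries both sides to the limit.\<close>
  show weak: "has_weak_grad U w g"
    unfolding has_weak_grad_def
  proof (intro conjI L2w L2g allI impI)
    fix \<psi> assume \<psi>: "test_function U \<psi>"
    obtain B where B: "0 < B" "\<And>x. norm (grad \<psi> x) \<le> B" using grad_bounded[OF \<psi>] by metis
    obtain B' where B': "0 < B'" "\<And>x. norm (\<psi> x) \<le> B'" using test_function_bounded[OF \<psi>] by metis
    have \<psi>m: "\<psi> \<in> borel_measurable (lebesgue_on U)" "grad \<psi> \<in> borel_measurable (lebesgue_on U)"
      using test_function_L2[OF U(2,1) \<psi>] by (auto simp: L2_on_def)
    have iw: "integrable (lebesgue_on U) (\<lambda>x. w x *\<^sub>R grad \<psi> x)"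
      by (intro L2_on_scaled_integrable L2w test_function_L2[OF U(2,1) \<psi>])
    have i\<phi>: "integrable (lebesgue_on U) (\<lambda>x. \<phi> n x *\<^sub>R grad \<psi> x)" for n
      by (intro L2_on_scaled_integrable test_function_L2[OF U(2,1) \<psi>] test_function_L2[OF U(2,1) test])
    have "(\<lambda>n. \<integral>x. \<phi> n x *\<^sub>R grad \<psi> x \<partial>lebesgue_on U) \<longlonglongrightarrow> (\<integral>x. w x *\<^sub>R grad \<psi> x \<partial>lebesgue_on U)"
    proof (rule integral_dominated_convergence)
      show "integrable (lebesgue_on U) (\<lambda>x. norm (w x *\<^sub>R grad \<psi> x) + (C + 1) * B)"
        by (intro Bochner_Integration.integrable_add integrable_norm iw finite_measure.integrable_const[OF finU])
      show "(\<lambda>x. w x *\<^sub>R grad \<psi> x) \<in> borel_measurable (lebesgue_on U)" using iw by auto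
      show "(\<lambda>x. \<phi> n x *\<^sub>R grad \<psi> x) \<in> borel_measurable (lebesgue_on U)" for n using i\<phi> by auto
      have "(\<lambda>n. \<phi> n x) \<longlonglongrightarrow> w x" for x using \<phi>lim[of x] by (simp add: LIM_zero_iff)
      then show "AE x in lebesgue_on U. (\<lambda>n. \<phi> n x *\<^sub>R grad \<psi> x) \<longlonglongrightarrow> w x *\<^sub>R grad \<psi> x"
        by (intro AE_I2 tendsto_scaleR tendsto_const)
      have "norm (\<phi> n x *\<^sub>R grad \<psi> x) \<le> norm (w x *\<^sub>R grad \<psi> x) + (C + 1) * B" for n x
      proof -
        have "norm (\<phi> n x *\<^sub>R grad \<psi> x)
            = norm (w x *\<^sub>R grad \<psi> x + (\<phi> n x - w x) *\<^sub>R grad \<psi> x)"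
          by (simp add: scaleR_left_diff_distrib)
        also have "\<dots> \<le> norm (w x *\<^sub>R grad \<psi> x) + norm ((\<phi> n x - w x) *\<^sub>R grad \<psi> x)"
          by (rule norm_triangle_ineq)
        also have "norm ((\<phi> n x - w x) *\<^sub>R grad \<psi> x) \<le> (C + 1) * B"
          using mult_mono[OF \<phi>bd[of n x] B(2)[of x]] C by simp
        finally show ?thesis by simp
      qed
      then show "AE x in lebesgue_on U. norm (\<phi> n x *\<^sub>R grad \<psi> x) \<le> norm (w x *\<^sub>R grad \<psi> x) + (C + 1) * B" for n
        by simp
    qed
    moreover have "(\<lambda>n. \<integral>x. \<psi> x *\<^sub>R grad (\<phi> n) x \<partial>lebesgue_on U) \<longlonglongrightarrow> (\<integral>x. \<psi> x *\<^sub>R g x \<partial>lebesgue_on U)"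
    proof (rule integral_dominated_convergence)
      show "integrable (lebesgue_on U) (\<lambda>x. B' * C)" using finU by (rule finite_measure.integrable_const)
      show "(\<lambda>x. \<psi> x *\<^sub>R g x) \<in> borel_measurable (lebesgue_on U)" using \<psi>m gm by measurable
      show "(\<lambda>x. \<psi> x *\<^sub>R grad (\<phi> n) x) \<in> borel_measurable (lebesgue_on U)" for n using \<psi>m \<phi>m by measurable
      show "AE x in lebesgue_on U. (\<lambda>n. \<psi> x *\<^sub>R grad (\<phi> n) x) \<longlonglongrightarrow> \<psi> x *\<^sub>R g x"
        using gradtends by eventually_elim (intro tendsto_scaleR tendsto_const)
      have "norm (\<psi> x *\<^sub>R grad (\<phi> n) x) \<le> B' * C" for n x
        using mult_mono[OF B'(2)[of x] gradbd[of n x]] B'(1) by simp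
      then show "AE x in lebesgue_on U. norm (\<psi> x *\<^sub>R grad (\<phi> n) x) \<le> B' * C" for n by simp
    qed
    then have "(\<lambda>n. \<integral>x. \<phi> n x *\<^sub>R grad \<psi> x \<partial>lebesgue_on U) \<longlonglongrightarrow> - (\<integral>x. \<psi> x *\<^sub>R g x \<partial>lebesgue_on U)"
      unfolding test_function_integration_by_parts[OF U test \<psi>] by (rule tendsto_minus)
    ultimately show "(\<integral>x. w x *\<^sub>R grad \<psi> x \<partial>lebesgue_on U) = - (\<integral>x. \<psi> x *\<^sub>R g x \<partial>lebesgue_on U)"
      by (rule LIMSEQ_unique)
  qed
  show "w \<in> H10 U"
    unfolding H10_def mem_Collect_eq
    by (intro exI[of _ g] exI[of _ \<phi>] conjI allI weak test conv1 conv2)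
qed

section \<open>Hat functions\<close>

text \<open>The nodal basis function of \<open>z\<close>. On a conforming mesh the choice of the
  element is immaterial, since coordinates agree on common faces.\<close>

definition hat :: "('a::euclidean_space) mesh \<Rightarrow> 'a \<Rightarrow> 'a \<Rightarrow> real" where
  "hat T z x = (if \<exists>t\<in>T. z \<in> verts t \<and> x \<in> elem t
     then bary (verts (SOME t. t \<in> T \<and> z \<in> verts t \<and> x \<in> elem t)) z x else 0)"

text \<open>A representative of the gradient that uses element interiors only, so it is Borel
  measurable and the element boundaries need no decision.\<close>

definition hat_grad :: "('a::euclidean_space) mesh \<Rightarrow> 'a \<Rightarrow> 'a \<Rightarrow> 'a" where
  "hat_grad T z x = (\<Sum>t\<in>{t\<in>T. z \<in> verts t}. indicator (interior (elem t)) x *\<^sub>R bgrad (verts t) z)"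

lemma elem_compact: "compact (elem t)"
  by (simp add: elem_def verts_def finite_imp_compact_convex_hull)

lemma elem_convex: "convex (elem t)"
  by (simp add: elem_def)

context
  fixes U :: "'a::euclidean_space set" and T :: "'a mesh"
  assumes mesh: "conforming_mesh U T"
begin

lemma mesh_simplex: "t \<in> T \<Longrightarrow> full_simplex (verts t)"
  using mesh by (intro tagged_simplex_full) (simp add: conforming_mesh_def)

lemma mesh_Int: "t \<in> T \<Longrightarrow> t' \<in> T \<Longrightarrow> elem t \<inter> elem t' = convex hull (verts t \<inter> verts t')"
  using mesh by (simp add: conforming_mesh_def)

lemma mesh_cover: "(\<Union>t\<in>T. elem t) = closure U"
  using mesh by (simp add: conforming_mesh_def)

lemma mesh_finite: "finite T"
  using mesh by (simp add: conforming_mesh_def)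

text \<open>The point lies in the hull of the common vertices, and both coordinates read off the
  same coefficient of one convex combination.\<close>

lemma bary_agree:
  assumes t: "t \<in> T" "z \<in> verts t" "x \<in> elem t" and t': "t' \<in> T" "z \<in> verts t'" "x \<in> elem t'"
  shows "bary (verts t) z x = bary (verts t') z x"
proof -
  interpret S: full_simplex "verts t" using t(1) by (rule mesh_simplex)
  interpret S': full_simplex "verts t'" using t'(1) by (rule mesh_simplex)
  let ?W = "verts t \<inter> verts t'"
  have W: "finite ?W" using S.finite by blast
  have "x \<in> convex hull ?W" using mesh_Int[OF t(1) t'(1)] t(3) t'(3) by blast
  then obtain u where u: "sum u ?W = 1" "(\<Sum>w\<in>?W. u w *\<^sub>R w) = x"
    by (auto simp: convex_hull_finite[OF W])
  show ?thesis
    using S.bary_sum[OF W u(1) _ t(2)] S'.bary_sum[OF W u(1) _ t'(2)] u(2) by simp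
qed

text \<open>The point lies in the common face, and \<open>z\<close> is not a vertex of that
  face.\<close>

lemma bary_other_elem:
  assumes t: "t \<in> T" "z \<in> verts t" "x \<in> elem t" and t': "t' \<in> T" "z \<notin> verts t'" "x \<in> elem t'"
  shows "bary (verts t) z x = 0"
proof -
  interpret S: full_simplex "verts t" using t(1) by (rule mesh_simplex)
  have "x \<in> convex hull (verts t \<inter> verts t')" using mesh_Int[OF t(1) t'(1)] t(3) t'(3) by blast
  then show ?thesis using S.bary_subset_hull(2)[of "verts t \<inter> verts t'" x z] t(2) t'(2) by simp
qed

lemma hat_eq_bary:
  assumes "t \<in> T" "z \<in> verts t" "x \<in> elem t"
  shows "hat T z x = bary (verts t) z x"
proof -
  define s where "s = (SOME t. t \<in> T \<and> z \<in> verts t \<and> x \<in> elem t)"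
  have s: "s \<in> T \<and> z \<in> verts s \<and> x \<in> elem s"
    unfolding s_def by (rule someI[of _ t]) (use assms in simp)
  have "hat T z x = bary (verts s) z x" using assms by (auto simp: hat_def s_def)
  also have "\<dots> = bary (verts t) z x" using s assms by (intro bary_agree) auto
  finally show ?thesis .
qed

lemma hat_eq_0:
  assumes "t \<in> T" "z \<notin> verts t" "x \<in> elem t"
  shows "hat T z x = 0"
proof (cases "\<exists>s\<in>T. z \<in> verts s \<and> x \<in> elem s")
  case True
  then obtain s where s: "s \<in> T" "z \<in> verts s" "x \<in> elem s" by blast
  show ?thesis using hat_eq_bary[OF s] bary_other_elem[OF s assms] by simp
next
  case False
  then show ?thesis unfolding hat_def by (simp only: if_False)
qed

lemma hat_nonneg: "0 \<le> hat T z x"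
proof (cases "\<exists>s\<in>T. z \<in> verts s \<and> x \<in> elem s")
  case True
  then obtain s where s: "s \<in> T" "z \<in> verts s" "x \<in> elem s" by blast
  interpret full_simplex "verts s" using s(1) by (rule mesh_simplex)
  show ?thesis using hat_eq_bary[OF s] hull_iff[of x] s by (simp add: elem_def)
next
  case False
  then show ?thesis unfolding hat_def by (simp only: if_False order_refl)
qed

text \<open>Shrinking towards \<open>z\<close> maps neighbours of \<open>x\<close> into a ball around \<open>z\<close> inside \<open>U\<close>; the element
  containing the image of a neighbour also contains the neighbour itself.\<close>

lemma hat_pos_interior:
  assumes z: "z \<in> interior (closure U)" and pos: "0 < hat T z x"
  shows "x \<in> interior (closure U)"
proof -
  obtain t where t: "t \<in> T" "z \<in> verts t" "x \<in> elem t"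
    using pos unfolding hat_def by (auto split: if_splits)
  interpret S: full_simplex "verts t" using t(1) by (rule mesh_simplex)
  have bpos: "0 < bary (verts t) z x" using pos hat_eq_bary[OF t] by simp
  obtain e where e: "0 < e" "ball z e \<subseteq> closure U" using z by (auto simp: mem_interior)
  \<comment> \<open>The first term makes the shrinking proper, the second brings the image of
    \<open>x\<close> into the ball; \<open>+ 1\<close> covers \<open>x = z\<close>.\<close>
  define \<delta> where "\<delta> = min (1 / 2) (e / (2 * (norm (x - z) + 1)))"
  have \<delta>: "0 < \<delta>" "\<delta> < 1" using e(1) by (auto simp: \<delta>_def add_nonneg_pos)
  define h where "h y = z + \<delta> *\<^sub>R (y - z)" for y
  have bary_h: "bary V z (h y) = 1 - \<delta> + \<delta> * bary V z y" for V y
    by (simp add: h_def bary_convex_comb)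
  have conth: "continuous_on UNIV h" unfolding h_def by (intro continuous_intros)
  have "dist z (h x) = \<delta> * norm (x - z)" using \<delta> by (simp add: h_def dist_norm)
  also have "\<dots> \<le> e / (2 * (norm (x - z) + 1)) * norm (x - z)"
    by (intro mult_right_mono) (auto simp: \<delta>_def)
  also have "\<dots> < e" using e(1) by (simp add: divide_simps add_pos_nonneg) (smt (verit, best) mult_pos_pos norm_ge_zero mult_nonneg_nonneg)
  finally have hx: "h x \<in> ball z e" by simp
  \<comment> \<open>Removing the closed elements that miss \<open>h x\<close> ensures that every
    element containing some point of \<open>W\<close> also contains \<open>h x\<close>.\<close>
  define N where "N = {t'\<in>T. h x \<notin> elem t'}"
  define W where "W = ball z e - (\<Union>t'\<in>N. elem t')"
  have "open W"
    unfolding W_def N_def using mesh_finite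
    by (intro open_Diff open_ball closed_UN) (auto intro: compact_imp_closed elem_compact)
  have hxW: "h x \<in> W" using hx by (auto simp: W_def N_def)
  \<comment> \<open>Positivity of the coordinate of \<open>z\<close> is imposed separately, because
    \<open>h\<close> shifts this coordinate and its sign at \<open>y\<close> cannot be read off from
    \<open>h y\<close>.\<close>
  define O1 where "O1 = h -` W \<inter> (\<Inter>t'\<in>{t'\<in>T. 0 < bary (verts t') z x}. {y. 0 < bary (verts t') z y})"
  have "open (h -` W)" using conth \<open>open W\<close> by (rule open_vimage[rotated])
  moreover have "open (\<Inter>t'\<in>{t'\<in>T. 0 < bary (verts t') z x}. {y. 0 < bary (verts t') z y})"
    unfolding bary_def using mesh_finite
    by (intro open_INT ballI open_Collect_less) (auto intro!: continuous_intros)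
  ultimately have "open O1" unfolding O1_def by (rule open_Int)
  moreover have "x \<in> O1" using hxW by (auto simp: O1_def)
  moreover have "O1 \<subseteq> closure U"
  proof
    fix y assume y: "y \<in> O1"
    then have "h y \<in> W" by (simp add: O1_def)
    then have "h y \<in> closure U" using e(2) by (auto simp: W_def)
    then obtain t' where t': "t' \<in> T" "h y \<in> elem t'" using mesh_cover by blast
    have hx': "h x \<in> elem t'" using \<open>h y \<in> W\<close> t' unfolding W_def N_def by blast
    interpret S': full_simplex "verts t'" using t'(1) by (rule mesh_simplex)
    have "z \<in> elem t" using t(2) by (simp add: elem_def hull_inc)
    then have hxt: "h x \<in> elem t"
      using convexD_alt[OF elem_convex, of z t x \<delta>] t(3) \<delta> by (simp add: h_def algebra_simps)
    have bh: "0 < bary (verts t) z (h x)"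
      unfolding bary_h using \<delta> bpos by (simp add: add_pos_pos)
    \<comment> \<open>Otherwise \<open>h x\<close> would lie on a face opposite to \<open>z\<close>,
      where the coordinate vanishes.\<close>
    have zt': "z \<in> verts t'"
      using bary_other_elem[OF t(1,2) hxt t'(1) _ hx'] bh by auto
    have "bary (verts t') z (h x) = bary (verts t) z (h x)"
      by (rule bary_agree[OF t'(1) zt' hx' t(1,2) hxt])
    then have "bary (verts t') z x = bary (verts t) z x" using \<delta> by (simp add: bary_h)
    then have "0 < bary (verts t') z x" using bpos by simp
    then have bz: "0 < bary (verts t') z y" using y t'(1) unfolding O1_def by blast
    \<comment> \<open>Coordinates of vertices other than \<open>z\<close> vanish at
      \<open>z\<close>, so \<open>h\<close> only scales them by \<delta> and nonnegativity passes
      from \<open>h y\<close> back to \<open>y\<close>.\<close>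
    have "0 \<le> bary (verts t') v y" if v: "v \<in> verts t'" for v
    proof (cases "v = z")
      case False
      then have "bary (verts t') v z = 0" using S'.bary_other v zt' by simp
      then have "bary (verts t') v (h y) = \<delta> * bary (verts t') v y"
        by (simp add: h_def bary_convex_comb)
      moreover have "0 \<le> bary (verts t') v (h y)" using t'(2) v S'.hull_iff by (simp add: elem_def)
      ultimately show ?thesis using \<delta>(1) by (simp add: zero_le_mult_iff)
    qed (use bz in simp)
    then have "y \<in> elem t'" using S'.hull_iff by (simp add: elem_def)
    then show "y \<in> closure U" using mesh_cover t'(1) by blast
  qed
  ultimately show ?thesis by (rule interiorI)
qed

text \<open>On a segment the function is Lipschitz on finitely many closed parameter sets that cover
  the unit interval, and such bounds glue on an interval. The sum of the gradient norms is a simple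
  common bound for all pieces.\<close>

lemma hat_lipschitz:
  assumes z: "z \<in> interior (closure U)"
  shows "(\<Sum>t\<in>T. norm (bgrad (verts t) z))-lipschitz_on UNIV (hat T z)"
proof (rule lipschitz_onI)
  let ?C = "\<Sum>t\<in>T. norm (bgrad (verts t) z)"
  show C: "0 \<le> ?C" by (simp add: sum_nonneg)
  fix x y :: 'a
  define p where "p s = x + s *\<^sub>R (y - x)" for s :: real
  have contp: "continuous_on UNIV p" unfolding p_def by (intro continuous_intros)
  have distp: "dist (p s) (p s') = \<bar>s - s'\<bar> * dist x y" for s s'
    by (simp add: p_def dist_norm norm_minus_commute flip: scaleR_left_diff_distrib)
  \<comment> \<open>\<open>None\<close> stands for the part outside the interior of the closure,
    where the hat function vanishes; \<open>Some t\<close> for the part in the element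
    \<open>t\<close>.\<close>
  define V where "V i = (case i of None \<Rightarrow> p -` (- interior (closure U)) | Some t \<Rightarrow> p -` elem t)" for i
  have "(?C * dist x y)-lipschitz_on {0..1} (\<lambda>s. hat T z (p s))"
  proof (rule lipschitz_on_closed_Union[of "insert None (Some ` T)" _ V])
    fix i assume "i \<in> insert None (Some ` T)"
    then consider "i = None" | t where "t \<in> T" "i = Some t" by auto
    then have "closed (V i) \<and> (?C * dist x y)-lipschitz_on (V i) (\<lambda>s. hat T z (p s))"
    proof cases
      case 1
      have "hat T z (p s) = 0" if "s \<in> V i" for s
        using that 1 hat_pos_interior[OF z, of "p s"] hat_nonneg[of z "p s"] by (force simp: V_def)
      moreover have "closed (p -` (- interior (closure U)))"
        using contp by (intro closed_vimage) auto
      ultimately show ?thesis using 1 C by (auto simp: V_def intro!: lipschitz_onI)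
    next
      case (2 t)
      have "closed (p -` elem t)"
        using contp by (intro closed_vimage compact_imp_closed elem_compact)
      moreover have "dist (hat T z (p s)) (hat T z (p s')) \<le> ?C * dist x y * dist s s'"
        if s: "s \<in> V i" "s' \<in> V i" for s s'
      proof (cases "z \<in> verts t")
        case True
        have "dist (hat T z (p s)) (hat T z (p s')) \<le> norm (bgrad (verts t) z) * dist (p s) (p s')"
          using bary_lipschitz[of "verts t" z "p s" "p s'"] s 2 True by (simp add: V_def hat_eq_bary dist_real_def)
        also have "\<dots> \<le> ?C * dist (p s) (p s')"
          using 2(1) mesh_finite by (intro mult_right_mono member_le_sum) auto
        finally show ?thesis by (simp add: distp dist_real_def mult_ac)
      next
        case False
        then have "hat T z (p s) = 0" "hat T z (p s') = 0" using s 2 by (auto simp: V_def intro: hat_eq_0)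
        then show ?thesis using C by simp
      qed
      ultimately show ?thesis using 2 C by (auto simp: V_def intro!: lipschitz_onI)
    qed
    then show "closed (V i)" "(?C * dist x y)-lipschitz_on (V i) (\<lambda>s. hat T z (p s))" by auto
  next
    show "{0..1} \<subseteq> (\<Union>i\<in>insert None (Some ` T). V i)"
    proof
      fix s :: real
      show "s \<in> (\<Union>i\<in>insert None (Some ` T). V i)"
      proof (cases "p s \<in> interior (closure U)")
        case True
        then obtain t where "t \<in> T" "p s \<in> elem t" using mesh_cover interior_subset by blast
        then show ?thesis by (auto simp: V_def intro!: bexI[of _ t])
      qed (auto simp: V_def)
    qed
  qed (use mesh_finite C in auto)
  from lipschitz_onD[OF this, of 0 1]
  show "dist (hat T z x) (hat T z y) \<le> ?C * dist x y" by (simp add: p_def)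
qed

text \<open>Distinct elements have distinct vertex sets of equal size, so \<open>t\<close> has a
  vertex that \<open>t'\<close> lacks. Its coordinate vanishes on the common face but is positive in
  the interior of \<open>t\<close>.\<close>

lemma interior_elem_unique:
  assumes "t \<in> T" "t' \<in> T" "x \<in> interior (elem t)" "x \<in> elem t'"
  shows "t = t'"
proof (rule ccontr)
  assume "t \<noteq> t'"
  interpret S: full_simplex "verts t" using assms(1) by (rule mesh_simplex)
  interpret S': full_simplex "verts t'" using assms(2) by (rule mesh_simplex)
  have "verts t \<noteq> verts t'" using \<open>t \<noteq> t'\<close> assms mesh by (auto simp: conforming_mesh_def inj_on_def)
  moreover have "verts t = verts t'" if "verts t \<subseteq> verts t'"
    using that S.card S'.card S'.finite by (intro card_subset_eq) auto
  ultimately obtain v where v: "v \<in> verts t" "v \<notin> verts t'" by blast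
  have "x \<in> elem t" using assms(3) interior_subset by blast
  then have "bary (verts t) v x = 0" using bary_other_elem[OF assms(1) v(1) _ assms(2) v(2) assms(4)] by simp
  moreover have "0 < bary (verts t) v x" using S.interior_hullD[of x v] assms(3) v(1) by (simp add: elem_def)
  ultimately show False by simp
qed

lemma hat_grad_interior:
  assumes "t \<in> T" "x \<in> interior (elem t)"
  shows "hat_grad T z x = (if z \<in> verts t then bgrad (verts t) z else 0)"
proof -
  have "indicator (interior (elem s)) x *\<^sub>R bgrad (verts s) z = (if s = t then bgrad (verts t) z else 0)"
    if "s \<in> {t\<in>T. z \<in> verts t}" for s
    using that assms interior_elem_unique[OF assms(1) _ assms(2), of s] interior_subset[of "elem s"]
    by (auto simp: indicator_def)
  then have "hat_grad T z x = (\<Sum>s\<in>{t\<in>T. z \<in> verts t}. if s = t then bgrad (verts t) z else 0)"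
    unfolding hat_grad_def by (intro sum.cong refl)
  also have "\<dots> = (if z \<in> verts t then bgrad (verts t) z else 0)"
    using assms(1) mesh_finite by simp
  finally show ?thesis .
qed

lemma hat_affine_interior:
  assumes t: "t \<in> T" "x \<in> interior (elem t)"
  shows "\<exists>\<delta>>0. \<forall>y. dist x y < \<delta> \<longrightarrow> hat T z y = hat T z x + hat_grad T z x \<bullet> (y - x)"
proof -
  obtain \<delta> where \<delta>: "0 < \<delta>" "ball x \<delta> \<subseteq> elem t" using t(2) by (auto simp: mem_interior)
  have "hat T z y = hat T z x + hat_grad T z x \<bullet> (y - x)" if "dist x y < \<delta>" for y
  proof -
    have y: "y \<in> elem t" "x \<in> elem t" using that \<delta> by auto
    show ?thesis
    proof (cases "z \<in> verts t")
      case True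
      then show ?thesis
        using y t(1) hat_grad_interior[OF t, of z] by (simp add: hat_eq_bary bary_def inner_diff_right)
    next
      case False
      then show ?thesis using y t(1) hat_grad_interior[OF t, of z] by (simp add: hat_eq_0)
    qed
  qed
  with \<delta>(1) show ?thesis by blast
qed

text \<open>Boundaries of convex sets are null sets, and there are finitely many elements.\<close>

lemma AE_interior_elem: "AE x in lebesgue. x \<in> closure U \<longrightarrow> (\<exists>t\<in>T. x \<in> interior (elem t))"
proof -
  have "negligible (\<Union>t\<in>T. frontier (elem t))"
    using mesh_finite by (intro negligible_Union) (auto intro: negligible_convex_frontier elem_convex)
  then have "AE x in lebesgue. x \<notin> (\<Union>t\<in>T. frontier (elem t))"
    by (intro AE_not_in) (simp add: negligible_iff_null_sets)
  then show ?thesis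
  proof eventually_elim
    case (elim x)
    show ?case
    proof
      assume "x \<in> closure U"
      then obtain t where t: "t \<in> T" "x \<in> elem t" using mesh_cover by blast
      then have "x \<notin> frontier (elem t)" using elim by blast
      then have "x \<in> interior (elem t)" using t(2) closure_subset by (auto simp: frontier_def)
      with t(1) show "\<exists>t\<in>T. x \<in> interior (elem t)" by blast
    qed
  qed
qed

lemma hat_H10:
  assumes U: "bounded U" "open U" "interior (closure U) \<subseteq> U" and z: "z \<in> U"
  shows "hat T z \<in> H10 U" "has_weak_grad U (hat T z) (hat_grad T z)"
proof -
  have zi: "z \<in> interior (closure U)"
    using z U(2) closure_subset interior_maximal by blast
  have zero: "hat T z x = 0" if "x \<notin> U" for x
    using that U(3) hat_pos_interior[OF zi, of x] hat_nonneg[of z x] by force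
  have meas: "hat_grad T z \<in> borel_measurable (lebesgue_on U)"
  proof -
    have "hat_grad T z \<in> borel_measurable borel"
      unfolding hat_grad_def by (intro borel_measurable_sum borel_measurable_scaleR borel_measurable_indicator) auto
    then have "hat_grad T z \<in> borel_measurable lborel" by simp
    then have "hat_grad T z \<in> borel_measurable lebesgue" by (rule measurable_completion)
    then show ?thesis by (rule measurable_restrict_space1)
  qed
  have "AE x in lebesgue_on U. \<exists>t\<in>T. x \<in> interior (elem t)"
  proof (subst AE_restrict_space_iff)
    show "AE x in lebesgue. x \<in> U \<longrightarrow> (\<exists>t\<in>T. x \<in> interior (elem t))"
      using AE_interior_elem by eventually_elim (use closure_subset[of U] in blast)
  qed (use U(2) in simp)
  then have "AE x in lebesgue_on U. \<exists>\<delta>>0. \<forall>y. dist x y < \<delta> \<longrightarrow> hat T z y = hat T z x + hat_grad T z x \<bullet> (y - x)"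
    by eventually_elim (use hat_affine_interior in blast)
  from piecewise_affine_H10[OF U(1,2) hat_lipschitz[OF zi] hat_nonneg zero meas this]
  show "hat T z \<in> H10 U" "has_weak_grad U (hat T z) (hat_grad T z)" by auto
qed

end

lemma poly_deg_le_affine:
  assumes "1 \<le> p"
  shows "poly_deg_le p (\<lambda>x :: 'a::euclidean_space. a + c \<bullet> x)"
proof -
  define I where "I = {k :: 'a \<Rightarrow> nat. (\<forall>b. b \<notin> Basis \<longrightarrow> k b = 0) \<and> (\<Sum>b\<in>Basis. k b) \<le> p}"
  have "finite I"
  proof (rule finite_subset)
    have "k b \<le> p" if "k \<in> I" "b \<in> Basis" for k b
      using that member_le_sum[of b Basis k] by (auto simp: I_def)
    then show "I \<subseteq> {k. \<forall>b. (b \<in> Basis \<longrightarrow> k b \<in> {..p}) \<and> (b \<notin> Basis \<longrightarrow> k b = 0)}"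
      by (auto simp: I_def)
    show "finite {k :: 'a \<Rightarrow> nat. \<forall>b. (b \<in> Basis \<longrightarrow> k b \<in> {..p}) \<and> (b \<notin> Basis \<longrightarrow> k b = 0)}"
      by (rule finite_set_of_finite_funs) auto
  qed
  \<comment> \<open>\<open>E b\<close> is the unit multi-index of the coordinate
    \<open>b\<close>.\<close>
  define E where "E b = (\<lambda>b'. if b' = b then 1 else 0 :: nat)" for b :: 'a
  \<comment> \<open>Written as a sum of indicators, the coefficients allow the sums over
    multi-indices and coordinates to be exchanged without separating cases.\<close>
  define d where "d k = (if k = (\<lambda>_. 0) then a else 0) + (\<Sum>b\<in>Basis. if k = E b then c \<bullet> b else 0)" for k
  have 0: "(\<lambda>_. 0) \<in> I" by (simp add: I_def)
  have E: "E b \<in> I" if "b \<in> Basis" for b using that assms by (auto simp: I_def E_def)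
  have mono: "(\<Prod>b'\<in>Basis. (x \<bullet> b') ^ E b b') = x \<bullet> b" if "b \<in> Basis" for x b :: 'a
  proof -
    have "(\<Prod>b'\<in>Basis. (x \<bullet> b') ^ E b b') = (\<Prod>b'\<in>Basis. if b' = b then x \<bullet> b else 1)"
      by (intro prod.cong) (auto simp: E_def)
    then show ?thesis using that by simp
  qed
  have "(\<Sum>k\<in>I. d k * (\<Prod>b\<in>Basis. (x \<bullet> b) ^ k b)) = a + c \<bullet> x" for x
  proof -
    have "(\<Sum>k\<in>I. d k * (\<Prod>b\<in>Basis. (x \<bullet> b) ^ k b))
      = (\<Sum>k\<in>I. if k = (\<lambda>_. 0) then a else 0)
        + (\<Sum>k\<in>I. \<Sum>b\<in>Basis. if k = E b then (c \<bullet> b) * (x \<bullet> b) else 0)"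
      unfolding sum.distrib[symmetric]
    proof (intro sum.cong refl)
      fix k
      have "(\<Sum>b\<in>Basis. if k = E b then c \<bullet> b else 0) * (\<Prod>b\<in>Basis. (x \<bullet> b) ^ k b)
        = (\<Sum>b\<in>Basis. if k = E b then (c \<bullet> b) * (x \<bullet> b) else 0)"
        unfolding sum_distrib_right by (intro sum.cong refl) (auto simp: mono)
      moreover have "(if k = (\<lambda>_. 0) then a else 0) * (\<Prod>b\<in>Basis. (x \<bullet> b) ^ k b) = (if k = (\<lambda>_. 0) then a else 0)"
        by simp
      ultimately show "d k * (\<Prod>b\<in>Basis. (x \<bullet> b) ^ k b) = (if k = (\<lambda>_. 0) then a else 0)
        + (\<Sum>b\<in>Basis. if k = E b then (c \<bullet> b) * (x \<bullet> b) else 0)"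
        by (simp add: d_def distrib_right)
    qed
    also have "(\<Sum>k\<in>I. if k = (\<lambda>_. 0) then a else 0) = a" using 0 \<open>finite I\<close> by simp
    also have "(\<Sum>k\<in>I. \<Sum>b\<in>Basis. if k = E b then (c \<bullet> b) * (x \<bullet> b) else 0)
      = (\<Sum>b\<in>Basis. \<Sum>k\<in>I. if k = E b then (c \<bullet> b) * (x \<bullet> b) else 0)"
      by (rule sum.swap)
    also have "\<dots> = (\<Sum>b\<in>Basis. (c \<bullet> b) * (x \<bullet> b))"
      using E \<open>finite I\<close> by (intro sum.cong refl) simp
    also have "\<dots> = c \<bullet> x" by (rule euclidean_inner[symmetric])
    finally show ?thesis .
  qed
  then show ?thesis unfolding poly_deg_le_def I_def[symmetric] by (intro exI[of _ d]) simp
qed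

lemma nontrivial_fe_space:
  fixes P :: "('a::euclidean_space) problem"
  assumes mp: "model_problem P \<alpha> L" and adm: "nvb_admissible (Omega P) T\<^sub>0" and p: "1 \<le> p"
  obtains T v where "T \<in> meshes (Omega P) T\<^sub>0" "v \<in> fe_space P p T" "tnorm P v \<noteq> 0"
proof -
  let ?U = "Omega P"
  have U: "bounded ?U" "open ?U" "interior (closure ?U) \<subseteq> ?U" "lipschitz_domain ?U"
    using mp lipschitz_domain_interior_closure by (auto simp: model_problem_def lipschitz_domain_def)
  obtain T t z where T: "T \<in> meshes ?U T\<^sub>0" and t: "t \<in> T" "z \<in> verts t" and z: "z \<in> ?U"
    using admissible_interior_vertex[OF adm U(4)] by metis
  have mesh: "conforming_mesh ?U T" using T by (simp add: meshes_def)
  note H = hat_H10[OF mesh U(1-3) z]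
  have "\<exists>q. poly_deg_le p q \<and> ae_equal_on (elem s) (hat T z) q" if s: "s \<in> T" for s
  proof (cases "z \<in> verts s")
    case True
    have "bary (verts s) z = (\<lambda>x. (1 - bgrad (verts s) z \<bullet> z) + bgrad (verts s) z \<bullet> x)"
      by (auto simp: bary_def fun_eq_iff inner_diff_right)
    then have "poly_deg_le p (bary (verts s) z)" using poly_deg_le_affine[OF p] by simp
    moreover have "ae_equal_on (elem s) (hat T z) (bary (verts s) z)"
      unfolding ae_equal_on_def using hat_eq_bary[OF mesh s True] by (intro AE_I2) (simp add: space_restrict_space)
    ultimately show ?thesis by blast
  next
    case False
    have "poly_deg_le p (\<lambda>x :: 'a. 0)" using poly_deg_le_affine[OF p, of 0 0] by simp
    moreover have "ae_equal_on (elem s) (hat T z) (\<lambda>x. 0)"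
      unfolding ae_equal_on_def using hat_eq_0[OF mesh s False] by (intro AE_I2) (simp add: space_restrict_space)
    ultimately show ?thesis by blast
  qed
  then have fe: "hat T z \<in> fe_space P p T" using H(1) by (simp add: fe_space_def X_space_def)
  have "tnorm P (hat T z) \<noteq> 0"
  proof
    assume "tnorm P (hat T z) = 0"
    then have "AE x in lebesgue_on ?U. nabla P (hat T z) x = 0"
      using L2_norm_eq_0_iff[of ?U "nabla P (hat T z)"] X_space_L2(2)[of "hat T z" P] H(1)
      by (simp add: tnorm_def X_space_def)
    moreover have "AE x in lebesgue_on ?U. nabla P (hat T z) x = hat_grad T z x"
      by (rule has_weak_grad_unique[OF U(2,1) has_weak_grad_weak_grad[OF H(1)] H(2)])
    ultimately have "AE x in lebesgue_on ?U. hat_grad T z x = 0" by eventually_elim simp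
    then have ae: "AE x in lebesgue. x \<in> ?U \<longrightarrow> hat_grad T z x = 0"
      using U(2) by (simp add: AE_restrict_space_iff)
    interpret full_simplex "verts t" using mesh t(1) by (rule mesh_simplex)
    have "elem t \<subseteq> closure ?U" using mesh_cover[OF mesh] t(1) by blast
    then have sub: "interior (elem t) \<subseteq> ?U" using interior_mono U(3) by blast
    \<comment> \<open>In the interior of \<open>t\<close> the gradient is the nonzero constant
      \<open>bgrad (verts t) z\<close>. A vanishing gradient would make this open set null and hence
      empty, yet it contains the barycentre.\<close>
    have "AE x in lebesgue. x \<notin> interior (elem t)"
      using ae
    proof eventually_elim
      case (elim x)
      show ?case
      proof
        assume x: "x \<in> interior (elem t)"
        then have "hat_grad T z x = 0" using elim sub by blast
        then show False using hat_grad_interior[OF mesh t(1) x, of z] t(2) bgrad_nonzero by simp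
      qed
    qed
    then have "negligible (interior (elem t))"
      by (simp add: negligible_iff_null_sets AE_iff_null_sets)
    then have "interior (elem t) = {}" using open_not_negligible[OF open_interior] by blast
    moreover have "(\<Sum>v\<in>verts t. (1 / real (card (verts t))) *\<^sub>R v) \<in> interior (elem t)"
      unfolding elem_def
    proof (rule interior_hullI)
      fix v assume v: "v \<in> verts t"
      have "(\<Sum>v\<in>verts t. 1 / real (card (verts t))) = 1" using card by simp
      from bary_sum[OF finite this subset_refl v] v card
      show "0 < bary (verts t) v (\<Sum>v\<in>verts t. (1 / real (card (verts t))) *\<^sub>R v)" by simp
    qed
    ultimately show False by blast
  qed
  with T fe show ?thesis by (rule that)
qed

section \<open>Energy contraction\<close>

text \<open>The energy decrease of the linearization cannot exceed the total energy error, which is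
  at most quadratic in the distance to s. One discrete function at positive distance therefore
  limits \<open>C_star\<close>, independently of any run or solver.\<close>

lemma contraction_constant_positive:
  fixes P :: "('a::euclidean_space) problem"
  assumes mp: "model_problem P \<alpha> L" and adm: "nvb_admissible (Omega P) T\<^sub>0" and p: "1 \<le> p"
    and exact: "\<forall>T\<in>meshes (Omega P) T\<^sub>0. discrete_solution P (fe_space P p T) (ustar T)"
    and lin: "linearization_form P a C_ell C_cnt" "linearization_step P p T\<^sub>0 a \<Phi>"
      "energy_decrease P p T\<^sub>0 \<Phi> C_star"
  shows "2 * C_star / L * (\<alpha>\<^sup>2 / C_cnt\<^sup>2) \<le> 1"
proof -
  have pos: "0 < \<alpha>" "0 < L" "0 < C_cnt" "0 < C_star"
    using model_problem_domain(3)[OF mp] lin by (auto simp: admissible_coefficient_def linearization_form_def energy_decrease_def)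
  obtain T v where T: "T \<in> meshes (Omega P) T\<^sub>0" and v: "v \<in> fe_space P p T" "tnorm P v \<noteq> 0"
    using nontrivial_fe_space[OF mp adm p] by metis
  define s where "s = ustar T"
  have s: "discrete_solution P (fe_space P p T) s" using exact T by (simp add: s_def)
  then have sT: "s \<in> fe_space P p T" by (simp add: discrete_solution_def)
  \<comment> \<open>Subtracting \<open>v\<close> from the exact solution prescribes the error: it is
    \<open>v\<close>, with nonzero norm.\<close>
  define u where "u = (\<lambda>x. s x - v x)"
  have u: "u \<in> fe_space P p T" unfolding u_def by (rule fe_space_diff[OF mp sT v(1)])
  have "tdist P s u = tnorm P v" by (simp add: tdist_def u_def)
  then have su: "0 < tdist P s u" using v(2) tdist_nonneg[of P s u] by simp
  have step: "\<Phi> T u \<in> fe_space P p T"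
    "\<And>v. v \<in> fe_space P p T \<Longrightarrow> a u (\<Phi> T u) v = a u u v + F_rhs P v - A_op P u v"
    using lin(2) T u unfolding linearization_step_def by blast+
  have "\<alpha> * tdist P s u \<le> C_cnt * tdist P (\<Phi> T u) u"
    by (rule discrete_error_bound[OF mp s u lin(1) step])
  then have "(\<alpha> * tdist P s u)\<^sup>2 \<le> (C_cnt * tdist P (\<Phi> T u) u)\<^sup>2"
    using pos su by (intro power_mono) auto
  then have 1: "\<alpha>\<^sup>2 / C_cnt\<^sup>2 * (tdist P s u)\<^sup>2 \<le> (tdist P (\<Phi> T u) u)\<^sup>2"
    using pos by (simp add: power_mult_distrib field_simps)
  have "C_star * (tdist P (\<Phi> T u) u)\<^sup>2 \<le> d2 P (\<Phi> T u) u"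
    using lin(3) T u by (simp add: energy_decrease_def)
  \<comment> \<open>\<open>s\<close> minimises the energy over the space that contains
    \<open>\<Phi> T u\<close>.\<close>
  also have "\<dots> \<le> d2 P s u"
    using discrete_solution_energy(1)[OF mp s step(1)] by (simp add: d2_def)
  also have "\<dots> \<le> L / 2 * (tdist P s u)\<^sup>2"
    using discrete_solution_energy(2)[OF mp s u]
      tdist_commute[OF mp fe_space_X_space[OF u] fe_space_X_space[OF sT]] by simp
  finally have 2: "C_star * (tdist P (\<Phi> T u) u)\<^sup>2 \<le> L / 2 * (tdist P s u)\<^sup>2" .
  have "C_star * (\<alpha>\<^sup>2 / C_cnt\<^sup>2 * (tdist P s u)\<^sup>2) \<le> L / 2 * (tdist P s u)\<^sup>2"
    by (rule order_trans[OF mult_left_mono[OF 1] 2]) (use pos in simp)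
  then have "(C_star * (\<alpha>\<^sup>2 / C_cnt\<^sup>2)) * (tdist P s u)\<^sup>2 \<le> L / 2 * (tdist P s u)\<^sup>2"
    by (simp only: mult.assoc)
  then have "C_star * (\<alpha>\<^sup>2 / C_cnt\<^sup>2) \<le> L / 2"
    using su by (simp only: mult_le_cancel_right_pos zero_less_power)
  then show ?thesis using pos by (simp add: field_simps)
qed

text \<open>Only the first contraction is counted and later steps merely do not increase the
  distance, so the constant does not depend on the number of solver steps.\<close>

lemma solver_iterate_close:
  assumes solver: "algebraic_solver P p T\<^sub>0 \<Phi> \<Psi> q" and T: "T \<in> meshes (Omega P) T\<^sub>0"
    and u: "u \<in> fe_space P p T" and j: "1 \<le> j"
  shows "tdist P (\<Phi> T u) ((\<Psi> T (\<Phi> T u) ^^ j) u) \<le> q * tdist P (\<Phi> T u) u"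
  using j
proof (induction j rule: nat_induct_at_least)
  have step: "tdist P (\<Phi> T u) ((\<Psi> T (\<Phi> T u) ^^ j) u)
      \<le> q * tdist P (\<Phi> T u) ((\<Psi> T (\<Phi> T u) ^^ (j - 1)) u)" if "1 \<le> j" for j
    using solver T u that unfolding algebraic_solver_def by blast
  have q: "0 < q" "q < 1" using solver by (auto simp: algebraic_solver_def)
  {
    case base
    show ?case using step[of 1] by simp
  next
    case (Suc n)
    have "tdist P (\<Phi> T u) ((\<Psi> T (\<Phi> T u) ^^ Suc n) u) \<le> q * tdist P (\<Phi> T u) ((\<Psi> T (\<Phi> T u) ^^ n) u)"
      using step[of "Suc n"] by (simp del: funpow.simps)
    also have "\<dots> \<le> 1 * tdist P (\<Phi> T u) ((\<Psi> T (\<Phi> T u) ^^ n) u)"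
      by (rule mult_right_mono) (use q tdist_nonneg in auto)
    also have "\<dots> \<le> q * tdist P (\<Phi> T u) u" using Suc.IH by simp
    finally show ?case .
  }
qed

theorem proposition7:
  fixes P :: "('a::euclidean_space) problem"
    and T\<^sub>0 :: "'a mesh"
    and a :: "('a \<Rightarrow> real) \<Rightarrow> ('a \<Rightarrow> real) \<Rightarrow> ('a \<Rightarrow> real) \<Rightarrow> real"
    and \<Phi> :: "'a mesh \<Rightarrow> ('a \<Rightarrow> real) \<Rightarrow> ('a \<Rightarrow> real)"
    and \<Psi> :: "'a mesh \<Rightarrow> ('a \<Rightarrow> real) \<Rightarrow> ('a \<Rightarrow> real) \<Rightarrow> ('a \<Rightarrow> real)"
    and ustar :: "'a mesh \<Rightarrow> 'a \<Rightarrow> real"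
    and u\<^sub>0 :: "'a \<Rightarrow> real"
    and R :: "'a run"
    and c :: params
    and p :: nat
    and \<alpha> L C_ell C_cnt C_star C_nrg q_alg :: real
  assumes problem: "model_problem P \<alpha> L"
    and mesh: "nvb_admissible (Omega P) T\<^sub>0"
    and degree: "1 \<le> p"
    and exact: "\<forall>T\<in>meshes (Omega P) T\<^sub>0. discrete_solution P (fe_space P p T) (ustar T)"
    and linearization: "linearization_form P a C_ell C_cnt" "linearization_step P p T\<^sub>0 a \<Phi>"
      "energy_decrease P p T\<^sub>0 \<Phi> C_star"
    and solver: "algebraic_solver P p T\<^sub>0 \<Phi> \<Psi> q_alg"
    and estimator: "estimator_well_defined P p T\<^sub>0"
    and params: "admissible_params c"
    and initial: "u\<^sub>0 \<in> fe_space P p T\<^sub>0"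
    and run: "ailfem_run P c \<Phi> \<Psi> T\<^sub>0 u\<^sub>0 R"
    and C_nrg: "0 < C_nrg" "C_nrg < C_star"
      "\<forall>l k. (l, k, 0) \<in> index_set P c R \<and> 1 \<le> k \<and> j_last P c R l k \<noteq> \<infinity> \<longrightarrow>
         C_nrg * (tdist P (last_iter P c R l k) (last_iter P c R l (k - 1)))\<^sup>2
           \<le> d2 P (last_iter P c R l k) (last_iter P c R l (k - 1))"
  shows "\<exists>q_nrg::real.
    0 < q_nrg \<and>
    q_nrg \<le> 1 - 2 * C_nrg / L * (\<alpha>\<^sup>2 / C_cnt\<^sup>2) * (1 - q_alg)\<^sup>2 \<and>
    1 - 2 * C_nrg / L * (\<alpha>\<^sup>2 / C_cnt\<^sup>2) * (1 - q_alg)\<^sup>2 < 1 \<and>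
    (\<forall>(l, k) \<in> completed P c R.
       0 \<le> d2 P (ustar (level_mesh R l)) (last_iter P c R l k) \<and>
       d2 P (ustar (level_mesh R l)) (last_iter P c R l k)
         \<le> q_nrg * d2 P (ustar (level_mesh R l)) (last_iter P c R l (k - 1))) \<and>
    (\<forall>(l, k) \<in> completed P c R.
       (1 - q_nrg) / q_nrg * d2 P (ustar (level_mesh R l)) (last_iter P c R l k)
         \<le> d2 P (last_iter P c R l k) (last_iter P c R l (k - 1)) \<and>
       d2 P (last_iter P c R l k) (last_iter P c R l (k - 1))
         \<le> d2 P (ustar (level_mesh R l)) (last_iter P c R l (k - 1)))"
proof -
  \<comment> \<open>The upper bound itself serves as the witness.\<close>
  define q where "q = 1 - 2 * C_nrg / L * (\<alpha>\<^sup>2 / C_cnt\<^sup>2) * (1 - q_alg)\<^sup>2"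
  have pos: "0 < \<alpha>" "0 < L" "0 < C_cnt" "0 < q_alg" "q_alg < 1"
    using model_problem_domain(3)[OF problem] linearization(1) solver
    by (auto simp: admissible_coefficient_def linearization_form_def algebraic_solver_def)
  have conf: "conforming_mesh (Omega P) T\<^sub>0" using mesh by (simp add: nvb_admissible_def)
  have "0 < 2 * C_nrg / L * (\<alpha>\<^sup>2 / C_cnt\<^sup>2) * (1 - q_alg)\<^sup>2"
    using pos C_nrg(1) by simp
  then have q1: "q < 1" by (simp add: q_def)
  \<comment> \<open>Dropping the solver factor and enlarging \<open>C_nrg\<close> to
    \<open>C_star\<close>, the latter strictly, reduces this to the bound that does not involve the
    run.\<close>
  have q0: "0 < q"
  proof -
    have "2 * C_nrg / L * (\<alpha>\<^sup>2 / C_cnt\<^sup>2) * (1 - q_alg)\<^sup>2 \<le> 2 * C_nrg / L * (\<alpha>\<^sup>2 / C_cnt\<^sup>2) * 1"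
      using pos C_nrg(1) by (intro mult_left_mono power_le_one) auto
    also have "\<dots> < 2 * C_star / L * (\<alpha>\<^sup>2 / C_cnt\<^sup>2)"
      using pos C_nrg(2) by (simp add: divide_strict_right_mono)
    also have "\<dots> \<le> 1"
      by (rule contraction_constant_positive[OF problem mesh degree exact linearization])
    finally show ?thesis by (simp add: q_def)
  qed
  have main: "0 \<le> d2 P (ustar (level_mesh R l)) (last_iter P c R l k) \<and>
      d2 P (ustar (level_mesh R l)) (last_iter P c R l k)
         \<le> q * d2 P (ustar (level_mesh R l)) (last_iter P c R l (k - 1))"
    if lk: "(l, k) \<in> completed P c R" for l k
  proof -
    define T u w s where "T = level_mesh R l" and "u = last_iter P c R l (k - 1)"
      and "w = last_iter P c R l k" and "s = ustar T"
    note C = completed_iterates[OF conf solver initial run lk, folded T_def u_def w_def]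
    have s: "discrete_solution P (fe_space P p T) s" using exact C(1) by (simp add: s_def)
    then have sT: "s \<in> fe_space P p T" by (simp add: discrete_solution_def)
    have step: "\<Phi> T u \<in> fe_space P p T"
      "\<And>v. v \<in> fe_space P p T \<Longrightarrow> a u (\<Phi> T u) v = a u u v + F_rhs P v - A_op P u v"
      using linearization(2) C(1,2) unfolding linearization_step_def by blast+
    obtain j where j: "1 \<le> j" "w = (\<Psi> T (\<Phi> T u) ^^ j) u" using C(5) by blast
    have "tdist P (\<Phi> T u) w \<le> q_alg * tdist P (\<Phi> T u) u"
      using solver_iterate_close[OF solver C(1,2) j(1)] j(2) by simp
    moreover have "tdist P (\<Phi> T u) u \<le> tdist P (\<Phi> T u) w + tdist P w u"
      using step(1) C(2,3) by (intro tdist_triangle[OF problem] fe_space_X_space)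
    ultimately have "(1 - q_alg) * tdist P (\<Phi> T u) u \<le> tdist P w u"
      by (simp add: algebra_simps)
    moreover have "\<alpha> / C_cnt * tdist P s u \<le> tdist P (\<Phi> T u) u"
      using discrete_error_bound[OF problem s C(2) linearization(1) step] pos by (simp add: field_simps)
    ultimately have "(1 - q_alg) * (\<alpha> / C_cnt * tdist P s u) \<le> tdist P w u"
      using pos mult_left_mono[of "\<alpha> / C_cnt * tdist P s u" "tdist P (\<Phi> T u) u" "1 - q_alg"] by simp
    then have "((1 - q_alg) * (\<alpha> / C_cnt * tdist P s u))\<^sup>2 \<le> (tdist P w u)\<^sup>2"
      using pos by (intro power_mono mult_nonneg_nonneg tdist_nonneg) auto
    then have sq: "(1 - q_alg)\<^sup>2 * (\<alpha>\<^sup>2 / C_cnt\<^sup>2) * (tdist P s u)\<^sup>2 \<le> (tdist P w u)\<^sup>2"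
      by (simp add: power_mult_distrib power_divide mult.assoc)
    have "j_last P c R l k \<noteq> \<infinity>" "1 \<le> k" using lk by (auto simp: completed_def)
    then have nrg: "C_nrg * (tdist P w u)\<^sup>2 \<le> d2 P w u"
      using C_nrg(3) C(4) by (simp add: w_def u_def)
    have "tdist P u s = tdist P s u"
      by (rule tdist_commute[OF problem fe_space_X_space[OF C(2)] fe_space_X_space[OF sT]])
    then have su: "2 / L * d2 P s u \<le> (tdist P s u)\<^sup>2"
      using discrete_solution_energy(2)[OF problem s C(2)] pos by (simp add: field_simps)
    \<comment> \<open>Chosen so that \<open>1 - q = 2 / L * A\<close>; \<open>A\<close> collects the
      constants between the squared error and the energy decrease.\<close>
    define A where "A = C_nrg * ((1 - q_alg)\<^sup>2 * (\<alpha>\<^sup>2 / C_cnt\<^sup>2))"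
    have "0 \<le> A" using pos C_nrg(1) by (simp add: A_def)
    have "(1 - q) * d2 P s u = A * (2 / L * d2 P s u)"
      by (simp add: q_def A_def field_simps)
    also have "\<dots> \<le> A * (tdist P s u)\<^sup>2"
      using su \<open>0 \<le> A\<close> by (rule mult_left_mono)
    also have "\<dots> \<le> C_nrg * (tdist P w u)\<^sup>2"
      using mult_left_mono[OF sq, of C_nrg] C_nrg(1) by (simp add: A_def mult.assoc)
    also note nrg
    \<comment> \<open>Energy differences telescope, so a lower bound for the decrease is a
      contraction of the error.\<close>
    also have "d2 P w u = d2 P s u - d2 P s w" by (simp add: d2_def)
    finally have "d2 P s w \<le> q * d2 P s u" by (simp add: algebra_simps)
    moreover have "0 \<le> d2 P s w" by (rule discrete_solution_energy(1)[OF problem s C(3)])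
    ultimately show ?thesis by (simp add: s_def T_def u_def w_def)
  qed
  \<comment> \<open>Pure arithmetic of the telescoping identity: the upper bound uses the
    nonnegative error of \<open>w\<close>, the lower one the contraction and division by the
    positive \<open>q\<close>.\<close>
  have cons: "(1 - q) / q * d2 P s w \<le> d2 P w u \<and> d2 P w u \<le> d2 P s u"
    if "0 \<le> d2 P s w" "d2 P s w \<le> q * d2 P s u" for s w u
  proof -
    have eq: "d2 P w u = d2 P s u - d2 P s w" by (simp add: d2_def)
    have "(1 - q) * d2 P s w \<le> q * d2 P w u" using that(2) by (simp add: eq algebra_simps)
    then show ?thesis using q0 that(1) by (simp add: eq field_simps)
  qed
  show ?thesis
  proof (intro exI[of _ q] conjI)
    show "q \<le> 1 - 2 * C_nrg / L * (\<alpha>\<^sup>2 / C_cnt\<^sup>2) * (1 - q_alg)\<^sup>2" by (simp only: q_def order_refl)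
    show "1 - 2 * C_nrg / L * (\<alpha>\<^sup>2 / C_cnt\<^sup>2) * (1 - q_alg)\<^sup>2 < 1" using q1 by (simp only: q_def)
  qed (use q0 main cons in auto)
qed

end
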